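(* Let $G$ be a planar graph with minimum degree $\delta(G)\ge 2$ and girth $g(G)\ge 14$. Then $\chi_{eq}^*(G)\le 3$; that is, $G$ has an equitable $n$-coloring for every integer $n\ge 3$.
   Context: A proper vertex $k$-coloring of a graph $G$ is equitable if the sizes of any two color classes differ by at most one. The equitable chromatic threshold $\chi_{eq}^*(G)$ is the smallest integer $m$ such that $G$ is equitably $n$-colorable for all $n\ge m$. The girth $g(G)$ is the length of a shortest cycle in $G$. *)

theory Defs
  imports "HOL-Analysis.Analysis" "HOL-Library.Extended_Nat" "Graph_Theory.Arc_Walk"
begin

text \<open>
  Finite simple graphs are the symmetric, loop-free digraphs without parallel arcs of the locale
  \<^locale>\<open>graph\<close>: an undirected edge \<open>{u, v}\<close> is represented by the two arcs \<open>u \<rightarrow> v\<close> and \<open>v \<rightarrow> u\<close>.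
\<close>

definition uedges :: "('a, 'b) pre_digraph \<Rightarrow> 'a set set" where
  "uedges G = {{u, v} | u v. (u, v) \<in> arcs_ends G}"

text \<open>
  In a \<^locale>\<open>graph\<close>, \<^const>\<open>out_degree\<close> counts the neighbours of a vertex. The value for the
  graph without vertices is unspecified.
\<close>

definition min_degree :: "('a, 'b) pre_digraph \<Rightarrow> nat" where
  "min_degree G = Min (out_degree G ` verts G)"

text \<open>
  \<^const>\<open>pre_digraph.cycle\<close> also accepts the closed walk \<open>u \<rightarrow> v \<rightarrow> u\<close> along a single undirected
  edge; the length bound excludes it. The girth of a forest is \<open>\<infinity>\<close>.
\<close>

definition girth :: "('a, 'b) pre_digraph \<Rightarrow> enat" where
  "girth G = (INF p \<in> {p. pre_digraph.cycle G p \<and> 3 \<le> length p}. enat (length p))"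

text \<open>
  A drawing in the plane, with \<^typ>\<open>complex\<close> as the plane: \<open>p\<close> places the vertices, and
  \<open>\<gamma> e\<close> is a simple (Jordan) arc joining the ends of the undirected edge \<open>e\<close>. An arc meets the
  vertex points only in its own ends, and two different arcs only in common ends.
\<close>

definition plane_drawing ::
  "('a, 'b) pre_digraph \<Rightarrow> ('a \<Rightarrow> complex) \<Rightarrow> ('a set \<Rightarrow> real \<Rightarrow> complex) \<Rightarrow> bool" where
  "plane_drawing G p \<gamma> \<longleftrightarrow>
     inj_on p (verts G) \<and>
     (\<forall>e \<in> uedges G.
        arc (\<gamma> e) \<and>
        {pathstart (\<gamma> e), pathfinish (\<gamma> e)} = p ` e \<and>
        path_image (\<gamma> e) \<inter> p ` verts G = p ` e) \<and>
     (\<forall>e \<in> uedges G. \<forall>f \<in> uedges G. e \<noteq> f \<longrightarrow>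
        path_image (\<gamma> e) \<inter> path_image (\<gamma> f) \<subseteq> p ` (e \<inter> f))"

definition planar :: "('a, 'b) pre_digraph \<Rightarrow> bool" where
  "planar G \<longleftrightarrow> (\<exists>p \<gamma>. plane_drawing G p \<gamma>)"

definition proper_coloring :: "('a, 'b) pre_digraph \<Rightarrow> nat \<Rightarrow> ('a \<Rightarrow> nat) \<Rightarrow> bool" where
  "proper_coloring G k c \<longleftrightarrow>
     c ` verts G \<subseteq> {..<k} \<and> (\<forall>(u, v) \<in> arcs_ends G. c u \<noteq> c v)"

definition color_class :: "('a, 'b) pre_digraph \<Rightarrow> ('a \<Rightarrow> nat) \<Rightarrow> nat \<Rightarrow> 'a set" where
  "color_class G c i = {v \<in> verts G. c v = i}"

text \<open>All \<open>k\<close> colour classes are compared, including those that are empty.\<close>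

definition equitable_coloring :: "('a, 'b) pre_digraph \<Rightarrow> nat \<Rightarrow> ('a \<Rightarrow> nat) \<Rightarrow> bool" where
  "equitable_coloring G k c \<longleftrightarrow>
     proper_coloring G k c \<and>
     (\<forall>i < k. \<forall>j < k. card (color_class G c i) \<le> card (color_class G c j) + 1)"

definition equitably_colorable :: "('a, 'b) pre_digraph \<Rightarrow> nat \<Rightarrow> bool" where
  "equitably_colorable G k \<longleftrightarrow> (\<exists>c. equitable_coloring G k c)"

text \<open>
  For a finite graph without loops the minimum exists: colouring injectively shows that
  every \<open>n \<ge> card (verts G)\<close> is admissible.
\<close>

definition eq_chromatic_threshold :: "('a, 'b) pre_digraph \<Rightarrow> nat" where
  "eq_chromatic_threshold G = (LEAST m. \<forall>n \<ge> m. equitably_colorable G n)"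

end

theory Submission
  imports Defs "HOL-Library.Multiset"
begin

text \<open>
  Euler's formula bounds the number of edges: a plane graph with girth at least 14 and its subgraphs
  satisfy \<open>6 e < 7 n\<close>. Only an inequality is needed, and it follows from the Jordan curve theorem and
  Janiszewski's theorem: an edge that closes a cycle splits a face, an edge borders at most two faces,
  and the edges around a face contain a cycle, unless there is only one face.

  Now take a minimal counterexample for \<open>m\<close> colours. If a set of vertices can be removed without
  creating vertices of degree less than two, then the rest has an equitable colouring, so some balanced
  distribution of colours on the removed set must fail to extend it. Paths of vertices of degree two
  that end in vertices of larger degree (threads) can be removed in this sense unless they have at most
  two inner vertices or, for three colours, four. For \<open>m \<ge> 4\<close>, cubic vertices with two threads of
  length two and no thread of length zero can be removed as well. For \<open>m = 3\<close>, the vertices of larger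
  degree that carry long threads can be removed together with their threads, giving all removed vertices
  of larger degree the same colour; the one exception, cubic vertices with threads of lengths 4, 1, 1,
  can be removed together with suitable neighbours. A discharging argument shows that one of these
  configurations occurs.
\<close>

section \<open>Arcs and components of plane complements\<close>

text \<open>The counterexample is a subset \<open>W\<close> of a fixed graph, and it is compared
  only with subsets of minimum degree two; the empty set qualifies, and the girth and 6e < 7n pass
  to all of them. Hence a configuration is removable only if each outside hub keeps two neighbours.
  Girth mostly ensures this: threads are short, so two removed threads ending in one hub would close
  a short cycle. Extending a colouring equitably means meeting prescribed class sizes on the removed
  set, so every balanced distribution has to be realised there. Three colours are harder because a
  thread of length four can fail when its ends share a colour; this is why whole hubs, and stars of
  hubs, are removed with all their threads. The constants: girth 14 gives 12e < 14n, so the charges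
  6 deg - 14 have a negative sum. A vertex of degree two has charge -2, which the two ends of its
  thread repay. A cubic hub has 4 units to spend, while threads of lengths 4, 1, 1 cost 6.\<close>

lemma interior_arc_empty:
  fixes g :: "real \<Rightarrow> complex"
  assumes "arc g"
  shows "interior (path_image g) = {}"
proof (rule ccontr)
  assume ne: "interior (path_image g) \<noteq> {}"
  obtain f where f: "homeomorphism {0..1} (path_image g) g f"
    using homeomorphism_arc[OF assms] by blast
  have "continuous_on (interior (path_image g)) f"
    using f interior_subset continuous_on_subset unfolding homeomorphism_def by metis
  moreover have "inj_on f (interior (path_image g))"
    using f interior_subset[of "path_image g"] unfolding homeomorphism_def
    by (metis inj_on_inverseI subset_iff)
  ultimately have "DIM(complex) \<le> DIM(real)"
    using invariance_of_dimension[OF _ open_interior _ ne] by blast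
  then show False by simp
qed

lemma component_subset_component:
  assumes "C \<in> components S" "S \<subseteq> T"
  obtains F where "F \<in> components T" "C \<subseteq> F"
proof -
  have "C \<noteq> {}" "C \<subseteq> T" "connected C"
    using assms in_components_nonempty in_components_subset in_components_connected by blast+
  moreover from this have "T \<noteq> {}" by blast
  ultimately obtain F where "F \<in> components T" "C \<subseteq> F" using exists_component_superset[of C T] by blast
  then show ?thesis by (rule that)
qed

text \<open>By invariance of dimension an arc has empty interior, so it cannot cover an open face of
  \<open>- X\<close>. Hence sending each component of the smaller complement to the component of
  \<open>- X\<close> around it is onto.\<close>

lemma card_components_add_arc:
  fixes X :: "complex set" and g :: "real \<Rightarrow> complex"
  assumes X: "closed X" and g: "arc g" and fin: "finite (components (- (X \<union> path_image g)))"
  shows "card (components (- X)) \<le> card (components (- (X \<union> path_image g)))"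
proof -
  define Y where "Y = X \<union> path_image g"
  define \<phi> where "\<phi> C = (SOME F. F \<in> components (- X) \<and> C \<subseteq> F)" for C
  have phi: "\<phi> C \<in> components (- X) \<and> C \<subseteq> \<phi> C" if "C \<in> components (- Y)" for C
  proof -
    have "\<exists>F. F \<in> components (- X) \<and> C \<subseteq> F"
      using component_subset_component[OF that, of "- X"] unfolding Y_def by blast
    then show ?thesis unfolding \<phi>_def by (rule someI_ex)
  qed
  have "components (- X) \<subseteq> \<phi> ` components (- Y)"
  proof
    fix F assume F: "F \<in> components (- X)"
    then have "open F" using X open_components by blast
    moreover have "F \<noteq> {}" using F in_components_nonempty by blast
    ultimately have "\<not> F \<subseteq> path_image g"
      using interior_arc_empty[OF g] interior_maximal by blast
    then obtain z where z: "z \<in> F" "z \<notin> path_image g" by blast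
    then have "z \<in> - Y" using F in_components_subset unfolding Y_def by fastforce
    then obtain C where C: "C \<in> components (- Y)" "z \<in> C"
      by (metis UnionE Union_components)
    then have "\<phi> C = F" using phi[OF C(1)] F z components_nonoverlap by blast
    then show "F \<in> \<phi> ` components (- Y)" using C by blast
  qed
  then show ?thesis using fin surj_card_le unfolding Y_def by blast
qed

text \<open>\<open>X\<close> may be disconnected; whether the ends of \<open>g\<close> are already
  joined inside \<open>X\<close> decides if adding \<open>g\<close> splits a face.\<close>

locale arc_attached =
  fixes X :: "complex set" and g :: "real \<Rightarrow> complex"
  assumes compact_X: "compact X" and arc_g: "arc g"
    and meet: "path_image g \<inter> X = {pathstart g, pathfinish g}"
begin

definition open_arc :: "complex set" where
  "open_arc = path_image g - {pathstart g, pathfinish g}"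

lemma open_arc_connected: "connected open_arc"
  unfolding open_arc_def using arc_g by (simp add: connected_simple_path_endless arc_imp_simple_path)

lemma open_arc_nonempty: "open_arc \<noteq> {}"
  unfolding open_arc_def using nonempty_simple_path_endless[of g] arc_g by (simp add: arc_imp_simple_path)

lemma open_arc_disjoint: "open_arc \<subseteq> - X"
  unfolding open_arc_def using meet by blast

text \<open>A path in \<open>X\<close> between the ends of \<open>g\<close> contains an arc
  \<open>h\<close>, and \<open>g\<close> followed by \<open>h\<close> is a Jordan curve
  \<open>J\<close>. The form is tailored to Janiszewski's theorem: \<open>X \<inter> J\<close> is
  the image of \<open>h\<close>, hence connected, and adding \<open>J\<close> to \<open>X\<close>
  has the same effect as adding \<open>g\<close>.\<close>

lemma jordan_curve_through:
  assumes "path_component X (pathstart g) (pathfinish g)"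
  obtains J I O' where "compact J" "path_image g \<subseteq> J" "J \<subseteq> X \<union> path_image g" "X \<union> path_image g = X \<union> J"
    "connected (X \<inter> J)" "open I" "open O'" "connected I" "connected O'" "I \<inter> O' = {}" "I \<union> O' = - J"
    "frontier I = J" "frontier O' = J"
proof -
  have neq: "pathstart g \<noteq> pathfinish g" using arc_distinct_ends[OF arc_g] by metis
  obtain b where "path b" "path_image b \<subseteq> X" "pathstart b = pathstart g" "pathfinish b = pathfinish g"
    using assms unfolding path_component_def by blast
  then obtain h where h: "arc h" "path_image h \<subseteq> path_image b"
      "pathstart h = pathfinish g" "pathfinish h = pathstart g"
    using path_contains_arc[of "reversepath b" "pathfinish g" "pathstart g"] neq by auto
  have hX: "path_image h \<subseteq> X" using h(2) \<open>path_image b \<subseteq> X\<close> by blast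
  let ?c = "g +++ h"
  have "path_image g \<inter> path_image h \<subseteq> {pathstart g, pathstart h}"
    using meet hX h(3) by auto
  then have c: "simple_path ?c" "pathfinish ?c = pathstart ?c"
    using simple_path_join_loop_eq[of h g] h arc_g by auto
  have pc: "path_image ?c = path_image g \<union> path_image h"
    using h(3) by (simp add: path_image_join)
  have "{pathstart g, pathfinish g} \<subseteq> path_image h"
    using h(3,4) pathstart_in_path_image[of h] pathfinish_in_path_image[of h] by auto
  then have "X \<inter> path_image ?c = path_image h"
    unfolding pc using meet hX by blast
  then have "connected (X \<inter> path_image ?c)"
    using h(1) connected_arc_image by simp
  moreover have "compact (path_image ?c)" using c(1) compact_simple_path_image by blast
  ultimately show thesis
    using that[of "path_image ?c" "inside (path_image ?c)" "outside (path_image ?c)"] Jordan_inside_outside[OF c] pc hX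
    by auto
qed

text \<open>Two points of \<open>F\<close> on the same side of \<open>J\<close> are separated
  neither by \<open>X\<close> nor by \<open>J\<close>, so by Janiszewski's theorem not by the union.
  The set \<open>I\<close>, one side of \<open>J\<close>, acts as a two-valued label; in this form
  the statement combines with the case of unjoined ends, where a single label suffices.\<close>

lemma same_side_connected:
  assumes "path_component X (pathstart g) (pathfinish g)"
    and F: "F \<in> components (- X)"
  shows "\<exists>I. \<forall>x\<in>F - path_image g. \<forall>y\<in>F - path_image g.
    (x \<in> I \<longleftrightarrow> y \<in> I) \<longrightarrow> connected_component (- (X \<union> path_image g)) x y"
proof -
  obtain J I O' where J: "compact J" "path_image g \<subseteq> J" "J \<subseteq> X \<union> path_image g"
      "X \<union> path_image g = X \<union> J" "connected (X \<inter> J)" "open I" "open O'" "connected I" "connected O'"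
      "I \<inter> O' = {}" "I \<union> O' = - J" "frontier I = J" "frontier O' = J"
    by (rule jordan_curve_through[OF assms(1)])
  have "connected_component (- (X \<union> path_image g)) x y"
    if x: "x \<in> F - path_image g" and y: "y \<in> F - path_image g" and xy: "x \<in> I \<longleftrightarrow> y \<in> I" for x y
    unfolding J(4)
  proof (rule Janiszewski)
    show "compact X" "closed J" "connected (X \<inter> J)"
      using compact_X J(1,5) compact_imp_closed by auto
    have "connected F" "F \<subseteq> - X" using F in_components_connected in_components_subset by blast+
    then show "connected_component (- X) x y"
      using x y unfolding connected_component_def by blast
    have "x \<notin> J" "y \<notin> J" using x y J(3) \<open>F \<subseteq> - X\<close> by blast+
    then have "x \<in> I \<and> y \<in> I \<or> x \<in> O' \<and> y \<in> O'" using xy J(11) by blast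
    then show "connected_component (- J) x y"
      unfolding connected_component_def using J(8,9,11) by blast
  qed
  then show ?thesis by blast
qed

text \<open>Both sides of \<open>J\<close> have all of \<open>J\<close> as frontier, so near a point
  of the open arc the open set \<open>F\<close> contains points of either side.\<close>

lemma both_sides_met:
  assumes "path_component X (pathstart g) (pathfinish g)"
    and F: "F \<in> components (- X)" "open_arc \<subseteq> F"
  obtains C D where "C \<in> components (- (X \<union> path_image g))" "D \<in> components (- (X \<union> path_image g))"
    "C \<noteq> D" "C \<subseteq> F" "D \<subseteq> F"
proof -
  obtain J I O' where J: "compact J" "path_image g \<subseteq> J" "J \<subseteq> X \<union> path_image g"
      "X \<union> path_image g = X \<union> J" "connected (X \<inter> J)" "open I" "open O'" "connected I" "connected O'"
      "I \<inter> O' = {}" "I \<union> O' = - J" "frontier I = J" "frontier O' = J"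
    by (rule jordan_curve_through[OF assms(1)])
  obtain z where z: "z \<in> open_arc" using open_arc_nonempty by blast
  have oF: "open F" using F(1) compact_X compact_imp_closed open_components by blast
  have FX: "F \<subseteq> - X" using F(1) in_components_subset by blast
  have zJ: "z \<in> J" using z J(2) unfolding open_arc_def by blast
  have "z \<in> closure I" "z \<in> closure O'" using zJ J(12,13) unfolding frontier_def by auto
  then have "F \<inter> closure I \<noteq> {}" "F \<inter> closure O' \<noteq> {}" using z F(2) by auto
  then have "F \<inter> I \<noteq> {}" "F \<inter> O' \<noteq> {}" using open_Int_closure_eq_empty[OF oF] by simp_all
  then obtain x y where x: "x \<in> I" "x \<in> F" and y: "y \<in> O'" "y \<in> F" by auto
  have nin: "x \<in> - (X \<union> path_image g)" "y \<in> - (X \<union> path_image g)"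
    unfolding J(4) using x y FX J(11) by auto
  obtain C D where C: "C \<in> components (- (X \<union> path_image g))" "x \<in> C"
    and D: "D \<in> components (- (X \<union> path_image g))" "y \<in> D"
    using nin by (metis UnionE Union_components)
  have sub: "E \<subseteq> F" if "E \<in> components (- (X \<union> path_image g))" "w \<in> E" "w \<in> F" for E w
    using components_maximal[OF F(1) in_components_connected[OF that(1)]] in_components_subset[OF that(1)] that by blast
  have "C \<noteq> D"
  proof
    assume "C = D"
    have "connected C" "C \<subseteq> I \<union> O'" using C(1) in_components_connected in_components_subset unfolding J(4,11) by blast+
    then show False using connectedD[of C I O'] J(6,7,10) x y C D \<open>C = D\<close> by blast
  qed
  then show thesis using that C D sub x y by blast
qed

text \<open>\<open>X\<close> falls into the part \<open>X1\<close> joined to the start of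
  \<open>g\<close> and the rest \<open>X2\<close>. The arc meets each of them in a single point, so
  Janiszewski's theorem applies to \<open>X1\<close> and \<open>g\<close>, and then to their union
  and \<open>X2\<close>. The finite family \<open>P\<close> makes both parts closed.\<close>

lemma separated_ends_connected:
  assumes ends: "\<not> path_component X (pathstart g) (pathfinish g)"
    and P: "X = \<Union>P" "finite P" "\<And>K. K \<in> P \<Longrightarrow> closed K \<and> path_connected K"
    and F: "F \<in> components (- X)" "x \<in> F - path_image g" "y \<in> F - path_image g"
  shows "connected_component (- (X \<union> path_image g)) x y"
proof -
  define A where "A = path_image g"
  define P1 where "P1 = {K \<in> P. K \<subseteq> path_component_set X (pathstart g)}"
  define X1 where "X1 = \<Union>P1"
  define X2 where "X2 = \<Union>(P - P1)"
  have X12: "X = X1 \<union> X2" unfolding X1_def X2_def P1_def using P(1) by blast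
  have outside: "K \<inter> path_component_set X (pathstart g) = {}" if K: "K \<in> P - P1" for K
  proof (rule ccontr)
    assume "K \<inter> path_component_set X (pathstart g) \<noteq> {}"
    then obtain w where w: "w \<in> K" "path_component X (pathstart g) w" by auto
    have "path_component X w v" if "v \<in> K" for v
      using P(1,3) K w(1) that path_component_of_subset[of K X]
      unfolding path_connected_component by (metis DiffD1 Union_upper)
    then have "K \<subseteq> path_component_set X (pathstart g)"
      using w(2) path_component_trans by blast
    then show False using K unfolding P1_def by blast
  qed
  have cl: "closed X1" "closed X2"
    unfolding X1_def X2_def P1_def using P(2,3) by (auto intro!: closed_Union)
  then have co: "compact X1" "compact X2"
    using compact_X X12 by (metis compact_Int_closed inf_sup_absorb sup_commute inf_commute)+
  have disj: "X1 \<inter> X2 = {}" using outside unfolding X1_def X2_def P1_def by blast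
  have sX: "pathstart g \<in> X" "pathfinish g \<in> X" using meet by blast+
  have s: "pathstart g \<in> X1"
  proof -
    have "pathstart g \<in> path_component_set X (pathstart g)" using sX(1) path_component_refl by auto
    then show ?thesis using outside sX(1) X12 unfolding X2_def by blast
  qed
  have "X1 \<subseteq> path_component_set X (pathstart g)" unfolding X1_def P1_def by blast
  then have f: "pathfinish g \<in> X2" using ends sX(2) X12 by blast
  have FX: "connected F" "F \<subseteq> - X" using F(1) in_components_connected in_components_subset by blast+
  have "connected_component (- X) x y"
    using FX F(2,3) unfolding connected_component_def by blast
  then have c12: "connected_component (- X1) x y" "connected_component (- X2) x y"
    using X12 connected_component_of_subset by (metis Compl_anti_mono sup_ge1, metis Compl_anti_mono sup_ge2)
  have conA: "connected (- A)" unfolding A_def using connected_arc_complement[OF arc_g] by simp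
  have "x \<in> - A" "y \<in> - A" using F(2,3) unfolding A_def by auto
  then have cA: "connected_component (- A) x y"
    using conA unfolding connected_component_def by blast
  have cX1A: "connected_component (- (X1 \<union> A)) x y"
  proof (rule Janiszewski[OF co(1) _ _ c12(1) cA])
    show "closed A" unfolding A_def using arc_g closed_arc_image by blast
    have "X1 \<inter> A = {pathstart g}" unfolding A_def using meet s f disj X12 by blast
    then show "connected (X1 \<inter> A)" by simp
  qed
  have "connected_component (- ((X1 \<union> A) \<union> X2)) x y"
  proof (rule Janiszewski[OF _ cl(2) _ cX1A c12(2)])
    show "compact (X1 \<union> A)" unfolding A_def using co(1) arc_g compact_arc_image by blast
    have "A \<inter> X2 \<subseteq> {pathstart g, pathfinish g}" "pathstart g \<notin> X2" "pathfinish g \<in> A"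
      unfolding A_def using meet s disj X12 by auto
    then have "A \<inter> X2 = {pathfinish g}" using f by auto
    then have "(X1 \<union> A) \<inter> X2 = {pathfinish g}" using disj by (simp add: Int_Un_distrib2)
    then show "connected ((X1 \<union> A) \<inter> X2)" by simp
  qed
  moreover have "(X1 \<union> A) \<union> X2 = X \<union> path_image g" using X12 by (simp only: A_def Un_ac)
  ultimately show ?thesis by simp
qed

text \<open>Components inside \<open>F\<close> are told apart by whether a chosen point of each lies
  in \<open>I\<close>, so there are no more of them than truth values.\<close>

lemma at_most_two_sides:
  assumes P: "X = \<Union>P" "finite P" "\<And>K. K \<in> P \<Longrightarrow> closed K \<and> path_connected K"
    and F: "F \<in> components (- X)"
  shows "finite {C \<in> components (- (X \<union> path_image g)). C \<subseteq> F} \<and>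
    card {C \<in> components (- (X \<union> path_image g)). C \<subseteq> F} \<le> 2"
proof -
  obtain I where I: "\<And>x y. \<lbrakk>x \<in> F - path_image g; y \<in> F - path_image g; x \<in> I \<longleftrightarrow> y \<in> I\<rbrakk>
      \<Longrightarrow> connected_component (- (X \<union> path_image g)) x y"
  proof (cases "path_component X (pathstart g) (pathfinish g)")
    case True
    from same_side_connected[OF True F] obtain I where
      "\<forall>x\<in>F - path_image g. \<forall>y\<in>F - path_image g.
        (x \<in> I \<longleftrightarrow> y \<in> I) \<longrightarrow> connected_component (- (X \<union> path_image g)) x y" ..
    then show ?thesis by (intro that[of I]) blast+
  next
    case False
    show ?thesis
      by (rule that[of UNIV], rule separated_ends_connected[OF False P F], assumption+)
  qed
  let ?S = "{C \<in> components (- (X \<union> path_image g)). C \<subseteq> F}"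
  define pt where "pt C = (SOME x. x \<in> C)" for C :: "complex set"
  have pt: "pt C \<in> C" if "C \<in> ?S" for C
  proof -
    have "C \<noteq> {}" using that in_components_nonempty by blast
    then show ?thesis unfolding pt_def by (simp add: some_in_eq)
  qed
  have "inj_on (\<lambda>C. pt C \<in> I) ?S"
  proof (rule inj_onI)
    fix C D assume C: "C \<in> ?S" and D: "D \<in> ?S" and eq: "(pt C \<in> I) = (pt D \<in> I)"
    have "C \<subseteq> - (X \<union> path_image g)" "D \<subseteq> - (X \<union> path_image g)" using C D in_components_subset by blast+
    then have "pt C \<in> F - path_image g" "pt D \<in> F - path_image g"
      using pt[OF C] pt[OF D] C D by auto
    then have "connected_component (- (X \<union> path_image g)) (pt C) (pt D)" using I eq by blast
    then obtain T where T: "connected T" "T \<subseteq> - (X \<union> path_image g)" "pt C \<in> T" "pt D \<in> T"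
      unfolding connected_component_def by blast
    have "T \<subseteq> C" using components_maximal[of C "- (X \<union> path_image g)" T] T pt[OF C] C by blast
    then show "C = D" using components_nonoverlap[of C "- (X \<union> path_image g)" D] C D pt[OF D] T(4) by blast
  qed
  then have "finite ?S" "card ?S \<le> card (UNIV :: bool set)"
    using inj_on_finite[of "\<lambda>C. pt C \<in> I" ?S "UNIV :: bool set"]
      card_inj_on_le[of "\<lambda>C. pt C \<in> I" ?S "UNIV :: bool set"] by (blast intro: finite)+
  then show ?thesis by simp
qed

text \<open>Only the face \<open>F\<close> that contains the open arc is affected; every other face
  survives unchanged. If the ends are joined, \<open>F\<close> gives way to at least two new
  faces.\<close>

lemma card_components_add:
  assumes P: "X = \<Union>P" "finite P" "\<And>K. K \<in> P \<Longrightarrow> closed K \<and> path_connected K"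
    and fin: "finite (components (- X))"
  shows "finite (components (- (X \<union> path_image g)))"
    and "path_component X (pathstart g) (pathfinish g) \<Longrightarrow>
      card (components (- X)) < card (components (- (X \<union> path_image g)))"
proof -
  let ?Y = "X \<union> path_image g"
  obtain F where F: "F \<in> components (- X)" "open_arc \<subseteq> F"
    using exists_component_superset[OF open_arc_disjoint _ open_arc_connected] open_arc_nonempty open_arc_disjoint
    by blast
  have other: "D \<in> components (- ?Y)" if D: "D \<in> components (- X)" "D \<noteq> F" for D
  proof (rule components_intermediate_subset[OF D(1)])
    have "D \<inter> F = {}" using components_nonoverlap[OF D(1) F(1)] D(2) by blast
    moreover have "D \<subseteq> - X" using D(1) in_components_subset by blast
    ultimately show "D \<subseteq> - ?Y" using F(2) meet unfolding open_arc_def by blast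
  qed blast
  let ?S = "{C \<in> components (- ?Y). C \<subseteq> F}"
  have "components (- ?Y) \<subseteq> components (- X) \<union> ?S"
  proof
    fix C assume C: "C \<in> components (- ?Y)"
    then obtain D where D: "D \<in> components (- X)" "C \<subseteq> D"
      using component_subset_component[OF C, of "- X"] by blast
    show "C \<in> components (- X) \<union> ?S"
    proof (cases "D = F")
      case False
      then have "D \<in> components (- ?Y)" using other D(1) by blast
      moreover have "C \<noteq> {}" using C in_components_nonempty by blast
      ultimately have "C = D" using components_nonoverlap[OF C] D(2) by blast
      then show ?thesis using D by blast
    qed (use C D in blast)
  qed
  then show fin': "finite (components (- ?Y))"
    using fin at_most_two_sides[OF P F(1)] finite_subset by blast
  assume "path_component X (pathstart g) (pathfinish g)"
  then obtain C D where CD: "C \<in> components (- ?Y)" "D \<in> components (- ?Y)" "C \<noteq> D" "C \<subseteq> F" "D \<subseteq> F"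
    using both_sides_met F by blast
  have new: "E \<notin> components (- X) - {F}" if "E \<in> components (- ?Y)" "E \<subseteq> F" for E
  proof
    assume "E \<in> components (- X) - {F}"
    then have "E \<inter> F = {}" using components_nonoverlap[of E "- X" F] F(1) by auto
    then show False using in_components_nonempty[OF that(1)] that(2) by auto
  qed
  then have "(components (- X) - {F}) \<inter> {C, D} = {}" using CD by auto
  then have "card ((components (- X) - {F}) \<union> {C, D}) = card (components (- X) - {F}) + card {C, D}"
    using fin by (intro card_Un_disjoint) simp_all
  moreover have "(components (- X) - {F}) \<union> {C, D} \<subseteq> components (- ?Y)"
    using other CD(1,2) by (simp add: subset_iff)
  ultimately have "card (components (- X) - {F}) + 2 \<le> card (components (- ?Y))"
    using card_mono[OF fin', of "(components (- X) - {F}) \<union> {C, D}"] CD(3) by simp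
  moreover have "card (components (- X) - {F}) + 1 = card (components (- X))"
    using card_Suc_Diff1[OF fin F(1)] by simp
  ultimately show "card (components (- X)) < card (components (- ?Y))" by linarith
qed

end

section \<open>Euler's inequality\<close>

locale plane_graph =
  fixes V :: "'a set" and E :: "'a set set" and p :: "'a \<Rightarrow> complex" and \<gamma> :: "'a set \<Rightarrow> real \<Rightarrow> complex"
  assumes finite_V: "finite V"
    and edge: "e \<in> E \<Longrightarrow> \<exists>u v. u \<in> V \<and> v \<in> V \<and> u \<noteq> v \<and> e = {u, v}"
    and inj_p: "inj_on p V"
    and arc_edge: "e \<in> E \<Longrightarrow> arc (\<gamma> e)"
    and ends_edge: "e \<in> E \<Longrightarrow> {pathstart (\<gamma> e), pathfinish (\<gamma> e)} = p ` e"
    and edge_meets_vertices: "e \<in> E \<Longrightarrow> path_image (\<gamma> e) \<inter> p ` V = p ` e"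
    and edges_meet: "e \<in> E \<Longrightarrow> f \<in> E \<Longrightarrow> e \<noteq> f \<Longrightarrow> path_image (\<gamma> e) \<inter> path_image (\<gamma> f) \<subseteq> p ` (e \<inter> f)"
begin

definition drawing :: "'a set \<Rightarrow> 'a set set \<Rightarrow> complex set" where
  "drawing U F = p ` U \<union> (\<Union>e\<in>F. path_image (\<gamma> e))"

text \<open>These are the closed path-connected sets that serve as the family \<open>P\<close> in
  \<open>separated_ends_connected\<close>.\<close>

definition pieces :: "'a set \<Rightarrow> 'a set set \<Rightarrow> complex set set" where
  "pieces U F = (\<lambda>v. {p v}) ` U \<union> (\<lambda>e. path_image (\<gamma> e)) ` F"

lemma edge_subset: "e \<in> E \<Longrightarrow> e \<subseteq> V"
  using edge by blast

lemma finite_E: "finite E"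
  using finite_V edge_subset by (meson PowI finite_Pow_iff finite_subset subsetI)

lemma drawing_pieces:
  assumes "U \<subseteq> V" "F \<subseteq> E"
  shows "drawing U F = \<Union>(pieces U F)" "finite (pieces U F)"
    "K \<in> pieces U F \<Longrightarrow> closed K \<and> path_connected K"
proof -
  have "finite U" "finite F" using assms finite_V finite_E finite_subset by blast+
  then show "drawing U F = \<Union>(pieces U F)" "finite (pieces U F)"
    unfolding drawing_def pieces_def by auto
  show "closed K \<and> path_connected K" if "K \<in> pieces U F"
    using that arc_edge assms(2) unfolding pieces_def
    by (auto intro: closed_arc_image path_connected_path_image arc_imp_path)
qed

lemma compact_drawing:
  assumes "U \<subseteq> V" "F \<subseteq> E"
  shows "compact (drawing U F)"
proof -
  have "finite U" "finite F" using assms finite_V finite_E finite_subset by blast+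
  then show ?thesis using arc_edge assms(2) unfolding drawing_def
    by (intro compact_Un compact_UN) (auto intro: compact_arc_image finite_imp_compact)
qed

lemma edge_meets_drawing:
  assumes "e \<in> E" "F \<subseteq> E" "e \<notin> F" "U \<subseteq> V"
  shows "path_image (\<gamma> e) \<inter> drawing U F = p ` e \<inter> drawing U F"
proof -
  have "path_image (\<gamma> e) \<inter> p ` U \<subseteq> p ` e" using edge_meets_vertices[OF assms(1)] assms(4) by blast
  moreover have "path_image (\<gamma> e) \<inter> path_image (\<gamma> f) \<subseteq> p ` e" if "f \<in> F" for f
    using edges_meet[of e f] assms that by blast
  moreover have "p ` e \<subseteq> path_image (\<gamma> e)" using edge_meets_vertices[OF assms(1)] by blast
  ultimately show ?thesis unfolding drawing_def by blast
qed

lemma edge_attached: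
  assumes "e \<in> E" "F \<subseteq> E" "e \<notin> F"
  shows "arc_attached (drawing V F) (\<gamma> e)"
proof
  show "compact (drawing V F)" using compact_drawing assms by blast
  show "arc (\<gamma> e)" using arc_edge assms by blast
  have "p ` e \<subseteq> drawing V F" using edge_subset[OF assms(1)] unfolding drawing_def by blast
  then show "path_image (\<gamma> e) \<inter> drawing V F = {pathstart (\<gamma> e), pathfinish (\<gamma> e)}"
    using edge_meets_drawing[OF assms(1,2,3), of V] ends_edge[OF assms(1)] by auto
qed

lemma drawing_insert: "drawing U (insert e F) = drawing U F \<union> path_image (\<gamma> e)"
  unfolding drawing_def by blast

lemma components_complement_finite:
  assumes "finite (S :: complex set)"
  shows "components (- S) = {- S}"
proof -
  have "connected (- S)"
    using path_connected_complement_countable[of S] countable_finite[OF assms]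
    by (simp add: path_connected_imp_connected)
  moreover have "- S \<noteq> {}"
  proof
    assume "- S = {}"
    then have "S = UNIV" by blast
    then show False using assms infinite_UNIV_char_0[where 'a=complex] by simp
  qed
  ultimately show ?thesis by (simp add: components_eq_sing_iff)
qed

text \<open>
  The labelling \<open>L\<close> is a union-find structure: vertices with equal labels are joined in the drawing, and
  the number of labels drops by at most one per edge.
\<close>

lemma euler_inequality_aux:
  assumes "finite F" "F \<subseteq> E"
  shows "finite (components (- drawing V F)) \<and>
    (\<exists>L :: 'a \<Rightarrow> 'a. (\<forall>u\<in>V. \<forall>v\<in>V. L u = L v \<longrightarrow> path_component (drawing V F) (p u) (p v)) \<and>
         card F + card (L ` V) + 1 \<le> card (components (- drawing V F)) + card V)"
  using assms
proof (induction F rule: finite_induct)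
  case empty
  have comps: "components (- drawing V {}) = {- drawing V {}}"
    by (rule components_complement_finite) (simp add: drawing_def finite_V)
  have "path_component (drawing V {}) (p u) (p u)" if "u \<in> V" for u
    using that by (intro path_component_refl) (simp add: drawing_def)
  then show ?case unfolding comps by (intro conjI exI[of _ id]) auto
next
  case (insert e F)
  let ?X = "drawing V F" and ?Y = "drawing V (insert e F)"
  have e: "e \<in> E" "F \<subseteq> E" using insert.prems by auto
  interpret arc_attached ?X "\<gamma> e" using edge_attached e insert.hyps by blast
  obtain L :: "'a \<Rightarrow> 'a" where fin: "finite (components (- ?X))"
    and L: "\<And>u v. u \<in> V \<Longrightarrow> v \<in> V \<Longrightarrow> L u = L v \<Longrightarrow> path_component ?X (p u) (p v)"
    and le: "card F + card (L ` V) + 1 \<le> card (components (- ?X)) + card V"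
    using insert.IH[OF e(2)] by blast
  have Y: "?Y = ?X \<union> path_image (\<gamma> e)" by (rule drawing_insert)
  note add = card_components_add[OF drawing_pieces(1,2,3)[OF order_refl e(2)] fin, folded Y]
  have mono: "path_component ?Y a b" if "path_component ?X a b" for a b
    using path_component_of_subset[OF _ that, of ?Y] unfolding Y by blast
  obtain u v where uv: "u \<in> V" "v \<in> V" "e = {u, v}" using edge e(1) by blast
  then have puv: "{pathstart (\<gamma> e), pathfinish (\<gamma> e)} = {p u, p v}" using ends_edge[OF e(1)] by simp
  show ?case
  proof (intro conjI)
    show "finite (components (- ?Y))" using add(1) .
    show "\<exists>L :: 'a \<Rightarrow> 'a. (\<forall>u\<in>V. \<forall>v\<in>V. L u = L v \<longrightarrow> path_component ?Y (p u) (p v)) \<and>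
         card (insert e F) + card (L ` V) + 1 \<le> card (components (- ?Y)) + card V"
    proof (cases "L u = L v")
      case True
      then have "path_component ?X (p u) (p v)" using L uv by blast
      then have "path_component ?X (pathstart (\<gamma> e)) (pathfinish (\<gamma> e))"
        using puv path_component_sym by (auto simp: doubleton_eq_iff)
      then show ?thesis using add(2) le L mono insert.hyps
        by (intro exI[of _ L]) auto
    next
      case False
      \<comment> \<open>The class of \<open>v\<close> is merged into that of \<open>u\<close>. The
        lost label pays for the new edge, and the number of faces does not drop by
        \<open>card_components_add_arc\<close>.\<close>
      define L' where "L' x = (if L x = L v then L u else L x)" for x
      have "path_component ?Y (pathstart (\<gamma> e)) (pathfinish (\<gamma> e))"
        unfolding path_component_def using arc_g arc_imp_path unfolding Y by blast
      then have pe: "path_component ?Y (p u) (p v)"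
        using puv path_component_sym by (auto simp: doubleton_eq_iff)
      have conn: "path_component ?Y (p x) (p y)" if "x \<in> V" "y \<in> V" "L x = L y" for x y
        using L[OF that] mono by blast
      have to_u: "path_component ?Y (p x) (p u)" if "x \<in> V" "L' x = L u" for x
      proof (cases "L x = L v")
        case True
        then show ?thesis using conn[OF that(1) uv(2)] pe path_component_sym path_component_trans by blast
      next
        case False
        then show ?thesis using that conn[OF that(1) uv(1)] unfolding L'_def by simp
      qed
      have "path_component ?Y (p x) (p y)" if "x \<in> V" "y \<in> V" "L' x = L' y" for x y
      proof (cases "L' x = L u")
        case True
        then show ?thesis using to_u that path_component_sym path_component_trans by metis
      next
        case False
        then have "L x = L y" using that unfolding L'_def by (auto split: if_splits)
        then show ?thesis using conn that by blast
      qed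
      moreover have "L' ` V \<subseteq> L ` V - {L v}" using uv(1) False unfolding L'_def by auto
      then have "card (L' ` V) < card (L ` V)"
        using finite_V uv(2) by (intro psubset_card_mono) auto
      moreover have "card (components (- ?X)) \<le> card (components (- ?Y))"
        using card_components_add_arc[of ?X "\<gamma> e"] compact_X compact_imp_closed arc_g add(1) unfolding Y by blast
      ultimately show ?thesis using le insert.hyps by (intro exI[of _ L']) auto
    qed
  qed
qed

lemma euler_inequality:
  assumes "V \<noteq> {}"
  shows "finite (components (- drawing V E))"
    "card E + 2 \<le> card (components (- drawing V E)) + card V"
proof -
  obtain L :: "'a \<Rightarrow> 'a" where L: "finite (components (- drawing V E))"
    "card E + card (L ` V) + 1 \<le> card (components (- drawing V E)) + card V"
    using euler_inequality_aux[OF finite_E order_refl] by blast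
  have "card (L ` V) \<ge> 1" using assms finite_V by (simp add: Suc_leI card_gt_0_iff)
  with L show "finite (components (- drawing V E))"
    "card E + 2 \<le> card (components (- drawing V E)) + card V" by auto
qed

text \<open>The ends are left out so that a face that touches the edge in a vertex only does not
  count as bordered by it; the bound in \<open>edge_borders_at_most_two\<close> depends on
  that.\<close>

definition open_edge :: "'a set \<Rightarrow> complex set" where
  "open_edge e = path_image (\<gamma> e) - p ` e"

definition borders :: "'a set \<Rightarrow> complex set \<Rightarrow> bool" where
  "borders e C \<longleftrightarrow> open_edge e \<inter> closure C \<noteq> {}"

text \<open>Without \<open>e\<close>, the open edge lies in one open face \<open>F\<close>. A face
  whose closure meets the open edge meets \<open>F\<close>, hence lies in \<open>F\<close>, and
  adding \<open>e\<close> cuts \<open>F\<close> into at most two faces.\<close>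

lemma edge_borders_at_most_two:
  assumes e: "e \<in> E"
  shows "card {C \<in> components (- drawing V E). borders e C} \<le> 2"
proof -
  let ?X = "drawing V (E - {e})"
  have sub: "E - {e} \<subseteq> E" by blast
  interpret arc_attached ?X "\<gamma> e" using edge_attached[OF e] by blast
  have EX: "drawing V E = ?X \<union> path_image (\<gamma> e)"
    using drawing_insert[of V e "E - {e}"] e by (simp add: insert_absorb)
  have oe: "open_edge e = open_arc"
    unfolding open_edge_def open_arc_def using ends_edge[OF e] by simp
  obtain F where F: "F \<in> components (- ?X)" "open_arc \<subseteq> F"
    using exists_component_superset[OF open_arc_disjoint _ open_arc_connected] open_arc_nonempty open_arc_disjoint
    by blast
  have oF: "open F" using F(1) compact_X compact_imp_closed open_components by blast
  have "C \<subseteq> F" if C: "C \<in> components (- drawing V E)" "borders e C" for C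
  proof -
    have "F \<inter> closure C \<noteq> {}" using C(2) F(2) unfolding borders_def oe by blast
    then have "F \<inter> C \<noteq> {}" using open_Int_closure_eq_empty[OF oF] by simp
    moreover have "C \<subseteq> - ?X" using in_components_subset[OF C(1)] unfolding EX by blast
    ultimately show ?thesis using components_maximal[OF F(1) in_components_connected[OF C(1)]] by blast
  qed
  then have sub2: "{C \<in> components (- drawing V E). borders e C} \<subseteq> {C \<in> components (- (?X \<union> path_image (\<gamma> e))). C \<subseteq> F}"
    unfolding EX by blast
  have two: "finite {C \<in> components (- (?X \<union> path_image (\<gamma> e))). C \<subseteq> F} \<and>
      card {C \<in> components (- (?X \<union> path_image (\<gamma> e))). C \<subseteq> F} \<le> 2"
    by (rule at_most_two_sides[OF drawing_pieces(1,2,3)[OF order_refl sub] F(1)])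
  show ?thesis
    by (rule order_trans[OF card_mono[OF conjunct1[OF two] sub2] conjunct2[OF two]])
qed

text \<open>The frontier of \<open>C\<close> consists of vertices and of points on bordering edges.
  A connected set larger than \<open>C\<close> would meet this frontier, so erasing all other edges
  does not enlarge the face.\<close>

lemma component_bordering_edges:
  assumes C: "C \<in> components (- drawing V E)"
  shows "C \<in> components (- drawing V {e \<in> E. borders e C})"
proof -
  let ?Y = "drawing V {e \<in> E. borders e C}"
  have "closed (drawing V E)" by (intro compact_imp_closed compact_drawing order_refl)
  then have fr: "frontier C \<subseteq> drawing V E"
    using C by (rule frontier_of_components_closed_complement)
  have "frontier C \<subseteq> ?Y"
  proof
    fix z assume z: "z \<in> frontier C"
    then have "z \<in> drawing V E" "z \<in> closure C" using fr unfolding frontier_def by auto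
    moreover have "z \<in> ?Y" if "e \<in> E" "z \<in> path_image (\<gamma> e)" for e
    proof (cases "z \<in> p ` e")
      case True
      then show ?thesis using edge_subset[OF that(1)] unfolding drawing_def by blast
    next
      case False
      then have "borders e C" using that \<open>z \<in> closure C\<close> unfolding borders_def open_edge_def by blast
      then show ?thesis using that unfolding drawing_def by blast
    qed
    ultimately show "z \<in> ?Y" unfolding drawing_def by blast
  qed
  have "?Y \<subseteq> drawing V E" unfolding drawing_def by blast
  then have "C \<subseteq> - ?Y" using in_components_subset[OF C] by blast
  moreover have "D = C" if "D \<noteq> {}" "C \<subseteq> D" "D \<subseteq> - ?Y" "connected D" for D
  proof (rule ccontr)
    assume "D \<noteq> C"
    then have "D - C \<noteq> {}" "D \<inter> C \<noteq> {}" using that in_components_nonempty[OF C] by blast+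
    then have "D \<inter> frontier C \<noteq> {}" using connected_Int_frontier[OF that(4)] by blast
    then show False using \<open>frontier C \<subseteq> ?Y\<close> that(3) by blast
  qed
  ultimately show ?thesis using in_components_nonempty[OF C] in_components_connected[OF C]
    unfolding in_components_maximal[of C "- ?Y"] by blast
qed

text \<open>Contrapositive of the fact that a forest does not separate the plane. Pruning a vertex
  of degree at most one keeps the complement disconnected, and the empty drawing has a connected
  complement, so pruning gets stuck at a subgraph of minimum degree two.\<close>

lemma forest_complement_connected:
  assumes "U \<subseteq> V" "F \<subseteq> E" "\<forall>e\<in>F. e \<subseteq> U"
    and "\<not> connected (- drawing U F)"
  shows "\<exists>U'\<subseteq>U. U' \<noteq> {} \<and> (\<forall>v\<in>U'. 2 \<le> card {e \<in> F. v \<in> e \<and> e \<subseteq> U'})"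
  using assms
proof (induction "card U" arbitrary: U F rule: less_induct)
  case less
  have finU: "finite U" using less.prems(1) finite_V finite_subset by blast
  have finF: "finite F" using less.prems(2) finite_E finite_subset by blast
  show ?case
  proof (cases "\<forall>v\<in>U. 2 \<le> card {e \<in> F. v \<in> e \<and> e \<subseteq> U}")
    case True
    have "U \<noteq> {}"
    proof
      assume U: "U = {}"
      have "e \<noteq> {}" if "e \<in> F" for e using edge[of e] less.prems(2) that by blast
      then have "F = {}" using less.prems(3) U by auto
      then have "drawing U F = {}" using U unfolding drawing_def by simp
      then show False using less.prems(4) connected_UNIV[where 'a=complex] by simp
    qed
    then show ?thesis using True by blast
  next
    case False
    then obtain v where v: "v \<in> U" "\<not> 2 \<le> card {e \<in> F. v \<in> e \<and> e \<subseteq> U}" by blast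
    have "{e \<in> F. v \<in> e \<and> e \<subseteq> U} = {e \<in> F. v \<in> e}" using less.prems(3) by blast
    then have deg: "card {e \<in> F. v \<in> e} \<le> 1" using v(2) by simp
    let ?D = "{e \<in> F. v \<in> e}"
    let ?U = "U - {v}" and ?F = "F - ?D"
    have "?D = {} \<or> (\<exists>e. ?D = {e})"
    proof (cases "card ?D = 0")
      case False
      then have "card ?D = 1" using deg by linarith
      then show ?thesis using card_1_singletonE[of ?D] by metis
    qed (use finF in simp)
    \<comment> \<open>\<open>T\<close> is what pruning \<open>v\<close> takes away: an isolated
      point, or a pendant edge that meets the remaining drawing only in its other end.\<close>
    then obtain T where T: "drawing U F = drawing ?U ?F \<union> T" "compact T" "connected (- T)"
      "connected (drawing ?U ?F \<inter> T)"
    proof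
      assume D: "?D = {}"
      then have FF: "?F = F" by blast
      have "drawing U F = drawing ?U ?F \<union> {p v}" unfolding FF unfolding drawing_def using v(1) by blast
      moreover have "connected (- {p v})" by (simp add: connected_punctured_universe)
      moreover have "connected (drawing ?U ?F \<inter> {p v})" by (cases "p v \<in> drawing ?U ?F") auto
      ultimately show ?thesis by (intro that[of "{p v}"]) simp_all
    next
      assume "\<exists>e. ?D = {e}"
      then obtain e where D: "?D = {e}" by blast
      then have e: "e \<in> F" "v \<in> e" by blast+
      then have eE: "e \<in> E" using less.prems(2) by blast
      then obtain u where u: "e = {u, v}" "u \<noteq> v" using edge[OF eE] e(2) by blast
      have uU: "u \<in> U" using bspec[OF less.prems(3) e(1)] u by blast
      have pe: "p ` e \<subseteq> path_image (\<gamma> e)" using edge_meets_vertices[OF eE] by blast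
      have FF: "F = insert e ?F" using D e by blast
      have "drawing U F = drawing U ?F \<union> path_image (\<gamma> e)"
        by (subst FF) (rule drawing_insert)
      also have "\<dots> = drawing ?U ?F \<union> path_image (\<gamma> e)"
        unfolding drawing_def using pe e(2) by auto
      finally have 1: "drawing U F = drawing ?U ?F \<union> path_image (\<gamma> e)" .
      have vn: "p v \<notin> drawing ?U ?F"
      proof
        assume "p v \<in> drawing ?U ?F"
        then consider w where "w \<in> ?U" "p v = p w" | f where "f \<in> ?F" "p v \<in> path_image (\<gamma> f)"
          unfolding drawing_def by blast
        then show False
        proof cases
          case 1
          then show False using inj_p v(1) less.prems(1) by (auto dest: inj_onD)
        next
          case 2
          then have f: "f \<in> E" "v \<notin> f" using less.prems(2) by blast+
          then have "p v \<in> p ` f" using edge_meets_vertices[OF f(1)] 2(2) v(1) less.prems(1) by blast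
          then show False using inj_on_image_mem_iff[OF inj_p _ edge_subset[OF f(1)], of v] f(2) v(1) less.prems(1) by blast
        qed
      qed
      have "p u \<in> drawing ?U ?F" using uU u(2) unfolding drawing_def by blast
      then have "drawing ?U ?F \<inter> path_image (\<gamma> e) = {p u}"
        using edge_meets_drawing[OF eE, of ?F ?U] less.prems(1,2) vn u(1) e(2) by auto
      then show ?thesis
        using that[OF 1] arc_edge[OF eE] compact_arc_image[of "\<gamma> e"] connected_arc_complement[of "\<gamma> e"] by simp
    qed
    have sub: "?U \<subseteq> V" "?F \<subseteq> E" using less.prems by blast+
    have sub': "\<forall>e\<in>?F. e \<subseteq> ?U" using less.prems(3) by blast
    have "\<not> connected (- drawing ?U ?F)"
      using Janiszewski_connected[OF compact_drawing[OF sub] compact_imp_closed[OF T(2)] T(4) _ T(3)] less.prems(4)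
      unfolding T(1) by blast
    moreover have "card ?U < card U" using finU v(1) by (rule card_Diff1_less)
    ultimately obtain U' where U': "U' \<subseteq> ?U" "U' \<noteq> {}" "\<forall>w\<in>U'. 2 \<le> card {e \<in> ?F. w \<in> e \<and> e \<subseteq> U'}"
      using less.hyps[OF _ sub sub'] by blast
    have mono: "card {e \<in> ?F. w \<in> e \<and> e \<subseteq> U'} \<le> card {e \<in> F. w \<in> e \<and> e \<subseteq> U'}" for w
    proof (rule card_mono)
      show "finite {e \<in> F. w \<in> e \<and> e \<subseteq> U'}" using finF by simp
    qed blast
    have "\<forall>w\<in>U'. 2 \<le> card {e \<in> F. w \<in> e \<and> e \<subseteq> U'}"
    proof
      fix w assume "w \<in> U'"
      then show "2 \<le> card {e \<in> F. w \<in> e \<and> e \<subseteq> U'}" by (rule order_trans[OF bspec[OF U'(3)] mono])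
    qed
    moreover have "U' \<subseteq> U" using U'(1) by blast
    ultimately show ?thesis using U'(2) by (intro exI[of _ U']) simp
  qed
qed

text \<open>The assumption \<open>girth\<close> says that every subgraph of minimum degree two has at least \<open>k\<close> edges.\<close>

lemma edge_bound:
  assumes "V \<noteq> {}" "2 \<le> k"
    and girth: "\<And>U F. U \<subseteq> V \<Longrightarrow> F \<subseteq> E \<Longrightarrow> U \<noteq> {} \<Longrightarrow> \<forall>v\<in>U. 2 \<le> card {e \<in> F. v \<in> e \<and> e \<subseteq> U} \<Longrightarrow> k \<le> card F"
  shows "(k - 2) * card E < k * card V"
proof -
  let ?C = "components (- drawing V E)"
  have euler: "card E + 2 \<le> card ?C + card V" and fin: "finite ?C" using euler_inequality[OF assms(1)] by blast+
  \<comment> \<open>If the edges bordering some face leave a connected complement, that face is the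
    whole complement. Otherwise they contain a subgraph of minimum degree two for every face, so
    each face has at least \<open>k\<close> bordering edges, and double counting applies.\<close>
  have "card ?C \<le> 1 \<or> k * card ?C \<le> 2 * card E"
  proof (cases "\<exists>C\<in>?C. connected (- drawing V {e \<in> E. borders e C})")
    case True
    then obtain C where C: "C \<in> ?C" "connected (- drawing V {e \<in> E. borders e C})" by blast
    let ?Y = "drawing V {e \<in> E. borders e C}"
    have "C = - ?Y"
      using component_bordering_edges[OF C(1)] C(2) connected_eq_components_subset_sing by blast
    moreover have "?Y \<subseteq> drawing V E" unfolding drawing_def by blast
    ultimately have "- drawing V E \<subseteq> C" by blast
    then have "C = - drawing V E" using in_components_subset[OF C(1)] by blast
    then have "connected (- drawing V E)" using in_components_connected[OF C(1)] by simp
    then have "?C \<subseteq> {- drawing V E}" using connected_eq_components_subset_sing by blast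
    then have "card ?C \<le> 1" using card_mono[of "{- drawing V E}" ?C] by simp
    then show ?thesis ..
  next
    case False
    have "k \<le> card {e \<in> E. borders e C}" if "C \<in> ?C" for C
    proof -
      have "\<not> connected (- drawing V {e \<in> E. borders e C})" using False that by blast
      then obtain U where "U \<subseteq> V" "U \<noteq> {}" "\<forall>v\<in>U. 2 \<le> card {e \<in> {e \<in> E. borders e C}. v \<in> e \<and> e \<subseteq> U}"
        using forest_complement_connected[OF order_refl, of "{e \<in> E. borders e C}"] edge_subset by blast
      then show ?thesis by (intro girth[of U]) auto
    qed
    then have "k * card ?C \<le> (\<Sum>C\<in>?C. card {e \<in> E. borders e C})"
      using sum_bounded_below[of ?C k "\<lambda>C. card {e \<in> E. borders e C}"] by (simp add: mult.commute)
    also have "\<dots> = (\<Sum>e\<in>E. card {C \<in> ?C. borders e C})"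
      unfolding card_eq_sum sum.inter_filter[OF finite_E] sum.inter_filter[OF fin] by (rule sum.swap)
    also have "\<dots> \<le> (\<Sum>e\<in>E. 2)" by (intro sum_mono edge_borders_at_most_two)
    finally show ?thesis by simp
  qed
  then show ?thesis
  proof
    assume "card ?C \<le> 1"
    then have "card E < card V" using euler by linarith
    then have "(k - 2) * card E \<le> (k - 2) * card V" "0 < card V" by auto
    moreover have "(k - 2) * card V < k * card V" using assms(2) \<open>0 < card V\<close> by simp
    ultimately show ?thesis by linarith
  next
    assume *: "k * card ?C \<le> 2 * card E"
    have "k * card E + 2 * k \<le> k * card ?C + k * card V"
      using mult_le_mono2[OF euler, of k] by (simp add: algebra_simps)
    then have "k * card E + 2 * k \<le> 2 * card E + k * card V" using * by linarith
    moreover have "0 < k * card V" using assms finite_V by (simp add: card_gt_0_iff)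
    ultimately show ?thesis using assms(2) unfolding diff_mult_distrib by linarith
  qed
qed

end

section \<open>Arranging balanced multisets of colours\<close>

definition balanced :: "nat \<Rightarrow> nat multiset \<Rightarrow> bool" where
  "balanced m M \<longleftrightarrow> set_mset M \<subseteq> {..<m} \<and> (\<forall>i<m. \<forall>j<m. count M i \<le> count M j + 1)"

text \<open>The colours of \<open>M\<close> are put along a path whose outer neighbours have the
  colours \<open>x\<close> and \<open>y\<close>.\<close>

definition arrangeable :: "'a multiset \<Rightarrow> 'a \<Rightarrow> 'a \<Rightarrow> bool" where
  "arrangeable M x y \<longleftrightarrow> (\<exists>cs. mset cs = M \<and> cs \<noteq> [] \<and> distinct_adj cs \<and> hd cs \<noteq> x \<and> last cs \<noteq> y)"

lemma size_eq_sum_count: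
  assumes "finite A" "set_mset M \<subseteq> A"
  shows "size M = sum (count M) A"
proof -
  have "sum (count M) A = sum (count M) (set_mset M)"
    using assms by (intro sum.mono_neutral_right) (auto simp: not_in_iff)
  then show ?thesis by (simp add: size_multiset_overloaded_eq)
qed

text \<open>A colour missing from \<open>M\<close> would force all multiplicities down to one and
  hence \<open>size M < m\<close>; so a full set of colours can be split off.\<close>

lemma balanced_large:
  assumes M: "balanced m M" and le: "m \<le> size M"
  obtains M' where "M = mset_set {..<m} + M'" "balanced m M'"
proof -
  have pos: "0 < count M i" if i: "i < m" for i
  proof (rule ccontr)
    assume "\<not> 0 < count M i"
    then have le1: "count M j \<le> 1" if "j < m" for j using M i that unfolding balanced_def by fastforce
    have "size M = sum (count M) {..<m}" using M unfolding balanced_def by (intro size_eq_sum_count) auto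
    also have "\<dots> = count M i + sum (count M) ({..<m} - {i})" using i by (intro sum.remove) auto
    also have "\<dots> \<le> 0 + sum (\<lambda>_. 1) ({..<m} - {i})"
    proof (intro add_mono sum_mono)
      show "count M i \<le> 0" using \<open>\<not> 0 < count M i\<close> by linarith
    qed (use le1 in auto)
    also have "\<dots> < m" using i by simp
    finally show False using le by simp
  qed
  then have sub: "mset_set {..<m} \<subseteq># M" by (intro mset_subset_eqI) (auto simp: count_mset_set')
  have "balanced m (M - mset_set {..<m})"
    unfolding balanced_def
  proof (intro conjI allI impI)
    show "set_mset (M - mset_set {..<m}) \<subseteq> {..<m}" using M unfolding balanced_def by (auto dest: in_diffD)
    fix i j assume ij: "i < m" "j < m"
    then have "count M i \<le> count M j + 1" using M unfolding balanced_def by blast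
    then show "count (M - mset_set {..<m}) i \<le> count (M - mset_set {..<m}) j + 1"
      using ij pos[OF ij(2)] by (simp add: count_mset_set')
  qed
  then show thesis using that[of "M - mset_set {..<m}"] sub by simp
qed

lemma balanced_small:
  assumes M: "balanced m M" and le: "size M \<le> m"
  shows "M = mset_set (set_mset M)"
proof -
  have "count M i \<le> 1" for i
  proof (rule ccontr)
    assume i: "\<not> count M i \<le> 1"
    then have im: "i < m" using M unfolding balanced_def by (metis count_eq_zero_iff le0 lessThan_iff le_trans subsetD zero_le_one)
    have pos: "1 \<le> count M j" if "j < m" for j
    proof -
      have "count M i \<le> count M j + 1" using M im that unfolding balanced_def by blast
      then show ?thesis using i by linarith
    qed
    have "m + 1 = 2 + card ({..<m} - {i})" using im by simp
    also have "\<dots> = 2 + sum (\<lambda>_. 1) ({..<m} - {i})" by simp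
    also have "\<dots> \<le> count M i + sum (count M) ({..<m} - {i})"
      using i pos by (intro add_mono sum_mono) auto
    also have "\<dots> = sum (count M) {..<m}" using im by (subst sum.remove[of _ i]) auto
    also have "\<dots> = size M" using M unfolding balanced_def by (intro size_eq_sum_count[symmetric]) auto
    finally show False using le by simp
  qed
  then show ?thesis by (metis (no_types) One_nat_def count_mset_set' finite_set_mset le_SucE le_zero_eq multiset_eqI count_eq_zero_iff)
qed

lemma choose_two:
  assumes "3 \<le> card A"
  obtains a b where "a \<in> A" "b \<in> A" "a \<noteq> b" "a \<noteq> x" "b \<noteq> y"
proof -
  have fin: "finite A" using assms card.infinite by fastforce
  have "\<not> A \<subseteq> {y}" using assms card_mono[of "{y}" A] by auto
  then obtain b where b: "b \<in> A" "b \<noteq> y" by blast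
  have "\<not> A \<subseteq> {x, b}" using assms card_mono[of "{x, b}" A] by (auto simp: card_insert_if split: if_splits)
  then show thesis using that b by blast
qed

lemma arrange_ends:
  assumes "finite A" "a \<in> A" "b \<in> A" "a \<noteq> b"
  obtains l where "mset_set A = mset (a # l @ [b])" "distinct (a # l @ [b])" "set l = A - {a, b}"
proof -
  obtain l where l: "set l = A - {a, b}" "distinct l" using assms(1) finite_distinct_list by (metis finite_Diff)
  have d: "distinct (a # l @ [b])" using l assms(4) by auto
  have "set (a # l @ [b]) = A" using l assms by auto
  then have "mset_set A = mset (a # l @ [b])" using mset_set_set[OF d] by metis
  then show thesis using that d l by blast
qed

lemma distinct_adjI: "distinct xs \<Longrightarrow> distinct_adj xs"
  by (induction xs rule: induct_list012) auto

lemma arrangeable_set: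
  assumes "3 \<le> card A"
  shows "arrangeable (mset_set A) x y"
proof -
  have fin: "finite A" using assms card.infinite by fastforce
  obtain a b where ab: "a \<in> A" "b \<in> A" "a \<noteq> b" "a \<noteq> x" "b \<noteq> y" using choose_two[OF assms] .
  obtain l where "mset_set A = mset (a # l @ [b])" "distinct (a # l @ [b])"
    using arrange_ends[OF fin ab(1-3)] .
  then show ?thesis unfolding arrangeable_def using ab distinct_adjI[of "a # l @ [b]"] by (intro exI[of _ "a # l @ [b]"]) auto
qed

text \<open>The block comes first, and its last colour is what the rest has to avoid in front; this
  is why \<open>M\<close> must be arrangeable for every \<open>x\<close>.\<close>

lemma arrangeable_add_block:
  fixes m :: nat
  assumes "3 \<le> m" "\<And>x. arrangeable M x y"
  shows "arrangeable (mset_set {..<m} + M) x y"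
proof -
  have "arrangeable (mset_set {..<m}) x y" using assms(1) by (intro arrangeable_set) simp
  then obtain cs where cs: "mset cs = mset_set {..<m}" "cs \<noteq> []" "distinct_adj cs" "hd cs \<noteq> x"
    unfolding arrangeable_def by blast
  obtain ds where ds: "mset ds = M" "ds \<noteq> []" "distinct_adj ds" "hd ds \<noteq> last cs" "last ds \<noteq> y"
    using assms(2) unfolding arrangeable_def by blast
  show ?thesis unfolding arrangeable_def
    using cs ds by (intro exI[of _ "cs @ ds"]) (auto simp: distinct_adj_append_iff)
qed

text \<open>A single remaining colour may be forbidden at an end of the path, so it is arranged
  together with the last block: both copies of \<open>e\<close> stand next to the ends.\<close>

lemma arrangeable_plus_one:
  fixes m :: nat
  assumes "4 \<le> m" "e < m"
  shows "arrangeable (mset_set {..<m} + {#e#}) x y"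
proof -
  have "3 \<le> card ({..<m} - {e})" using assms by simp
  then obtain a b where ab: "a \<in> {..<m} - {e}" "b \<in> {..<m} - {e}" "a \<noteq> b" "a \<noteq> x" "b \<noteq> y"
    using choose_two by metis
  obtain l where l: "mset_set ({..<m} - {e}) = mset (a # l @ [b])" "distinct (a # l @ [b])"
    "set l = {..<m} - {e} - {a, b}" using arrange_ends[OF _ ab(1-3)] by blast
  have "card (set l) = m - 3" unfolding l(3) using ab assms(2) by (simp add: card_Diff_subset)
  then have "l \<noteq> []" using assms(1) by auto
  have "mset_set {..<m} = add_mset e (mset_set ({..<m} - {e}))" using assms(2) by (simp add: mset_set.remove)
  then have "mset (a # e # l @ [e, b]) = mset_set {..<m} + {#e#}" using l(1) by simp
  moreover have "distinct_adj (a # e # l @ [e, b])"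
  proof -
    have "distinct_adj l" using l(2) distinct_adjI by auto
    moreover have "e \<noteq> hd l" "last l \<noteq> e" using l(3) \<open>l \<noteq> []\<close> hd_in_set last_in_set by fastforce+
    ultimately show ?thesis using ab \<open>l \<noteq> []\<close> by (auto simp: distinct_adj_append_iff distinct_adj_Cons)
  qed
  ultimately show ?thesis unfolding arrangeable_def using ab by (intro exI[of _ "a # e # l @ [e, b]"]) auto
qed

lemma arrangeable_plus_two:
  fixes m :: nat
  assumes "4 \<le> m" "e < m" "f < m" "e \<noteq> f"
  shows "arrangeable (mset_set {..<m} + {#e, f#}) x y"
proof -
  let ?A = "{..<m} - {e, f}"
  have all: "mset_set {..<m} = add_mset e (add_mset f (mset_set ?A))"
  proof -
    have "mset_set {..<m} = add_mset e (mset_set ({..<m} - {e}))" using assms by (simp add: mset_set.remove)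
    also have "mset_set ({..<m} - {e}) = add_mset f (mset_set ({..<m} - {e} - {f}))"
      using assms by (intro mset_set.remove) auto
    also have "{..<m} - {e} - {f} = ?A" by blast
    finally show ?thesis .
  qed
  have cA: "card ?A = m - 2" using assms by (simp add: card_Diff_subset)
  show ?thesis
  proof (cases "\<exists>a\<in>?A. \<exists>b\<in>?A. a \<noteq> b \<and> a \<noteq> x \<and> b \<noteq> y")
    case True
    then obtain a b where ab: "a \<in> ?A" "b \<in> ?A" "a \<noteq> b" "a \<noteq> x" "b \<noteq> y" by blast
    obtain l where l: "mset_set ?A = mset (a # l @ [b])" "distinct (a # l @ [b])" "set l = ?A - {a, b}"
      using arrange_ends[OF _ ab(1-3)] by blast
    let ?cs = "a # e # f # l @ [e, f, b]"
    have "distinct_adj l" using l(2) distinct_adjI by auto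
    moreover have "l \<noteq> [] \<Longrightarrow> f \<noteq> hd l \<and> last l \<noteq> e" using l(3) hd_in_set last_in_set by fastforce
    ultimately have "distinct_adj ?cs"
      using ab assms(4) by (cases "l = []") (auto simp: distinct_adj_append_iff distinct_adj_Cons)
    moreover have "mset ?cs = mset_set {..<m} + {#e, f#}" using l(1) all by simp
    ultimately show ?thesis unfolding arrangeable_def using ab by (intro exI[of _ ?cs]) auto
  next
    case False
    have "card ?A \<noteq> 0" using cA assms(1) by simp
    then have "?A \<noteq> {}" by (metis card.empty)
    then obtain p where p: "p \<in> ?A" by blast
    have "\<not> ?A \<subseteq> {p}"
    proof
      assume "?A \<subseteq> {p}"
      then have "card ?A \<le> 1" using card_mono[of "{p}" ?A] by simp
      then show False using cA assms(1) by simp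
    qed
    then obtain q where "q \<in> ?A" "p \<noteq> q" by blast
    note pq = p this
    \<comment> \<open>Failure for both orders of \<open>p\<close> and \<open>q\<close> forces
      \<open>x = y\<close>, a colour outside \<open>{e, f}\<close>; then \<open>e\<close> and
      \<open>f\<close> themselves are admissible ends.\<close>
    have "(p = x \<or> q = y) \<and> (q = x \<or> p = y)"
    proof (rule ccontr)
      assume "\<not> ?thesis"
      then have "(p \<noteq> q \<and> p \<noteq> x \<and> q \<noteq> y) \<or> (q \<noteq> p \<and> q \<noteq> x \<and> p \<noteq> y)" using pq(3) by auto
      then show False using False pq(1,2) by blast
    qed
    then have "x = y \<and> (p = x \<or> q = x)" using pq(3) by auto
    then obtain q where xy: "x = y" "x \<in> ?A" and q: "q \<in> ?A" "q \<noteq> x" using pq by metis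
    obtain l where l: "mset_set ?A = mset (x # l @ [q])" "distinct (x # l @ [q])" "set l = ?A - {x, q}"
      using arrange_ends[OF _ xy(2) q(1) q(2)[symmetric]] by blast
    let ?cs = "e # x # f # (l @ [q]) @ [e, f]"
    have "f \<notin> set (l @ [q])" using l(3) q(1) by simp
    then have "f \<noteq> hd (l @ [q])" using hd_in_set[of "l @ [q]"] by (metis append_is_Nil_conv list.distinct(1))
    moreover have "distinct_adj (l @ [q])" by (rule distinct_adjI) (use l(2) in simp)
    ultimately have "distinct_adj ?cs"
      using q(1) xy(2) assms(4) by (auto simp: distinct_adj_append_iff distinct_adj_Cons hd_append split: if_splits)
    moreover have "mset ?cs = mset_set {..<m} + {#e, f#}" using l(1) all by simp
    ultimately show ?thesis unfolding arrangeable_def using xy by (intro exI[of _ ?cs]) auto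
  qed
qed

lemma balanced_one: "balanced m M \<Longrightarrow> size M = 1 \<Longrightarrow> \<exists>e<m. M = {#e#}"
  using size_1_singleton_mset unfolding balanced_def by fastforce

lemma balanced_two:
  assumes "balanced m M" "size M = 2" "2 \<le> m"
  shows "\<exists>e<m. \<exists>f<m. e \<noteq> f \<and> M = {#e, f#}"
proof -
  have M: "M = mset_set (set_mset M)" using balanced_small assms by simp
  then have "card (set_mset M) = 2" using assms(2) by (metis size_mset_set)
  then obtain e f where "set_mset M = {e, f}" "e \<noteq> f" by (auto simp: card_2_iff)
  then show ?thesis using M assms(1) unfolding balanced_def
    by (intro exI[of _ e] exI[of _ f]) (auto simp: add_mset_commute)
qed

lemma arrangeable_balanced:
  assumes "4 \<le> m" "balanced m M" "3 \<le> size M"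
  shows "arrangeable M x y"
  using assms(2,3)
proof (induction "size M" arbitrary: M x rule: less_induct)
  case less
  show ?case
  proof (cases "size M \<le> m")
    case True
    then have M: "M = mset_set (set_mset M)" using balanced_small less.prems by blast
    then have "3 \<le> card (set_mset M)" using less.prems(2) by (metis size_mset_set)
    then show ?thesis using arrangeable_set M by metis
  next
    case False
    then obtain M' where M': "M = mset_set {..<m} + M'" "balanced m M'"
      using balanced_large less.prems(1) by (metis nat_le_linear)
    then have s: "size M = m + size M'" by simp
    consider "size M' = 1" | "size M' = 2" | "3 \<le> size M'" using s False by linarith
    then show ?thesis
    proof cases
      case 1
      then show ?thesis using balanced_one[OF M'(2)] arrangeable_plus_one[OF assms(1)] M'(1) by blast
    next
      case 2
      then show ?thesis using balanced_two[OF M'(2)] arrangeable_plus_two[OF assms(1)] M'(1) assms(1) by fastforce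
    next
      case 3
      have "arrangeable M' x y" for x using less.hyps[OF _ M'(2) 3] s assms(1) by simp
      then show ?thesis using arrangeable_add_block[of m M'] M'(1) assms(1) by simp
    qed
  qed
qed

lemma third_colour:
  assumes "e < 3" "f < (3::nat)" "e \<noteq> f"
  obtains p where "{..<3} = {e, f, p}" "p \<noteq> e" "p \<noteq> f"
proof -
  \<comment> \<open>The colours 0, 1, 2 add up to 3, so \<open>3 - e - f\<close> is the missing
    one.\<close>
  have "{e, f, 3 - e - f} \<subseteq> {..<3}" using assms by auto
  moreover have ne: "3 - e - f \<noteq> e" "3 - e - f \<noteq> f" using assms by presburger+
  then have "card {e, f, 3 - e - f} = 3" using assms(3) by (simp add: card_insert_if)
  ultimately have "{..<3} = {e, f, 3 - e - f}" by (intro card_subset_eq[symmetric]) auto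
  then show thesis using that[of "3 - e - f"] ne by blast
qed

lemma arrangeable_five:
  assumes "e < 3" "f < (3::nat)" "e \<noteq> f"
  shows "arrangeable (mset_set {..<3} + {#e, f#}) x y"
proof -
  obtain p where p: "{..<3} = {e, f, p}" "p \<noteq> e" "p \<noteq> f" using third_colour assms by blast
  consider "x \<noteq> e" "y \<noteq> f" | "x \<noteq> f" "y \<noteq> e" | "x = e" "y = e" | "x = f" "y = f" using assms(3) by auto
  then show ?thesis
  proof cases
    case 1 then show ?thesis unfolding arrangeable_def p(1) using p assms by (intro exI[of _ "[e, f, p, e, f]"]) auto
  next
    case 2 then show ?thesis unfolding arrangeable_def p(1) using p assms by (intro exI[of _ "[f, e, p, f, e]"]) auto
  next
    case 3 then show ?thesis unfolding arrangeable_def p(1) using p assms by (intro exI[of _ "[f, e, p, e, f]"]) auto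
  next
    case 4 then show ?thesis unfolding arrangeable_def p(1) using p assms by (intro exI[of _ "[e, f, p, f, e]"]) auto
  qed
qed

text \<open>Splitting one block off seven colours leaves four, a length that can fail. So two blocks
  and the surplus colour are arranged at once, with \<open>e\<close> in every second place.\<close>

lemma arrangeable_seven:
  assumes "e < (3::nat)"
  shows "arrangeable (mset_set {..<3} + (mset_set {..<3} + {#e#})) x y"
proof -
  have "\<exists>f<(3::nat). e \<noteq> f" by (cases "e = 0") (auto intro: exI[of _ 0] exI[of _ 1])
  then obtain f where f: "f < 3" "e \<noteq> f" by blast
  obtain p where p: "{..<3} = {e, f, p}" "p \<noteq> e" "p \<noteq> f" using third_colour assms f by blast
  consider "x \<noteq> f" "y \<noteq> p" | "x \<noteq> p" "y \<noteq> f" | "x = f" "y = f" | "x = p" "y = p" using p by auto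
  then show ?thesis
  proof cases
    case 1 then show ?thesis unfolding arrangeable_def p(1) using p f by (intro exI[of _ "[f, e, f, e, p, e, p]"]) auto
  next
    case 2 then show ?thesis unfolding arrangeable_def p(1) using p f by (intro exI[of _ "[p, e, f, e, p, e, f]"]) auto
  next
    case 3 then show ?thesis unfolding arrangeable_def p(1) using p f by (intro exI[of _ "[p, e, f, e, f, e, p]"]) auto
  next
    case 4 then show ?thesis unfolding arrangeable_def p(1) using p f by (intro exI[of _ "[f, e, p, e, p, e, f]"]) auto
  qed
qed

lemma arrangeable_balanced_three:
  assumes "balanced 3 M" "size M = 3 \<or> 5 \<le> size M"
  shows "arrangeable M x y"
  using assms
proof (induction "size M" arbitrary: M x rule: less_induct)
  case less
  show ?case
  proof (cases "size M = 3")
    case True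
    then have M: "M = mset_set (set_mset M)" using balanced_small less.prems(1) by simp
    then have "card (set_mset M) = 3" using True by (metis size_mset_set)
    then show ?thesis using arrangeable_set[of "set_mset M"] M by simp
  next
    case False
    then have "3 \<le> size M" using less.prems(2) by linarith
    then obtain M' where M': "M = mset_set {..<3} + M'" "balanced 3 M'"
      by (rule balanced_large[OF less.prems(1)])
    then have s: "size M = 3 + size M'" by simp
    consider "size M' = 2" | "size M' = 4" | "size M' = 3 \<or> 5 \<le> size M'"
      using s False less.prems(2) by linarith
    then show ?thesis
    proof cases
      case 1
      then show ?thesis using balanced_two[OF M'(2)] arrangeable_five M'(1) by fastforce
    next
      case 2
      then obtain M'' where M'': "M' = mset_set {..<3} + M''" "balanced 3 M''"
        using balanced_large[OF M'(2)] by auto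
      then have "size M'' = 1" using 2 by simp
      then show ?thesis using balanced_one[OF M''(2)] arrangeable_seven M'(1) M''(1) by blast
    next
      case 3
      have "arrangeable M' x y" for x using less.hyps[OF _ M'(2) 3] s by simp
      then show ?thesis using arrangeable_add_block[of 3 M'] M'(1) by simp
    qed
  qed
qed

section \<open>Colour arrangements on a cubic hub with three short legs\<close>

definition doubles :: "'a multiset \<Rightarrow> 'a set" where
  "doubles M = {f. 2 \<le> count M f}"

lemma finite_doubles: "finite (doubles M)"
proof (rule finite_subset)
  show "doubles M \<subseteq> set_mset M" unfolding doubles_def by (auto simp flip: count_greater_zero_iff)
qed simp

lemma mset_set_if_no_doubles:
  assumes "doubles M = {}"
  shows "M = mset_set (set_mset M)"
proof (rule multiset_eqI)
  fix x
  have "\<not> 2 \<le> count M x" using assms unfolding doubles_def by blast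
  then show "count M x = count (mset_set (set_mset M)) x"
    by (cases "x \<in># M") (auto simp: count_mset_set' not_in_iff simp flip: count_greater_zero_iff)
qed

lemma doubles_remove:
  assumes "\<And>f. count M f \<le> 2"
  shows "doubles (M - {#a#}) = doubles M - {a}"
  unfolding doubles_def using assms[of a] by auto

text \<open>Seven colours are fewer than two blocks of at least four, so only what exceeds a single
  block can be doubled, and that is at most \<open>size M - m\<close>.\<close>

lemma balanced_counts:
  assumes "4 \<le> m" "balanced m M" "size M \<le> 7"
  shows "count M f \<le> 2" and "card (doubles M) + 4 \<le> size M \<or> doubles M = {}"
proof -
  have "count M f \<le> 2 \<and> (card (doubles M) + 4 \<le> size M \<or> doubles M = {})" for f
  proof (cases "size M < m")
    case True
    then have M: "M = mset_set (set_mset M)" using balanced_small assms(2) by simp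
    have "count M g \<le> 1" for g by (subst M) (simp add: count_mset_set')
    then show ?thesis unfolding doubles_def by (metis (mono_tags, lifting) Suc_1 empty_Collect_eq le_SucI le_antisym not_less_eq_eq numeral_One one_le_numeral)
  next
    case False
    then obtain M' where M': "M = mset_set {..<m} + M'" "balanced m M'" using balanced_large[OF assms(2)] by auto
    then have s: "size M = m + size M'" by simp
    then have "size M' < m" using assms by simp
    then have M2: "M' = mset_set (set_mset M')" using balanced_small[OF M'(2)] by simp
    have c1: "count M' g \<le> 1" for g by (subst M2) (simp add: count_mset_set')
    have le2: "count M g \<le> 2" for g unfolding M'(1) using c1[of g] by (simp add: count_mset_set')
    have "doubles M \<subseteq> set_mset M'"
    proof
      fix g assume "g \<in> doubles M"
      then have "2 \<le> count (mset_set {..<m}) g + count M' g" unfolding doubles_def M'(1) by simp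
      moreover have "count (mset_set {..<m}) g \<le> 1" by (simp add: count_mset_set')
      ultimately have "count M' g > 0" by linarith
      then show "g \<in># M'" by simp
    qed
    then have "card (doubles M) \<le> card (set_mset M')" by (intro card_mono) auto
    also have "\<dots> = size M'" using M2 by (metis size_mset_set)
    finally show ?thesis using le2 s assms(1) by simp
  qed
  then show "count M f \<le> 2" "card (doubles M) + 4 \<le> size M \<or> doubles M = {}" by blast+
qed

text \<open>The path is a cubic hub \<open>v\<close> between two legs \<open>a1, b1\<close> and
  \<open>a2, b2\<close>, and \<open>\<gamma>\<close> is the colour next to \<open>v\<close> on the
  third leg. A doubled colour \<open>f\<close> goes to both places next to \<open>v\<close>, except
  when \<open>\<gamma>\<close> occurs in \<open>M\<close> and is forbidden at both ends.\<close>

lemma arrange_path_five: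
  assumes s: "size M = 5" and le2: "\<And>f. count M f \<le> 2"
    and one: "\<And>f g. f \<in> doubles M \<Longrightarrow> g \<in> doubles M \<Longrightarrow> f = g" and \<gamma>: "\<gamma> \<notin> doubles M"
  shows "\<exists>b1 a1 v a2 b2. M = {#b1, a1, v, a2, b2#} \<and> b1 \<noteq> a1 \<and> a1 \<noteq> v \<and> v \<noteq> a2 \<and> a2 \<noteq> b2 \<and>
    b1 \<noteq> x \<and> b2 \<noteq> y \<and> v \<noteq> \<gamma>"
proof (cases "doubles M = {}")
  case True
  then have M: "M = mset_set (set_mset M)" by (rule mset_set_if_no_doubles)
  then have c: "card (set_mset M) = 5" using s by (metis size_mset_set)
  have "\<not> set_mset M \<subseteq> {\<gamma>}" using c card_mono[of "{\<gamma>}" "set_mset M"] by auto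
  then obtain v where v: "v \<in># M" "v \<noteq> \<gamma>" by blast
  have c4: "card (set_mset M - {v}) = 4" using c v(1) by simp
  then obtain b1 b2 where b: "b1 \<in> set_mset M - {v}" "b2 \<in> set_mset M - {v}" "b1 \<noteq> b2" "b1 \<noteq> x" "b2 \<noteq> y"
    using choose_two[of "set_mset M - {v}" x y] by auto
  have "card (set_mset M - {v} - {b1, b2}) = 2" using c4 b by (simp add: card_Diff_subset)
  then obtain a1 a2 where a: "set_mset M - {v} - {b1, b2} = {a1, a2}" "a1 \<noteq> a2" by (auto simp: card_2_iff)
  then have S: "set_mset M = {b1, a1, v, a2, b2}" using v b by blast
  have ne: "a1 \<noteq> v" "a2 \<noteq> v" "a1 \<noteq> b1" "a1 \<noteq> b2" "a2 \<noteq> b1" "a2 \<noteq> b2" using a by blast+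
  have "M = {#b1, a1, v, a2, b2#}" using ne a(2) b by (subst M, subst S) auto
  then show ?thesis using ne b v by blast
next
  case False
  then obtain f where f: "f \<in> doubles M" by blast
  have cf: "count M f = 2" using f le2[of f] unfolding doubles_def by auto
  have "{#f, f#} \<subseteq># M" using cf by (intro mset_subset_eqI) auto
  then obtain M' where M': "M = {#f, f#} + M'" by (metis subset_mset.add_diff_inverse)
  have "f \<notin># M'" using cf M' by (simp add: not_in_iff)
  have "doubles M' = {}"
  proof (rule ccontr)
    assume "doubles M' \<noteq> {}"
    then obtain g where "g \<in> doubles M'" by blast
    then have "g \<in> doubles M" "2 \<le> count M' g" unfolding doubles_def M' by auto
    then have "g = f" "g \<in># M'" using one f by (auto simp flip: count_greater_zero_iff)
    then show False using \<open>f \<notin># M'\<close> by blast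
  qed
  then have MS: "M' = mset_set (set_mset M')" by (rule mset_set_if_no_doubles)
  have "size M' = 3" using s M' by simp
  then have c: "card (set_mset M') = 3" using MS by (metis size_mset_set)
  have \<gamma>f: "\<gamma> \<noteq> f" using \<gamma> f by blast
  have split: "\<exists>q r. M' = {#p, q, r#} \<and> q \<noteq> r \<and> q \<noteq> p \<and> r \<noteq> p \<and> f \<noteq> p \<and> f \<noteq> q \<and> f \<noteq> r" if "p \<in># M'" for p
  proof -
    have "card (set_mset M' - {p}) = 2" using c that by simp
    then obtain q r where qr: "set_mset M' - {p} = {q, r}" "q \<noteq> r" by (auto simp: card_2_iff)
    then have "set_mset M' = {p, q, r}" "q \<noteq> p" "r \<noteq> p" using that by blast+
    then have "M' = {#p, q, r#}" using qr(2) by (subst MS) auto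
    then show ?thesis using \<open>f \<notin># M'\<close> qr(2) \<open>q \<noteq> p\<close> \<open>r \<noteq> p\<close> by auto
  qed
  show ?thesis
  proof (cases "\<gamma> \<in># M'")
    case False
    obtain b1 b2 where b: "b1 \<in># M'" "b2 \<in># M'" "b1 \<noteq> b2" "b1 \<noteq> x" "b2 \<noteq> y"
      using choose_two[of "set_mset M'" x y] c by auto
    obtain v where v: "M' = {#b1, b2, v#}" "v \<noteq> b1" "v \<noteq> b2" "f \<noteq> b1" "f \<noteq> b2" "f \<noteq> v"
      using split[OF b(1)] b(2,3) by (auto simp: add_mset_commute)
    then have "v \<noteq> \<gamma>" using False by auto
    then show ?thesis using M' v b by (intro exI[of _ b1] exI[of _ f] exI[of _ v] exI[of _ f] exI[of _ b2]) (auto simp: add_mset_commute)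
  next
    case True
    then obtain q r where qr: "M' = {#\<gamma>, q, r#}" "q \<noteq> r" "q \<noteq> \<gamma>" "r \<noteq> \<gamma>" "f \<noteq> \<gamma>" "f \<noteq> q" "f \<noteq> r" using split by blast
    consider "x \<noteq> \<gamma>" "y \<noteq> q" | "x \<noteq> \<gamma>" "y \<noteq> r" | "y \<noteq> \<gamma>" "x \<noteq> q" | "y \<noteq> \<gamma>" "x \<noteq> r" | "x = \<gamma>" "y = \<gamma>"
      using qr by auto
    then show ?thesis
    proof cases
      case 1
      have "M = {#\<gamma>, f, r, f, q#}" unfolding M' qr(1) by (simp add: add_mset_commute)
      then show ?thesis
        by (intro exI conjI) (assumption, use qr 1 in simp_all)
    next
      case 2
      have "M = {#\<gamma>, f, q, f, r#}" unfolding M' qr(1) by (simp add: add_mset_commute)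
      then show ?thesis
        by (intro exI conjI) (assumption, use qr 2 in simp_all)
    next
      case 3
      have "M = {#q, f, r, f, \<gamma>#}" unfolding M' qr(1) by (simp add: add_mset_commute)
      then show ?thesis
        by (intro exI conjI) (assumption, use qr 3 in simp_all)
    next
      case 4
      have "M = {#r, f, q, f, \<gamma>#}" unfolding M' qr(1) by (simp add: add_mset_commute)
      then show ?thesis
        by (intro exI conjI) (assumption, use qr 4 in simp_all)
    next
      case 5
      have "M = {#f, \<gamma>, f, r, q#}" unfolding M' qr(1) by (simp add: add_mset_commute)
      then show ?thesis
        by (intro exI conjI) (assumption, use qr 5 in simp_all)
    qed
  qed
qed

lemma card_le_one_unique: "finite A \<Longrightarrow> card A \<le> 1 \<Longrightarrow> f \<in> A \<Longrightarrow> g \<in> A \<Longrightarrow> f = g"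
  using card_le_Suc0_iff_eq[of A] by auto

text \<open>\<open>c\<close> colours the leg of length one. The remaining five places tolerate a
  single doubled colour, and there are at most two, so \<open>c\<close> is taken from the doubled
  ones if \<open>z\<close> permits.\<close>

lemma arrange_spider_six:
  assumes "4 \<le> m" "balanced m M" "size M = 6"
  shows "\<exists>c b1 a1 v a2 b2. M = {#c, b1, a1, v, a2, b2#} \<and> b1 \<noteq> a1 \<and> a1 \<noteq> v \<and> v \<noteq> a2 \<and> a2 \<noteq> b2 \<and>
    b1 \<noteq> x \<and> b2 \<noteq> y \<and> v \<noteq> c \<and> c \<noteq> z"
proof -
  have le2: "count M f \<le> 2" for f using balanced_counts(1)[OF assms(1,2)] assms(3) by simp
  have D: "card (doubles M) \<le> 2" using balanced_counts(2)[OF assms(1,2)] assms(3) by auto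
  note D_remove = doubles_remove[OF le2]
  have fin: "finite (doubles M)" by (rule finite_doubles)
  have main: ?thesis if c: "c \<in># M" "c \<noteq> z" "card (doubles M - {c}) \<le> 1" for c
  proof -
    have "size (M - {#c#}) = 5" using c(1) assms(3) by (simp add: size_Diff_singleton)
    moreover have "count (M - {#c#}) f \<le> 2" for f using le2[of f] by (auto intro: le_trans[OF diff_le_self])
    moreover have "f = g" if "f \<in> doubles (M - {#c#})" "g \<in> doubles (M - {#c#})" for f g
      using that card_le_one_unique[of "doubles M - {c}" f g] fin c(3) D_remove by simp
    moreover have "c \<notin> doubles (M - {#c#})" using D_remove by simp
    ultimately obtain b1 a1 v a2 b2 where "M - {#c#} = {#b1, a1, v, a2, b2#}" and
      ne: "b1 \<noteq> a1" "a1 \<noteq> v" "v \<noteq> a2" "a2 \<noteq> b2" "b1 \<noteq> x" "b2 \<noteq> y" "v \<noteq> c"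
      using arrange_path_five[of "M - {#c#}" c x y] by auto
    then have "M = {#c, b1, a1, v, a2, b2#}" using c(1) by (metis insert_DiffM)
    then show ?thesis using ne c(2) by blast
  qed
  show ?thesis
  proof (cases "doubles M \<subseteq> {z}")
    case True
    have "\<not> set_mset M \<subseteq> {z}"
    proof
      assume "set_mset M \<subseteq> {z}"
      then have "size M = count M z" using size_eq_sum_count[of "{z}" M] by simp
      then show False using le2[of z] assms(3) by simp
    qed
    then obtain c where "c \<in># M" "c \<noteq> z" by blast
    moreover have "card (doubles M - {c}) \<le> 1" using True card_mono[of "{z}" "doubles M - {c}"] by auto
    ultimately show ?thesis using main by blast
  next
    case False
    then obtain c where c: "c \<in> doubles M" "c \<noteq> z" by blast
    then have "c \<in># M" unfolding doubles_def by (auto simp flip: count_greater_zero_iff)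
    moreover have "card (doubles M - {c}) \<le> 1" using c(1) D by simp
    ultimately show ?thesis using main c(2) by blast
  qed
qed

text \<open>Now up to three colours are doubled, and the outer colour \<open>b\<close> and the inner
  colour \<open>a\<close> of the third leg absorb two of them. Only the outer one has to avoid
  \<open>z\<close>.\<close>

lemma arrange_spider_seven:
  assumes "4 \<le> m" "balanced m M" "size M = 7"
  shows "\<exists>b3 a3 b1 a1 v a2 b2. M = {#b3, a3, b1, a1, v, a2, b2#} \<and> b1 \<noteq> a1 \<and> a1 \<noteq> v \<and> v \<noteq> a2 \<and> a2 \<noteq> b2 \<and>
    b1 \<noteq> x \<and> b2 \<noteq> y \<and> v \<noteq> a3 \<and> a3 \<noteq> b3 \<and> b3 \<noteq> z"
proof -
  have le2: "count M f \<le> 2" for f using balanced_counts(1)[OF assms(1,2)] assms(3) by simp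
  have D: "card (doubles M) \<le> 3" using balanced_counts(2)[OF assms(1,2)] assms(3) by auto
  have fin: "finite (doubles M)" by (rule finite_doubles)
  have main: ?thesis if ab: "a \<in># M" "b \<in># M" "a \<noteq> b" "b \<noteq> z" "card (doubles M - {b} - {a}) \<le> 1" for a b
  proof -
    let ?N = "M - {#b#} - {#a#}"
    have aN: "a \<in># M - {#b#}" using ab by (simp add: in_diff_count)
    have le2': "count (M - {#b#}) f \<le> 2" for f using le2[of f] by (auto intro: le_trans[OF diff_le_self])
    have DN: "doubles ?N = doubles M - {b} - {a}" using doubles_remove[OF le2'] doubles_remove[OF le2] by simp
    have MN: "M = add_mset b (add_mset a ?N)" using ab(2) aN by (metis insert_DiffM)
    then have "size M = size (add_mset b (add_mset a ?N))" by (rule arg_cong)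
    then have "size ?N = 5" using assms(3) by (simp only: size_add_mset)
    moreover have "count ?N f \<le> 2" for f using le2'[of f] by (auto intro: le_trans[OF diff_le_self])
    moreover have "f = g" if "f \<in> doubles ?N" "g \<in> doubles ?N" for f g
      using that card_le_one_unique[of "doubles M - {b} - {a}" f g] fin ab(5) DN by simp
    moreover have "a \<notin> doubles ?N" using DN by simp
    ultimately obtain b1 a1 v a2 b2 where "?N = {#b1, a1, v, a2, b2#}" and
      ne: "b1 \<noteq> a1" "a1 \<noteq> v" "v \<noteq> a2" "a2 \<noteq> b2" "b1 \<noteq> x" "b2 \<noteq> y" "v \<noteq> a"
      using arrange_path_five[of ?N a x y] by auto
    then have "M = {#b, a, b1, a1, v, a2, b2#}" using MN by simp
    then show ?thesis using ne ab(3,4) by blast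
  qed
  have notsub: "\<not> set_mset M \<subseteq> {p, q}" for p q
  proof
    assume "set_mset M \<subseteq> {p, q}"
    then have "size M = sum (count M) {p, q}" using size_eq_sum_count[of "{p, q}" M] by simp
    also have "\<dots> \<le> sum (\<lambda>_. 2) {p, q}" by (intro sum_mono le2)
    also have "\<dots> \<le> 4" by (simp add: card_insert_if)
    finally show False using assms(3) by simp
  qed
  have in_M: "c \<in># M" if "c \<in> doubles M" for c
    using that unfolding doubles_def by (auto simp flip: count_greater_zero_iff)
  show ?thesis
  proof (cases "doubles M \<subseteq> {z}")
    case True
    obtain b where b: "b \<in># M" "b \<noteq> z" using notsub[of z z] by blast
    obtain a where a: "a \<in># M" "a \<noteq> b" using notsub[of b b] by blast
    have "card (doubles M - {b} - {a}) \<le> 1" using True card_mono[of "{z}" "doubles M - {b} - {a}"] by auto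
    then show ?thesis using main a b by blast
  next
    case False
    then obtain b where b: "b \<in> doubles M" "b \<noteq> z" by blast
    have cb: "card (doubles M - {b}) \<le> 2" using b(1) D by simp
    show ?thesis
    proof (cases "doubles M \<subseteq> {b}")
      case True
      obtain a where a: "a \<in># M" "a \<noteq> b" using notsub[of b b] by blast
      have "doubles M - {b} - {a} = {}" using True by blast
      then have "card (doubles M - {b} - {a}) \<le> 1" by (metis card.empty zero_le_one)
      then show ?thesis by (rule main[OF a(1) in_M[OF b(1)] a(2) b(2)])
    next
      case False
      then obtain a where a: "a \<in> doubles M" "a \<noteq> b" by blast
      then have "card (doubles M - {b} - {a}) \<le> 1" using cb by simp
      then show ?thesis by (rule main[OF in_M[OF a(1)] in_M[OF b(1)] a(2) b(2)])
    qed
  qed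
qed

section \<open>Extending equitable colourings along paths\<close>

lemma list_colouring:
  assumes "distinct ps" "length cs = length ps"
  shows "\<exists>f. map f ps = cs \<and> (\<forall>v. v \<notin> set ps \<longrightarrow> f v = c v)"
  using assms
proof (induction ps arbitrary: cs)
  case Nil
  then show ?case by auto
next
  case (Cons p ps)
  then obtain z zs where z: "cs = z # zs" by (cases cs) auto
  then obtain f where f: "map f ps = zs" "\<forall>v. v \<notin> set ps \<longrightarrow> f v = c v" using Cons by auto
  have "map (f(p := z)) (p # ps) = cs" using f z Cons.prems(1) by auto
  moreover have "\<forall>v. v \<notin> set (p # ps) \<longrightarrow> (f(p := z)) v = c v" using f by auto
  ultimately show ?case by blast
qed

text \<open>Every colour is used \<open>s div m\<close> times, and \<open>s mod m\<close> colours,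
  the set \<open>R\<close>, once more. Choosing \<open>R\<close> comparable to the set
  \<open>S\<close> of currently smallest classes keeps the totals within one of each other.\<close>

lemma balanced_complement:
  fixes n :: "nat \<Rightarrow> nat"
  assumes "0 < m" and n: "\<And>i j. i < m \<Longrightarrow> j < m \<Longrightarrow> n i \<le> n j + 1"
  shows "\<exists>M. balanced m M \<and> size M = s \<and> (\<forall>i<m. \<forall>j<m. n i + count M i \<le> n j + count M j + 1)"
proof -
  define a where "a = Min (n ` {..<m})"
  define S where "S = {i. i < m \<and> n i = a}"
  have a: "a \<le> n i" if "i < m" for i unfolding a_def using that by (intro Min_le) auto
  have "a \<in> n ` {..<m}" unfolding a_def using assms(1) by (intro Min_in) auto
  then obtain i0 where i0: "i0 < m" "n i0 = a" by auto
  have ni: "n i = (if i \<in> S then a else a + 1)" if "i < m" for i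
    using a[OF that] n[OF that i0(1)] i0(2) that unfolding S_def by auto
  have S: "S \<subseteq> {..<m}" unfolding S_def by auto
  then have finS: "finite S" using finite_subset by blast
  have r: "s mod m < m" using assms(1) by simp
  obtain R where R: "R \<subseteq> {..<m}" "card R = s mod m" "R \<subseteq> S \<or> S \<subseteq> R"
  proof (cases "s mod m \<le> card S")
    case True
    then obtain R where "R \<subseteq> S" "card R = s mod m" using obtain_subset_with_card_n by metis
    then show thesis using that S by blast
  next
    case False
    then have "s mod m - card S \<le> card ({..<m} - S)" using r S finS by (simp add: card_Diff_subset)
    then obtain T where T: "T \<subseteq> {..<m} - S" "card T = s mod m - card S" using obtain_subset_with_card_n by metis
    have "finite T" using T(1) finite_subset by blast
    then have "card (S \<union> T) = card S + card T" using T(1) finS by (intro card_Un_disjoint) auto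
    then show thesis using that[of "S \<union> T"] T S False by auto
  qed
  define M where "M = repeat_mset (s div m) (mset_set {..<m}) + mset_set R"
  have finR: "finite R" using R(1) finite_subset by blast
  have cM: "count M i = s div m + (if i \<in> R then 1 else 0)" if "i < m" for i
    unfolding M_def using that finR by (simp add: count_mset_set')
  have "size M = s" unfolding M_def using R(2) by (simp add: mult.commute)
  moreover have "balanced m M"
    unfolding balanced_def
  proof (intro conjI allI impI)
    have "count M x = 0" if "\<not> x < m" for x
      unfolding M_def using that R(1) finR by (auto simp: count_mset_set')
    then show "set_mset M \<subseteq> {..<m}" by (metis count_eq_zero_iff lessThan_iff subsetI)
  qed (simp add: cM)
  moreover have "n i + count M i \<le> n j + count M j + 1" if "i < m" "j < m" for i j
    using R(3) by (auto simp: ni that cM)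
  ultimately show ?thesis by blast
qed

text \<open>
  With three colours, length four is excluded because between two ends of the same colour, that colour
  cannot occur twice on a path of four vertices.
\<close>

definition extendable_length :: "nat \<Rightarrow> nat \<Rightarrow> bool" where
  "extendable_length m n \<longleftrightarrow> (4 \<le> m \<and> 3 \<le> n) \<or> (m = 3 \<and> (n = 3 \<or> 5 \<le> n))"

lemma arrangeable_extendable:
  "extendable_length m n \<Longrightarrow> balanced m M \<Longrightarrow> size M = n \<Longrightarrow> arrangeable M x y"
  unfolding extendable_length_def using arrangeable_balanced arrangeable_balanced_three by blast

text \<open>Planarity enters the colouring argument only through \<open>sparse\<close>, which is 6e
  < 7n for every induced subgraph, with the degree sum in place of 2e.\<close>

locale sparse_graph =
  fixes V :: "'a set" and adj :: "'a \<Rightarrow> 'a \<Rightarrow> bool"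
  assumes finite_V: "finite V"
    and adj_sym: "adj u v \<Longrightarrow> adj v u"
    and adj_irrefl: "\<not> adj v v"
    and sparse: "W \<subseteq> V \<Longrightarrow> W \<noteq> {} \<Longrightarrow> 3 * (\<Sum>v\<in>W. card {u \<in> W. adj v u}) < 7 * card W"
    and girth: "set xs \<subseteq> V \<Longrightarrow> distinct xs \<Longrightarrow> 3 \<le> length xs \<Longrightarrow> successively adj xs \<Longrightarrow>
      adj (last xs) (hd xs) \<Longrightarrow> 14 \<le> length xs"
begin

definition proper :: "'a set \<Rightarrow> nat \<Rightarrow> ('a \<Rightarrow> nat) \<Rightarrow> bool" where
  "proper W m c \<longleftrightarrow> (\<forall>v\<in>W. c v < m) \<and> (\<forall>u\<in>W. \<forall>v\<in>W. adj u v \<longrightarrow> c u \<noteq> c v)"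

definition equitable :: "'a set \<Rightarrow> nat \<Rightarrow> ('a \<Rightarrow> nat) \<Rightarrow> bool" where
  "equitable W m c \<longleftrightarrow> proper W m c \<and>
    (\<forall>i<m. \<forall>j<m. card {v \<in> W. c v = i} \<le> card {v \<in> W. c v = j} + 1)"

text \<open>
  Only the first vertex of the path can have a neighbour in \<open>W\<close> other than \<open>b\<close>, and only the last one
  a neighbour other than \<open>a\<close>. The ends \<open>a\<close> and \<open>b\<close> need not lie in \<open>W\<close>.
\<close>

definition is_path :: "'a set \<Rightarrow> 'a list \<Rightarrow> 'a \<Rightarrow> 'a \<Rightarrow> bool" where
  "is_path W ps a b \<longleftrightarrow> distinct ps \<and> set ps \<inter> W = {} \<and>
    (\<forall>i<length ps. \<forall>j<length ps. adj (ps ! i) (ps ! j) \<longrightarrow> j = Suc i \<or> i = Suc j) \<and>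
    (\<forall>i<length ps. \<forall>u\<in>W. adj (ps ! i) u \<longrightarrow> (i = 0 \<and> u = a) \<or> (Suc i = length ps \<and> u = b))"

text \<open>The second path is one relative to \<open>W\<close> enlarged by the first, and is
  entered from the last vertex of the first. The provisional end \<open>b\<close> lies outside
  \<open>W\<close>, so the outer ends \<open>a\<close> and \<open>b'\<close> are the only
  constraints left.\<close>

lemma is_path_append:
  assumes p: "is_path W ps a b" and b: "b \<notin> W" and q: "is_path (W \<union> set ps) qs (last ps) b'"
    and b': "b' \<notin> set ps" and ne: "ps \<noteq> []" "qs \<noteq> []"
  shows "is_path W (ps @ qs) a b'"
proof -
  have last: "last ps = ps ! (length ps - 1)" using ne by (simp add: last_conv_nth)
  have d: "distinct ps" "distinct qs" "set ps \<inter> W = {}" "set qs \<inter> (W \<union> set ps) = {}"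
    using p q unfolding is_path_def by auto
  have pq: "j = 0 \<and> Suc i = length ps" if "i < length ps" "j < length qs" "adj (qs ! j) (ps ! i)" for i j
  proof -
    have "ps ! i \<in> set ps" using that by simp
    then have "j = 0 \<and> ps ! i = last ps" using q that b' unfolding is_path_def by blast
    then show ?thesis using last d(1) that(1) ne by (simp add: nth_eq_iff_index_eq)
  qed
  show ?thesis unfolding is_path_def
  proof (intro conjI allI impI ballI)
    show "distinct (ps @ qs)" "set (ps @ qs) \<inter> W = {}" using d by auto
  next
    fix i j assume i: "i < length (ps @ qs)" and j: "j < length (ps @ qs)" and adj: "adj ((ps @ qs) ! i) ((ps @ qs) ! j)"
    show "j = Suc i \<or> i = Suc j"
    proof (cases "i < length ps"; cases "j < length ps")
      assume "i < length ps" "j < length ps"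
      then show ?thesis using adj p unfolding is_path_def by (simp add: nth_append)
    next
      assume a: "i < length ps" "\<not> j < length ps"
      then have "adj (qs ! (j - length ps)) (ps ! i)" using adj adj_sym by (simp add: nth_append)
      moreover have "j - length ps < length qs" using a j by auto
      ultimately show ?thesis using pq[of i "j - length ps"] a by auto
    next
      assume a: "\<not> i < length ps" "j < length ps"
      then have "adj (qs ! (i - length ps)) (ps ! j)" using adj by (simp add: nth_append)
      moreover have "i - length ps < length qs" using a i by auto
      ultimately show ?thesis using pq[of j "i - length ps"] a by auto
    next
      assume a: "\<not> i < length ps" "\<not> j < length ps"
      then have "adj (qs ! (i - length ps)) (qs ! (j - length ps))" using adj by (simp add: nth_append)
      then have "j - length ps = Suc (i - length ps) \<or> i - length ps = Suc (j - length ps)"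
        using q a i j unfolding is_path_def by auto
      then show ?thesis using a by auto
    qed
  next
    fix i u assume i: "i < length (ps @ qs)" and u: "u \<in> W" and adj: "adj ((ps @ qs) ! i) u"
    show "i = 0 \<and> u = a \<or> Suc i = length (ps @ qs) \<and> u = b'"
    proof (cases "i < length ps")
      case True
      then show ?thesis using adj p u b unfolding is_path_def by (auto simp: nth_append)
    next
      case False
      then have "adj (qs ! (i - length ps)) u" "i - length ps < length qs" using adj i by (auto simp: nth_append)
      moreover have "u \<noteq> last ps" using u d(3) ne(1) last_in_set by blast
      ultimately have "Suc (i - length ps) = length qs \<and> u = b'" using q u unfolding is_path_def by blast
      then show ?thesis using False by auto
    qed
  qed
qed

lemma extend_colouring_path:
  assumes c: "proper W m c" and p: "is_path W ps a b" and len: "length cs = length ps"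
    and cs: "set cs \<subseteq> {..<m}" "distinct_adj cs" "cs \<noteq> [] \<Longrightarrow> hd cs \<noteq> c a \<and> last cs \<noteq> c b"
  shows "\<exists>c'. proper (W \<union> set ps) m c' \<and> (\<forall>v. v \<notin> set ps \<longrightarrow> c' v = c v) \<and> map c' ps = cs"
proof -
  have d: "distinct ps" "set ps \<inter> W = {}" using p unfolding is_path_def by auto
  obtain c' where c': "map c' ps = cs" "\<forall>v. v \<notin> set ps \<longrightarrow> c' v = c v" using list_colouring[OF d(1) len, of c] by auto
  have nth: "c' (ps ! i) = cs ! i" if "i < length ps" for i using c'(1) that by (metis nth_map)
  have on_W: "c' v = c v" if "v \<in> W" for v using c'(2) d(2) that by blast
  have path_W: "c' (ps ! i) \<noteq> c' u" if i: "i < length ps" and u: "u \<in> W" "adj (ps ! i) u" for i u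
  proof -
    have ne: "cs \<noteq> []" using i len by auto
    have "(i = 0 \<and> u = a) \<or> (Suc i = length ps \<and> u = b)" using p i u unfolding is_path_def by blast
    moreover have "last cs = cs ! i" if "Suc i = length ps"
      using that ne len by (metis diff_Suc_1 last_conv_nth)
    ultimately have "(cs ! i = hd cs \<and> u = a) \<or> (cs ! i = last cs \<and> u = b)"
      using ne by (auto simp: hd_conv_nth)
    then show ?thesis using cs(3)[OF ne] nth[OF i] on_W[OF u(1)] by auto
  qed
  have "proper (W \<union> set ps) m c'"
    unfolding proper_def
  proof (intro conjI ballI impI)
    fix v assume "v \<in> W \<union> set ps"
    then show "c' v < m"
    proof
      assume "v \<in> W" then show ?thesis using c on_W unfolding proper_def by simp
    next
      assume "v \<in> set ps"
      then have "c' v \<in> set cs" using c'(1) by auto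
      then show ?thesis using cs(1) by blast
    qed
  next
    fix u v assume u: "u \<in> W \<union> set ps" and v: "v \<in> W \<union> set ps" and uv: "adj u v"
    consider "u \<in> W" "v \<in> W" | i where "i < length ps" "u = ps ! i" "v \<in> W" | j where "j < length ps" "v = ps ! j" "u \<in> W"
      | i j where "i < length ps" "u = ps ! i" "j < length ps" "v = ps ! j"
      using u v unfolding in_set_conv_nth Un_iff by metis
    then show "c' u \<noteq> c' v"
    proof cases
      case 1 then show ?thesis using c uv on_W unfolding proper_def by simp
    next
      case 2 then show ?thesis using path_W uv by blast
    next
      case 3 then show ?thesis using path_W[of j u] adj_sym[OF uv] by metis
    next
      case 4
      then have "j = Suc i \<or> i = Suc j" using p uv unfolding is_path_def by blast
      then show ?thesis using 4 nth cs(2) len unfolding distinct_adj_conv_nth by (metis Suc_lessD)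
    qed
  qed
  then show ?thesis using c' by blast
qed

text \<open>Equitability is reduced to prescribed class sizes on \<open>U\<close>: among the
  balanced multisets, \<open>balanced_complement\<close> selects one that evens out the
  totals.\<close>

lemma equitable_extend:
  assumes "0 < m" "finite W" "finite U" "W \<inter> U = {}" and c: "equitable W m c"
    and ext: "\<And>M. balanced m M \<Longrightarrow> size M = card U \<Longrightarrow>
      \<exists>c'. (\<forall>v\<in>W. c' v = c v) \<and> proper (W \<union> U) m c' \<and> (\<forall>i<m. card {v \<in> U. c' v = i} = count M i)"
  shows "\<exists>c'. (\<forall>v\<in>W. c' v = c v) \<and> equitable (W \<union> U) m c'"
proof -
  let ?n = "\<lambda>i. card {v \<in> W. c v = i}"
  obtain M where M: "balanced m M" "size M = card U" "\<forall>i<m. \<forall>j<m. ?n i + count M i \<le> ?n j + count M j + 1"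
    using balanced_complement[OF assms(1), of ?n "card U"] c unfolding equitable_def by blast
  obtain c' where c': "\<forall>v\<in>W. c' v = c v" "proper (W \<union> U) m c'" "\<forall>i<m. card {v \<in> U. c' v = i} = count M i"
    using ext[OF M(1,2)] by blast
  have "card {v \<in> W \<union> U. c' v = i} = ?n i + count M i" if "i < m" for i
  proof -
    have "{v \<in> W \<union> U. c' v = i} = {v \<in> W. c v = i} \<union> {v \<in> U. c' v = i}" using c'(1) by auto
    then have "card {v \<in> W \<union> U. c' v = i} = card {v \<in> W. c v = i} + card {v \<in> U. c' v = i}"
      using assms(2-4) by (simp add: card_Un_disjoint disjoint_iff)
    then show ?thesis using c'(3) that by simp
  qed
  then have "equitable (W \<union> U) m c'" unfolding equitable_def using c'(2) M(3) by simp
  then show ?thesis using c'(1) by blast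
qed

lemma card_colour_class_list:
  assumes "distinct ps"
  shows "card {v \<in> set ps. c v = i} = count (mset (map c ps)) i"
proof -
  have "count (mset (map c ps)) i = length (filter (\<lambda>v. c v = i) ps)"
    by (induction ps) auto
  also have "\<dots> = card (set (filter (\<lambda>v. c v = i) ps))"
    using assms by (intro distinct_card[symmetric]) simp
  finally show ?thesis by simp
qed

lemma equitable_extend_path:
  assumes m: "0 < m" and W: "finite W" and c: "equitable W m c" and p: "is_path W ps a b"
    and len: "extendable_length m (length ps)"
  shows "\<exists>c'. equitable (W \<union> set ps) m c'"
proof -
  have d: "distinct ps" "set ps \<inter> W = {}" using p unfolding is_path_def by auto
  have "\<exists>c'. (\<forall>v\<in>W. c' v = c v) \<and> proper (W \<union> set ps) m c' \<and> (\<forall>i<m. card {v \<in> set ps. c' v = i} = count M i)"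
    if M: "balanced m M" "size M = card (set ps)" for M
  proof -
    have "size M = length ps" using M(2) d(1) by (simp add: distinct_card)
    then have "arrangeable M (c a) (c b)" using arrangeable_extendable[OF len M(1)] by simp
    then obtain cs where cs: "mset cs = M" "distinct_adj cs" "hd cs \<noteq> c a" "last cs \<noteq> c b"
      unfolding arrangeable_def by blast
    have "length cs = length ps" using cs(1) \<open>size M = length ps\<close> by (metis size_mset)
    moreover have "set cs \<subseteq> {..<m}" using M(1) cs(1) unfolding balanced_def by (metis set_mset_mset)
    ultimately obtain c' where c': "proper (W \<union> set ps) m c'" "\<forall>v. v \<notin> set ps \<longrightarrow> c' v = c v" "map c' ps = cs"
      using extend_colouring_path[OF _ p, of m c cs] c cs unfolding equitable_def by blast
    then show ?thesis using d cs(1) card_colour_class_list[OF d(1), of c'] by (intro exI[of _ c']) auto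
  qed
  then show ?thesis using equitable_extend[OF m W _ _ c, of "set ps"] d(2) by blast
qed

end

section \<open>Minimal counterexamples and their threads\<close>

locale min_counterexample = sparse_graph +
  fixes W :: "'a set" and m :: nat
  assumes m: "3 \<le> m" and W: "W \<subseteq> V"
    and min_deg: "v \<in> W \<Longrightarrow> 2 \<le> card {u \<in> W. adj v u}"
    and smaller: "U \<subset> W \<Longrightarrow> \<forall>v\<in>U. 2 \<le> card {u \<in> U. adj v u} \<Longrightarrow> \<exists>c. equitable U m c"
    and counterexample: "\<not> (\<exists>c. equitable W m c)"
begin

definition nbrs :: "'a \<Rightarrow> 'a set" where
  "nbrs v = {u \<in> W. adj v u}"

definition deg :: "'a \<Rightarrow> nat" where
  "deg v = card (nbrs v)"

lemma finite_W: "finite W"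
  using W finite_V finite_subset by blast

lemma finite_nbrs: "finite (nbrs v)"
  unfolding nbrs_def using finite_W by simp

lemma nbrs_sym: "u \<in> W \<Longrightarrow> v \<in> nbrs u \<Longrightarrow> u \<in> nbrs v"
  unfolding nbrs_def using adj_sym by blast

lemma nbrs_in_W: "v \<in> nbrs u \<Longrightarrow> v \<in> W"
  unfolding nbrs_def by blast

lemma nbrs_irrefl: "u \<notin> nbrs u"
  unfolding nbrs_def using adj_irrefl by blast

lemma deg_ge_2: "v \<in> W \<Longrightarrow> 2 \<le> deg v"
  unfolding deg_def nbrs_def using min_deg .

lemma reducible:
  assumes "U \<subset> W" "\<And>v. v \<in> U \<Longrightarrow> 2 \<le> card (nbrs v \<inter> U)"
  shows "\<exists>c. equitable U m c"
proof (rule smaller[OF assms(1)], rule ballI)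
  fix v assume v: "v \<in> U"
  have "nbrs v \<inter> U = {u \<in> U. adj v u}" unfolding nbrs_def using assms(1) by blast
  then show "2 \<le> card {u \<in> U. adj v u}" using assms(2)[OF v] by simp
qed

text \<open>
  \<open>walk u v\<close> follows the edge from \<open>u\<close> to \<open>v\<close> without turning back. The step is forced at vertices of
  degree two and an arbitrary choice at all others.
\<close>

definition next_vertex :: "'a \<Rightarrow> 'a \<Rightarrow> 'a" where
  "next_vertex u v = (SOME w. w \<in> nbrs v \<and> w \<noteq> u)"

fun walk :: "'a \<Rightarrow> 'a \<Rightarrow> nat \<Rightarrow> 'a" where
  "walk u v 0 = u"
| "walk u v (Suc 0) = v"
| "walk u v (Suc (Suc n)) = next_vertex (walk u v n) (walk u v (Suc n))"

lemma next_vertex: "v \<in> W \<Longrightarrow> next_vertex u v \<in> nbrs v \<and> next_vertex u v \<noteq> u"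
proof -
  assume "v \<in> W"
  then have "\<not> nbrs v \<subseteq> {u}"
    using deg_ge_2 card_mono[of "{u}" "nbrs v"] unfolding deg_def by fastforce
  then have "\<exists>w. w \<in> nbrs v \<and> w \<noteq> u" by blast
  then show ?thesis unfolding next_vertex_def by (rule someI_ex)
qed

lemma walk_step:
  assumes "u \<in> W" "v \<in> nbrs u"
  shows "walk u v n \<in> W \<and> walk u v (Suc n) \<in> nbrs (walk u v n)"
proof (induction n)
  case 0
  then show ?case using assms by simp
next
  case (Suc n)
  then have "walk u v (Suc n) \<in> W" using nbrs_in_W by blast
  then show ?case using next_vertex by simp
qed

lemma walk_no_return:
  assumes "u \<in> W" "v \<in> nbrs u"
  shows "walk u v (Suc (Suc n)) \<noteq> walk u v n"
proof -
  have "walk u v (Suc n) \<in> W" using walk_step[OF assms] by blast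
  then show ?thesis using next_vertex by simp
qed

lemma nbrs_walk:
  assumes "u \<in> W" "v \<in> nbrs u" "deg (walk u v (Suc n)) = 2"
  shows "nbrs (walk u v (Suc n)) = {walk u v n, walk u v (Suc (Suc n))}"
proof -
  have "walk u v n \<in> nbrs (walk u v (Suc n))" "walk u v (Suc (Suc n)) \<in> nbrs (walk u v (Suc n))"
    using walk_step[OF assms(1,2)] nbrs_sym by blast+
  moreover have "card {walk u v n, walk u v (Suc (Suc n))} = 2"
    using walk_no_return[OF assms(1,2), of n] by (metis card_2_iff)
  ultimately show ?thesis
    using assms(3) finite_nbrs unfolding deg_def by (metis card_subset_eq empty_subsetI insert_subset)
qed

text \<open>At a first repetition the earlier occurrence has degree two, so the vertex before the
  later occurrence is one of its two neighbours on the walk. This yields an earlier repetition, a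
  return to \<open>u\<close>, or a step back.\<close>

lemma walk_distinct_from_earlier:
  assumes uv: "u \<in> W" "v \<in> nbrs u"
    and deg2: "\<And>k. 1 \<le> k \<Longrightarrow> k \<le> n \<Longrightarrow> deg (walk u v k) = 2 \<and> walk u v k \<noteq> u"
  shows "j \<le> Suc n \<Longrightarrow> 1 \<le> i \<Longrightarrow> i < j \<Longrightarrow> walk u v i \<noteq> walk u v j"
proof (induction j arbitrary: i)
  case 0
  then show ?case by simp
next
  case (Suc j)
  obtain i' where i': "i = Suc i'" using Suc.prems(2) by (cases i) auto
  show ?case
  proof
    assume eq: "walk u v i = walk u v (Suc j)"
    have "deg (walk u v i) = 2" using deg2[of i] Suc.prems by auto
    then have N: "nbrs (walk u v i) = {walk u v i', walk u v (Suc i)}" using nbrs_walk[OF uv] i' by blast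
    have "walk u v j \<in> nbrs (walk u v (Suc j))" using walk_step[OF uv] nbrs_sym by blast
    then have "walk u v j = walk u v i' \<or> walk u v j = walk u v (Suc i)" using N eq by auto
    then show False
    proof
      assume a: "walk u v j = walk u v i'"
      show False
      proof (cases "i' = 0")
        case True
        then show False using a deg2[of j] Suc.prems i' by auto
      next
        case False
        then show False using a Suc.IH[of i'] Suc.prems i' by auto
      qed
    next
      assume a: "walk u v j = walk u v (Suc i)"
      have "\<not> Suc i < j" using a Suc.IH[of "Suc i"] Suc.prems by auto
      then consider "j = i" | "j = Suc i" using Suc.prems by linarith
      then show False
      proof cases
        case 1
        then show False using a walk_step[OF uv, of i] nbrs_irrefl by metis
      next
        case 2
        then show False using eq walk_no_return[OF uv, of i] by simp
      qed
    qed
  qed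
qed

lemma walk_stops:
  assumes uv: "u \<in> W" "v \<in> nbrs u"
  shows "\<exists>n. 3 \<le> deg (walk u v (Suc n)) \<or> walk u v (Suc n) = u"
proof (rule ccontr)
  assume no: "\<not> ?thesis"
  have deg2: "deg (walk u v k) = 2 \<and> walk u v k \<noteq> u" if pos: "1 \<le> k" for k
  proof -
    obtain k' where k: "k = Suc k'" using pos by (cases k) auto
    have "walk u v k \<in> W" using walk_step[OF uv] by blast
    then have "2 \<le> deg (walk u v k)" by (rule deg_ge_2)
    moreover have "\<not> 3 \<le> deg (walk u v k)" "walk u v k \<noteq> u" using no k by auto
    ultimately show ?thesis by linarith
  qed
  let ?K = "{1..Suc (card W)}"
  have "inj_on (walk u v) ?K"
  proof (rule linorder_inj_onI)
    fix i j :: nat assume "i < j" "i \<in> ?K" "j \<in> ?K"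
    then show "walk u v i \<noteq> walk u v j"
      using walk_distinct_from_earlier[OF uv, of "Suc (card W)" j i] deg2 by auto
  qed auto
  moreover have "walk u v ` ?K \<subseteq> W" using walk_step[OF uv] by blast
  ultimately have "card ?K \<le> card W" using card_inj_on_le finite_W by blast
  then show False by simp
qed

text \<open>At vertices of degree two the choice in \<open>next_vertex\<close> is forced, so walking
  back retraces the walk.\<close>

lemma walk_reverse:
  assumes uv: "u \<in> W" "v \<in> nbrs u"
    and deg2: "\<And>k. 1 \<le> k \<Longrightarrow> k \<le> n \<Longrightarrow> deg (walk u v k) = 2"
  shows "i \<le> Suc n \<Longrightarrow> walk (walk u v (Suc n)) (walk u v n) i = walk u v (Suc n - i)"
proof (induction i rule: less_induct)
  case (less i)
  consider "i = 0" | "i = 1" | k where "i = Suc (Suc k)" by (metis One_nat_def not0_implies_Suc)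
  then show ?case
  proof cases
    case 1 then show ?thesis by simp
  next
    case 2 then show ?thesis by simp
  next
    case 3
    define j where "j = n - Suc k"
    have j: "Suc n - i = j" "Suc n - Suc k = Suc j" "Suc n - k = Suc (Suc j)" unfolding j_def using 3 less.prems by auto
    have "walk (walk u v (Suc n)) (walk u v n) i
        = next_vertex (walk u v (Suc (Suc j))) (walk u v (Suc j))"
      using 3 less.IH[of k] less.IH[of "Suc k"] less.prems j by simp
    moreover have "next_vertex (walk u v (Suc (Suc j))) (walk u v (Suc j)) = walk u v j"
    proof -
      have "deg (walk u v (Suc j)) = 2" using deg2[of "Suc j"] j 3 less.prems by simp
      then have "nbrs (walk u v (Suc j)) = {walk u v j, walk u v (Suc (Suc j))}" using nbrs_walk[OF uv] by blast
      moreover have "walk u v (Suc j) \<in> W" using walk_step[OF uv] by blast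
      ultimately show ?thesis using next_vertex[of "walk u v (Suc j)" "walk u v (Suc (Suc j))"] by auto
    qed
    ultimately show ?thesis using j by simp
  qed
qed

lemma is_path_walk_segment:
  assumes uv: "u \<in> W" "v \<in> nbrs u" and X: "X \<subseteq> W" and p: "1 \<le> p"
    and deg2: "\<And>k. p \<le> k \<Longrightarrow> k < q \<Longrightarrow> deg (walk u v k) = 2 \<and> walk u v k \<notin> X
      \<and> walk u v k \<noteq> walk u v (p - 1) \<and> walk u v k \<noteq> walk u v q"
    and inj: "inj_on (walk u v) {p..<q}"
  shows "is_path X (map (walk u v) [p..<q]) (walk u v (p - 1)) (walk u v q)"
proof -
  let ?ps = "map (walk u v) [p..<q]"
  have N: "nbrs (walk u v k) = {walk u v (k - 1), walk u v (Suc k)}" if "p \<le> k" "k < q" for k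
    using nbrs_walk[OF uv, of "k - 1"] deg2[OF that] p that(1) by simp
  have inW: "walk u v k \<in> W" for k using walk_step[OF uv] by blast
  show ?thesis unfolding is_path_def
  proof (intro conjI allI impI ballI)
    show "distinct ?ps" using inj by (simp add: distinct_map)
    show "set ?ps \<inter> X = {}" using deg2 by auto
  next
    fix i j assume i: "i < length ?ps" and j: "j < length ?ps" and adj: "adj (?ps ! i) (?ps ! j)"
    let ?i = "p + i" and ?j = "p + j"
    have ij: "p \<le> ?i" "?i < q" "p \<le> ?j" "?j < q" using i j by auto
    have "walk u v ?j \<in> nbrs (walk u v ?i)" using adj i j inW unfolding nbrs_def by simp
    then consider "walk u v ?j = walk u v (?i - 1)" | "walk u v ?j = walk u v (Suc ?i)" using N[OF ij(1,2)] by auto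
    then show "j = Suc i \<or> i = Suc j"
    proof cases
      case 1
      have "i \<noteq> 0" using 1 deg2[OF ij(3,4)] by (cases "i = 0") auto
      then have "?j = ?i - 1" using 1 inj ij by (intro inj_onD[OF inj 1]) auto
      then show ?thesis using \<open>i \<noteq> 0\<close> by auto
    next
      case 2
      have "Suc ?i \<noteq> q" using 2 deg2[OF ij(3,4)] by metis
      then have "?j = Suc ?i" using ij by (intro inj_onD[OF inj 2]) auto
      then show ?thesis by auto
    qed
  next
    fix i w assume i: "i < length ?ps" and w: "w \<in> X" and adj: "adj (?ps ! i) w"
    let ?i = "p + i"
    have ij: "p \<le> ?i" "?i < q" using i by auto
    have "w \<in> nbrs (walk u v ?i)" using adj i w X unfolding nbrs_def by auto
    then consider "w = walk u v (?i - 1)" | "w = walk u v (Suc ?i)" using N[OF ij] by auto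
    then show "i = 0 \<and> w = walk u v (p - 1) \<or> Suc i = length ?ps \<and> w = walk u v q"
    proof cases
      case 1
      have "i = 0"
      proof (rule ccontr)
        assume "i \<noteq> 0"
        then have "walk u v (?i - 1) \<notin> X" using deg2[of "?i - 1"] ij by auto
        then show False using 1 w by simp
      qed
      then show ?thesis using 1 by simp
    next
      case 2
      have "Suc ?i = q"
      proof (rule ccontr)
        assume "Suc ?i \<noteq> q"
        then have "walk u v (Suc ?i) \<notin> X" using deg2[of "Suc ?i"] ij by auto
        then show False using 2 w by simp
      qed
      then show ?thesis using 2 by auto
    qed
  qed
qed

lemma extendable_six: "extendable_length m 6" "6 \<le> n \<Longrightarrow> extendable_length m n"
  unfolding extendable_length_def using m by auto

text \<open>Otherwise the walk closes up through vertices of degree two, and it runs around a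
  component that is a cycle. Such a component can be removed and its cycle coloured
  afterwards.\<close>

lemma walk_reaches_hub:
  assumes uv: "u \<in> W" "v \<in> nbrs u"
  shows "\<exists>n. 3 \<le> deg (walk u v (Suc n)) \<and> (\<forall>k. 1 \<le> k \<longrightarrow> k \<le> n \<longrightarrow> deg (walk u v k) = 2 \<and> walk u v k \<noteq> u)"
proof -
  let ?s = "walk u v"
  let ?P = "\<lambda>n. 3 \<le> deg (?s (Suc n)) \<or> ?s (Suc n) = u"
  define n where "n = (LEAST n. ?P n)"
  have P: "?P n" unfolding n_def using walk_stops[OF uv] by (rule LeastI_ex)
  have inW: "?s k \<in> W" for k using walk_step[OF uv] by blast
  have deg2: "deg (?s k) = 2 \<and> ?s k \<noteq> u" if k: "1 \<le> k" "k \<le> n" for k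
  proof -
    obtain k' where k': "k = Suc k'" using k(1) by (cases k) auto
    then have "\<not> ?P k'" using k(2) not_less_Least[of k' ?P] unfolding n_def by simp
    then show ?thesis using deg_ge_2[OF inW[of k]] k' by auto
  qed
  show ?thesis
  proof (cases "3 \<le> deg (?s (Suc n))")
    case True
    then show ?thesis using deg2 by blast
  next
    case False
    then have ret: "?s (Suc n) = u" and degu: "deg u = 2" using P deg_ge_2[OF inW[of "Suc n"]] by auto
    have "n \<noteq> 0" using ret uv(2) nbrs_irrefl by (metis walk.simps(2))
    moreover have "n \<noteq> 1" using ret walk_no_return[OF uv, of 0] by auto
    ultimately have n: "2 \<le> n" by linarith
    have d2: "deg (?s k) = 2" if "1 \<le> k" "k \<le> Suc n" for k
      using deg2[of k] that ret degu by (cases "k = Suc n") auto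
    have inj: "inj_on ?s {1..Suc n}"
    proof (rule linorder_inj_onI)
      fix i j assume "i < j" "i \<in> {1..Suc n}" "j \<in> {1..Suc n}"
      then show "?s i \<noteq> ?s j" using walk_distinct_from_earlier[OF uv, of n j i] deg2 by auto
    qed auto
    have last: "?s (Suc (Suc n)) = ?s 1"
    proof -
      have N: "nbrs u = {?s n, ?s (Suc (Suc n))}" using nbrs_walk[OF uv, of n] degu ret by simp
      have "?s 1 \<noteq> ?s n" using inj_onD[OF inj, of 1 n] n by auto
      then show ?thesis using N uv(2) by auto
    qed
    let ?C = "?s ` {1..Suc n}"
    let ?xs = "map ?s [1..<Suc (Suc n)]"
    have "14 \<le> length ?xs"
    proof (rule girth)
      show "set ?xs \<subseteq> V" using inW W by auto
      have "{1..<Suc (Suc n)} = {1..Suc n}" by auto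
      then show "distinct ?xs" using inj by (simp add: distinct_map del: upt_Suc)
      show "3 \<le> length ?xs" using n by simp
      have step: "adj (?s k) (?s (Suc k))" for k using walk_step[OF uv, of k] unfolding nbrs_def by blast
      show "successively adj ?xs" unfolding successively_conv_nth using step by (simp del: upt_Suc walk.simps)
      have "last ?xs = ?s (Suc n)" "hd ?xs = ?s 1" by (auto simp: last_map hd_map simp del: upt_Suc)
      then show "adj (last ?xs) (hd ?xs)" using step[of "Suc n"] last by metis
    qed
    then have n14: "13 \<le> n" by (simp del: upt_Suc)
    have NC: "nbrs (?s k) \<subseteq> ?C" if k: "1 \<le> k" "k \<le> Suc n" for k
    proof -
      obtain k' where k': "k = Suc k'" using k(1) by (cases k) auto
      then have N: "nbrs (?s k) = {?s k', ?s (Suc k)}" using nbrs_walk[OF uv, of k'] d2[OF k] by simp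
      have "?s k' \<in> ?C" using ret k' k(2) by (cases "k' = 0") (auto intro!: image_eqI[of _ _ "Suc n"])
      moreover have "?s (Suc k) \<in> ?C" using last k by (cases "k = Suc n") (auto simp del: walk.simps)
      ultimately show ?thesis using N by auto
    qed
    have "?C \<subseteq> W" using inW by blast
    have "\<exists>c. equitable (W - ?C) m c"
    proof (rule reducible)
      have "?s 1 \<in> ?C" by (rule imageI) simp
      then show "W - ?C \<subset> W" using inW[of 1] by blast
      fix w assume w: "w \<in> W - ?C"
      have "nbrs w \<inter> ?C = {}"
      proof (rule ccontr)
        assume "nbrs w \<inter> ?C \<noteq> {}"
        then obtain k where k: "1 \<le> k" "k \<le> Suc n" "?s k \<in> nbrs w" by auto
        then have "w \<in> nbrs (?s k)" using nbrs_sym w by blast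
        then show False using NC[OF k(1,2)] w by blast
      qed
      then have "nbrs w \<inter> (W - ?C) = nbrs w" using nbrs_in_W by blast
      then show "2 \<le> card (nbrs w \<inter> (W - ?C))" using deg_ge_2 w unfolding deg_def by simp
    qed
    then obtain c where c: "equitable (W - ?C) m c" by blast
    have neq: "?s i \<noteq> ?s j" if "1 \<le> i" "i \<le> Suc n" "1 \<le> j" "j \<le> Suc n" "i \<noteq> j" for i j
      using inj_onD[OF inj, of i j] that by auto
    \<comment> \<open>A cycle is not a path in the sense of \<open>is_path\<close>, so it is cut
      into six vertices, whose neighbours outside the piece are still uncoloured, and a rest of at
      least eight. Both lengths are extendable for every \<open>m\<close>.\<close>
    let ?p1 = "map ?s [1..<7]" and ?p2 = "map ?s [7..<Suc (Suc n)]"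
    have inC: "?s k \<in> ?C" if "1 \<le> k" "k \<le> Suc n" for k using that by (intro imageI) simp
    have "is_path (W - ?C) ?p1 (?s (1 - 1)) (?s 7)"
    proof (rule is_path_walk_segment[OF uv])
      show "inj_on ?s {1..<7}" by (rule inj_on_subset[OF inj]) (use n14 in auto)
      fix k :: nat assume k: "1 \<le> k" "k < 7"
      then have "?s k \<noteq> ?s 0" "?s k \<noteq> ?s 7" using n14 deg2[of k] neq[of k 7] by simp_all
      then show "deg (?s k) = 2 \<and> ?s k \<notin> W - ?C \<and> ?s k \<noteq> ?s (1 - 1) \<and> ?s k \<noteq> ?s 7"
        using k n14 d2[of k] inC[of k] by simp
    qed simp_all
    then obtain c1 where c1: "equitable (W - ?C \<union> set ?p1) m c1"
      using equitable_extend_path[OF _ _ c, of ?p1] m finite_W extendable_six(1) by auto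
    have "is_path (W - ?C \<union> set ?p1) ?p2 (?s (7 - 1)) (?s (Suc (Suc n)))"
    proof (rule is_path_walk_segment[OF uv])
      show "W - ?C \<union> set ?p1 \<subseteq> W" using inW by auto
      show "inj_on ?s {7..<Suc (Suc n)}" by (rule inj_on_subset[OF inj]) auto
      fix k :: nat assume k: "7 \<le> k" "k < Suc (Suc n)"
      have "?s k \<notin> set ?p1"
      proof
        assume "?s k \<in> set ?p1"
        then obtain i where "1 \<le> i" "i < 7" "?s k = ?s i" by auto
        then show False using neq[of k i] k n14 by simp
      qed
      moreover have "?s k \<noteq> ?s 6" "?s k \<noteq> ?s 1" using k n14 neq[of k 6] neq[of k 1] by auto
      ultimately show "deg (?s k) = 2 \<and> ?s k \<notin> W - ?C \<union> set ?p1 \<and> ?s k \<noteq> ?s (7 - 1) \<and> ?s k \<noteq> ?s (Suc (Suc n))"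
        unfolding last using k d2[of k] inC[of k] by simp
    qed simp
    moreover have "finite (W - ?C \<union> set ?p1)" using finite_W by simp
    moreover have "extendable_length m (length ?p2)" using n14 by (intro extendable_six(2)) (simp del: upt_Suc)
    ultimately obtain c2 where c2: "equitable (W - ?C \<union> set ?p1 \<union> set ?p2) m c2"
      using equitable_extend_path[OF _ _ c1, of ?p2] m by (metis gr0I not_numeral_le_zero)
    have "{1..<7} \<union> {7..<Suc (Suc n)} = {1..Suc n}" using n14 by auto
    then have "set ?p1 \<union> set ?p2 = ?C" by (metis image_Un set_map set_upt)
    then have "W - ?C \<union> set ?p1 \<union> set ?p2 = W" using \<open>?C \<subseteq> W\<close> by blast
    then show ?thesis using c2 counterexample by auto
  qed
qed

text \<open>
  A hub is a vertex of degree at least three. A dart \<open>d = (u, v)\<close> stands for the thread that leaves the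
  hub \<open>u\<close> through its neighbour \<open>v\<close>: its vertices are \<open>wk d 0 = u, wk d 1 = v, \<dots>\<close>, of which \<open>len d\<close>
  are inner vertices, it ends in the hub \<open>fin d\<close>, and \<open>rv d\<close> is the same thread seen from there.
\<close>

definition hub_darts :: "('a \<times> 'a) set" where
  "hub_darts = {(u, v). u \<in> W \<and> 3 \<le> deg u \<and> v \<in> nbrs u}"

definition wk :: "'a \<times> 'a \<Rightarrow> nat \<Rightarrow> 'a" where
  "wk d = walk (fst d) (snd d)"

definition len :: "'a \<times> 'a \<Rightarrow> nat" where
  "len d = (LEAST n. 3 \<le> deg (wk d (Suc n)))"

definition fin :: "'a \<times> 'a \<Rightarrow> 'a" where
  "fin d = wk d (Suc (len d))"

definition rv :: "'a \<times> 'a \<Rightarrow> 'a \<times> 'a" where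
  "rv d = (fin d, wk d (len d))"

definition inner :: "'a \<times> 'a \<Rightarrow> 'a set" where
  "inner d = wk d ` {1..len d}"

definition thread :: "'a \<times> 'a \<Rightarrow> 'a list" where
  "thread d = map (wk d) [1..<Suc (len d)]"

lemma set_thread: "set (thread d) = inner d"
  unfolding thread_def inner_def by auto

lemma length_thread: "length (thread d) = len d"
  unfolding thread_def by simp

lemma hub_dartD: "d \<in> hub_darts \<Longrightarrow> fst d \<in> W \<and> 3 \<le> deg (fst d) \<and> snd d \<in> nbrs (fst d)"
  unfolding hub_darts_def by auto

lemma wk_0 [simp]: "wk d 0 = fst d" and wk_1: "wk d (Suc 0) = snd d"
  unfolding wk_def by simp_all

lemma len:
  assumes "fst d \<in> W" "snd d \<in> nbrs (fst d)"
  shows "3 \<le> deg (fin d)" "1 \<le> k \<Longrightarrow> k \<le> len d \<Longrightarrow> deg (wk d k) = 2 \<and> wk d k \<noteq> fst d"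
proof -
  obtain n where n: "3 \<le> deg (wk d (Suc n))" "\<And>k. 1 \<le> k \<Longrightarrow> k \<le> n \<Longrightarrow> deg (wk d k) = 2 \<and> wk d k \<noteq> fst d"
    using walk_reaches_hub[OF assms] unfolding wk_def by blast
  have "len d = n" unfolding len_def
  proof (rule Least_equality)
    fix y assume y: "3 \<le> deg (wk d (Suc y))"
    show "n \<le> y"
    proof (rule ccontr)
      assume "\<not> n \<le> y"
      then have "deg (wk d (Suc y)) = 2" using n(2)[of "Suc y"] by simp
      then show False using y by simp
    qed
  qed (rule n(1))
  then show "3 \<le> deg (fin d)" "1 \<le> k \<Longrightarrow> k \<le> len d \<Longrightarrow> deg (wk d k) = 2 \<and> wk d k \<noteq> fst d"
    using n unfolding fin_def by auto
qed

context
  fixes d assumes d: "d \<in> hub_darts"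
begin

lemma dart: "fst d \<in> W" "snd d \<in> nbrs (fst d)"
  using hub_dartD[OF d] by blast+

lemma wk_in_W: "wk d k \<in> W" and wk_step: "wk d (Suc k) \<in> nbrs (wk d k)"
  using walk_step[OF dart] unfolding wk_def by blast+

lemma fin_in_W: "fin d \<in> W"
  unfolding fin_def by (rule wk_in_W)

lemma hub_start: "3 \<le> deg (fst d)" and hub_fin: "3 \<le> deg (fin d)"
  using hub_dartD[OF d] len(1)[OF dart] by blast+

lemma deg_inner: "1 \<le> k \<Longrightarrow> k \<le> len d \<Longrightarrow> deg (wk d k) = 2"
  using len(2)[OF dart] by blast

lemma deg_innerD: "x \<in> inner d \<Longrightarrow> deg x = 2"
  unfolding inner_def using deg_inner by auto

lemma inner_subset: "inner d \<subseteq> W"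
  unfolding inner_def using wk_in_W by blast

lemma nbrs_inner: "1 \<le> k \<Longrightarrow> k \<le> len d \<Longrightarrow> nbrs (wk d k) = {wk d (k - 1), wk d (Suc k)}"
  using nbrs_walk[OF dart, of "k - 1"] deg_inner[of k] unfolding wk_def by simp

lemma wk_inj: "inj_on (wk d) {1..len d}"
proof (rule linorder_inj_onI)
  fix i j assume "i < j" "i \<in> {1..len d}" "j \<in> {1..len d}"
  then show "wk d i \<noteq> wk d j"
    using walk_distinct_from_earlier[OF dart, of "len d" j i] len(2)[OF dart] unfolding wk_def by auto
qed auto

lemma distinct_thread: "distinct (thread d)"
  unfolding thread_def using wk_inj by (simp add: distinct_map atLeastLessThanSuc_atLeastAtMost del: upt_Suc)

lemma start_fin_not_inner: "fst d \<notin> inner d" "fin d \<notin> inner d"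
  using deg_innerD hub_start hub_fin by fastforce+

lemma wk_rv: "i \<le> Suc (len d) \<Longrightarrow> wk (rv d) i = wk d (Suc (len d) - i)"
  using walk_reverse[OF dart, of "len d" i] deg_inner unfolding wk_def rv_def fin_def by simp

lemma rv_hub_dart: "rv d \<in> hub_darts"
  using fin_in_W hub_fin nbrs_sym[OF wk_in_W wk_step[of "len d"]] unfolding hub_darts_def rv_def fin_def by simp

lemma len_rv: "len (rv d) = len d"
proof -
  have "len (rv d) = len d"
    unfolding len_def[of "rv d"]
  proof (rule Least_equality)
    show "3 \<le> deg (wk (rv d) (Suc (len d)))" using wk_rv[of "Suc (len d)"] hub_start by simp
    fix y assume y: "3 \<le> deg (wk (rv d) (Suc y))"
    show "len d \<le> y"
    proof (rule ccontr)
      assume n: "\<not> len d \<le> y"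
      then have "wk (rv d) (Suc y) = wk d (len d - y)" using wk_rv[of "Suc y"] by simp
      then show False using y deg_inner[of "len d - y"] n by simp
    qed
  qed
  then show ?thesis .
qed

lemma fst_rv: "fst (rv d) = fin d"
  unfolding rv_def by simp

lemma fin_rv: "fin (rv d) = fst d"
  unfolding fin_def[of "rv d"] len_rv using wk_rv[of "Suc (len d)"] by simp

lemma rv_rv: "rv (rv d) = d"
proof -
  have "wk (rv d) (len d) = snd d" using wk_rv[of "len d"] wk_1 by simp
  then show ?thesis unfolding rv_def[of "rv d"] fin_rv len_rv by simp
qed

lemma inner_rv: "inner (rv d) = inner d"
proof -
  have "inner (rv d) \<subseteq> inner d"
  proof
    fix x assume "x \<in> inner (rv d)"
    then obtain i where "1 \<le> i" "i \<le> len d" "x = wk (rv d) i" unfolding inner_def len_rv by auto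
    then show "x \<in> inner d" unfolding inner_def using wk_rv[of i]
      by (intro image_eqI[of _ _ "Suc (len d) - i"]) auto
  qed
  moreover have "inner d \<subseteq> inner (rv d)"
  proof
    fix x assume "x \<in> inner d"
    then obtain i where "1 \<le> i" "i \<le> len d" "x = wk d i" unfolding inner_def by auto
    then show "x \<in> inner (rv d)" unfolding inner_def len_rv using wk_rv[of "Suc (len d) - i"]
      by (intro image_eqI[of _ _ "Suc (len d) - i"]) auto
  qed
  ultimately show ?thesis by blast
qed

lemma rv_neq: "rv d \<noteq> d"
proof
  assume eq: "rv d = d"
  then have f: "fin d = fst d" "wk d (len d) = snd d" unfolding rv_def by (metis fst_conv, metis snd_conv)
  show False
  proof (cases "len d")
    case 0
    then show False using f(2) dart nbrs_irrefl by (metis wk_0)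
  next
    case (Suc l)
    then have "len d = 1" using inj_onD[OF wk_inj, of "len d" 1] f(2) wk_1 by simp
    then show False using f(1) walk_no_return[OF dart, of 0] unfolding fin_def wk_def by simp
  qed
qed

lemma inner_nbr_cases:
  assumes "x \<in> inner d" "w \<in> nbrs x" "w \<notin> inner d"
  shows "(w = fst d \<and> x = wk d 1) \<or> (w = fin d \<and> x = wk d (len d))"
proof -
  obtain k where k: "1 \<le> k" "k \<le> len d" "x = wk d k" using assms(1) unfolding inner_def by auto
  have out: "j \<notin> {1..len d}" if "w = wk d j" for j using assms(3) that unfolding inner_def by blast
  have "w = wk d (k - 1) \<or> w = wk d (Suc k)" using nbrs_inner[OF k(1,2)] assms(2) k(3) by auto
  then show ?thesis
  proof
    assume a: "w = wk d (k - 1)"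
    then have "k = 1" using out[OF a] k by auto
    then show ?thesis using a k(3) by simp
  next
    assume a: "w = wk d (Suc k)"
    then have "k = len d" using out[OF a] k by auto
    then show ?thesis using a k(3) unfolding fin_def by simp
  qed
qed

lemma is_path_thread:
  assumes "X \<subseteq> W" "X \<inter> inner d = {}"
  shows "is_path X (thread d) (fst d) (fin d)"
proof -
  have "is_path X (map (walk (fst d) (snd d)) [1..<Suc (len d)]) (walk (fst d) (snd d) (1 - 1)) (walk (fst d) (snd d) (Suc (len d)))"
  proof (rule is_path_walk_segment[OF dart assms(1)])
    show "inj_on (walk (fst d) (snd d)) {1..<Suc (len d)}"
      using wk_inj unfolding wk_def by (simp only: atLeastLessThanSuc_atLeastAtMost)
    fix k assume k: "1 \<le> k" "k < Suc (len d)"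
    then have i: "wk d k \<in> inner d" unfolding inner_def by auto
    then have "wk d k \<noteq> fin d" "wk d k \<noteq> fst d" using start_fin_not_inner by metis+
    then show "deg (walk (fst d) (snd d) k) = 2 \<and> walk (fst d) (snd d) k \<notin> X \<and>
        walk (fst d) (snd d) k \<noteq> walk (fst d) (snd d) (1 - 1) \<and>
        walk (fst d) (snd d) k \<noteq> walk (fst d) (snd d) (Suc (len d))"
      using deg_innerD[OF i] i assms(2) unfolding wk_def fin_def by auto
  qed simp
  then show ?thesis unfolding thread_def fin_def wk_def by simp
qed

end

text \<open>Walking backwards from a common edge is forced, so the threads agree until a start is
  reached; a shorter one would put a hub inside the other thread.\<close>

lemma wk_pred_determines:
  assumes d: "d \<in> hub_darts" and e: "e \<in> hub_darts"
    and j: "1 \<le> j" "j \<le> len d" and k: "1 \<le> k" "k \<le> len e"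
    and eq: "wk d j = wk e k" "wk d (j - 1) = wk e (k - 1)" and le: "j \<le> k"
  shows "d = e"
proof -
  have backward: "walk (wk f n) (wk f (n - 1)) i = wk f (n - i)"
    if f: "f \<in> hub_darts" and n: "1 \<le> n" "n \<le> len f" "i \<le> n" for f n i
    using walk_reverse[OF dart[OF f], of "n - 1" i] deg_inner[OF f] n unfolding wk_def by simp
  have b: "wk d (j - i) = wk e (k - i)" if "i \<le> j" for i
    using backward[OF d j that] backward[OF e k, of i] that le eq by simp
  have "\<not> j < k"
  proof
    assume "j < k"
    then have "deg (wk e (k - j)) = 2" using deg_inner[OF e, of "k - j"] k by simp
    then show False using b[of j] hub_start[OF d] by simp
  qed
  then have "j = k" using le by simp
  then have "fst d = fst e" "snd d = snd e" using b[of j] b[of "j - 1"] j by (auto simp: wk_1)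
  then show ?thesis by (rule prod_eqI)
qed

text \<open>A common inner vertex has only two neighbours, so the threads pass it in the same or in
  opposite directions; reversing \<open>d\<close> turns the second case into the first.\<close>

lemma inner_disjoint:
  assumes d: "d \<in> hub_darts" and e: "e \<in> hub_darts" and x: "x \<in> inner d" "x \<in> inner e"
  shows "e = d \<or> e = rv d"
proof -
  have same: "a = b" if a: "a \<in> hub_darts" and b: "b \<in> hub_darts" and j: "1 \<le> j" "j \<le> len a"
    and k: "1 \<le> k" "k \<le> len b" and eq: "wk a j = wk b k" "wk a (j - 1) = wk b (k - 1)" for a b j k
  proof (cases "j \<le> k")
    case True
    then show ?thesis using wk_pred_determines[OF a b j k eq] by blast
  next
    case False
    then show ?thesis using wk_pred_determines[OF b a k j eq[symmetric]] by simp
  qed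
  obtain j where j: "1 \<le> j" "j \<le> len d" "x = wk d j" using x(1) unfolding inner_def by auto
  obtain k where k: "1 \<le> k" "k \<le> len e" "x = wk e k" using x(2) unfolding inner_def by auto
  have "wk e (k - 1) \<in> nbrs x" using nbrs_inner[OF e k(1,2)] k(3) by simp
  then consider "wk e (k - 1) = wk d (j - 1)" | "wk e (k - 1) = wk d (Suc j)"
    using nbrs_inner[OF d j(1,2)] j(3) by auto
  then show ?thesis
  proof cases
    case 1
    then show ?thesis using same[OF d e j(1,2) k(1,2)] j(3) k(3) by simp
  next
    case 2
    let ?j = "Suc (len d) - j"
    have j': "1 \<le> ?j" "?j \<le> len (rv d)" using j len_rv[OF d] by auto
    have "wk (rv d) ?j = wk e k" using wk_rv[OF d, of ?j] j k(3) by simp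
    moreover have "Suc (len d) - (?j - 1) = Suc j" using j by simp
    then have "wk (rv d) (?j - 1) = wk e (k - 1)" using wk_rv[OF d, of "?j - 1"] j 2 by simp
    ultimately show ?thesis using same[OF rv_hub_dart[OF d] e j' k(1,2)] by simp
  qed
qed

section \<open>Closed chains of threads\<close>

definition segment :: "'a \<times> 'a \<Rightarrow> 'a list" where
  "segment d = fst d # thread d"

lemma segment_map: "segment d = map (wk d) [0..<Suc (len d)]"
  unfolding segment_def thread_def by (simp add: upt_conv_Cons del: upt_Suc)

lemma set_segment: "set (segment d) = insert (fst d) (inner d)"
  unfolding segment_def by (simp add: set_thread)

lemma adj_wk: "d \<in> hub_darts \<Longrightarrow> adj (wk d k) (wk d (Suc k))"
  using wk_step unfolding nbrs_def by blast

lemma segment_walk: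
  assumes "d \<in> hub_darts"
  shows "successively adj (segment d)" "adj (last (segment d)) (fin d)" "distinct (segment d)"
proof -
  show "successively adj (segment d)"
    unfolding segment_map successively_conv_nth using adj_wk[OF assms] by (simp del: upt_Suc)
  have "last (segment d) = wk d (len d)" unfolding segment_map by (simp add: last_map)
  then show "adj (last (segment d)) (fin d)" unfolding fin_def using adj_wk[OF assms] by simp
  show "distinct (segment d)"
    unfolding segment_def using distinct_thread[OF assms] start_fin_not_inner[OF assms] by (simp add: set_thread)
qed

lemma concat_segments_walk:
  assumes "ds \<noteq> []" "set ds \<subseteq> hub_darts" "successively (\<lambda>d e. fin d = fst e) ds"
  shows "successively adj (concat (map segment ds)) \<and> adj (last (concat (map segment ds))) (fin (last ds))
    \<and> hd (concat (map segment ds)) = fst (hd ds) \<and> concat (map segment ds) \<noteq> []"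
  using assms
proof (induction ds rule: induct_list012)
  case 1
  then show ?case by simp
next
  case (2 d)
  then show ?case using segment_walk[of d] by (simp add: segment_def)
next
  case (3 d e ds)
  let ?c = "concat (map segment (e # ds))"
  have IH: "successively adj ?c" "adj (last ?c) (fin (last (e # ds)))" "hd ?c = fst e" "?c \<noteq> []"
    using 3 by auto
  have "concat (map segment (d # e # ds)) = segment d @ ?c" by simp
  moreover have "segment d \<noteq> []" "hd (segment d) = fst d" unfolding segment_def by simp_all
  moreover have "successively adj (segment d)" "adj (last (segment d)) (hd ?c)"
    using 3 segment_walk[of d] IH(3) by auto
  ultimately show ?case using IH by (simp only: successively_append_iff last_append hd_append) simp
qed

text \<open>Each \<open>segment\<close> omits the final hub of its thread, so that a closed chain
  lists that hub only once. Distinct starting hubs and the exclusion of reversed threads keep the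
  list free of repetitions, and it is a cycle to which the girth applies.\<close>

lemma cycle_of_threads:
  assumes ds: "ds \<noteq> []" "set ds \<subseteq> hub_darts" "successively (\<lambda>d e. fin d = fst e) ds" "fin (last ds) = fst (hd ds)"
    and dist: "distinct (map fst ds)" and rv: "\<And>d e. d \<in> set ds \<Longrightarrow> e \<in> set ds \<Longrightarrow> e \<noteq> rv d"
    and len: "3 \<le> (\<Sum>d\<leftarrow>ds. len d + 1)"
  shows "14 \<le> (\<Sum>d\<leftarrow>ds. len d + 1)"
proof -
  let ?xs = "concat (map segment ds)"
  have l: "length ?xs = (\<Sum>d\<leftarrow>ds. len d + 1)"
    by (simp add: length_concat segment_def length_thread comp_def)
  have "14 \<le> length ?xs"
  proof (rule girth)
    show "set ?xs \<subseteq> V"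
      using ds(2) inner_subset dart(1) W by (fastforce simp: set_segment)
    show "3 \<le> length ?xs" using len l by simp
    show "successively adj ?xs" "adj (last ?xs) (hd ?xs)" using concat_segments_walk[OF ds(1-3)] ds(4) by auto
    show "distinct ?xs"
    proof (rule distinct_concat)
      have "inj_on fst (set ds)" "distinct ds" using dist by (simp_all add: distinct_map)
      moreover have "inj_on segment (set ds)"
      proof (rule inj_onI)
        fix d e assume "d \<in> set ds" "e \<in> set ds" "segment d = segment e"
        then show "d = e" using \<open>inj_on fst (set ds)\<close> unfolding segment_def by (auto dest: inj_onD)
      qed
      ultimately show "distinct (map segment ds)" by (simp add: distinct_map)
    next
      fix ys assume "ys \<in> set (map segment ds)"
      then show "distinct ys" using segment_walk(3) ds(2) by auto
    next
      fix ys zs assume yz: "ys \<in> set (map segment ds)" "zs \<in> set (map segment ds)" "ys \<noteq> zs"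
      then obtain d e where de: "d \<in> set ds" "e \<in> set ds" "ys = segment d" "zs = segment e" "d \<noteq> e" by auto
      then have h: "d \<in> hub_darts" "e \<in> hub_darts" using ds(2) by auto
      have "fst d \<noteq> fst e" using de dist by (auto simp: distinct_map dest: inj_onD)
      moreover have "inner d \<inter> inner e = {}" using inner_disjoint[OF h] rv[OF de(1,2)] de(5) by blast
      moreover have "fst d \<notin> inner e" using deg_innerD[OF h(2), of "fst d"] hub_start[OF h(1)] by fastforce
      moreover have "fst e \<notin> inner d" using deg_innerD[OF h(1), of "fst e"] hub_start[OF h(2)] by fastforce
      ultimately show "set ys \<inter> set zs = {}" unfolding de(3,4) set_segment by blast
    qed
  qed
  then show ?thesis using l by simp
qed

lemma loop_length:
  assumes d: "d \<in> hub_darts" and loop: "fin d = fst d"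
  shows "13 \<le> len d"
proof -
  have "len d \<noteq> 0" using loop wk_step[OF d, of 0] nbrs_irrefl unfolding fin_def by (metis wk_0)
  moreover have "len d \<noteq> 1" using loop walk_no_return[OF dart[OF d], of 0] unfolding fin_def wk_def by auto
  ultimately have "3 \<le> (\<Sum>d\<leftarrow>[d]. len d + 1)" by simp
  then have "14 \<le> (\<Sum>d\<leftarrow>[d]. len d + 1)"
    using d loop rv_neq[OF d] by (intro cycle_of_threads) auto
  then show ?thesis by simp
qed

lemma nbrs_inter_inner:
  assumes d: "d \<in> hub_darts" and w: "w \<in> W" "w \<notin> inner d"
  shows "nbrs w \<inter> inner d \<subseteq> (if w = fst d then {wk d 1} else {}) \<union> (if w = fin d then {wk d (len d)} else {})"
proof
  fix x assume x: "x \<in> nbrs w \<inter> inner d"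
  then have "w \<in> nbrs x" using nbrs_sym w by blast
  then show "x \<in> (if w = fst d then {wk d 1} else {}) \<union> (if w = fin d then {wk d (len d)} else {})"
    using inner_nbr_cases[OF d _ _ w(2)] x by auto
qed

section \<open>Threads that can be removed\<close>

lemma card_nbrs_remove:
  assumes "nbrs w \<inter> S \<subseteq> T" "finite T" "card T + 2 \<le> deg w" "w \<in> W"
  shows "2 \<le> card (nbrs w \<inter> (W - S))"
proof -
  have "nbrs w \<inter> (W - S) = nbrs w - (nbrs w \<inter> S)" using nbrs_in_W by blast
  then have "card (nbrs w \<inter> (W - S)) = deg w - card (nbrs w \<inter> S)"
    unfolding deg_def using finite_nbrs by (simp add: card_Diff_subset)
  moreover have "card (nbrs w \<inter> S) \<le> card T" using assms by (intro card_mono)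
  ultimately show ?thesis using assms(3) by linarith
qed

lemma extend_path:
  assumes "X \<subseteq> W" "equitable X m c" "is_path X ps a b" "extendable_length m (length ps)"
  obtains c' where "equitable (X \<union> set ps) m c'"
proof -
  have "0 < m" "finite X" using m assms(1) finite_W finite_subset by auto
  then show thesis using equitable_extend_path[OF _ _ assms(2,3,4)] that by blast
qed

lemma finish_with_thread:
  assumes d: "d \<in> hub_darts" and l: "extendable_length m (len d)"
    and eq: "equitable (W - inner d) m c"
  shows False
proof -
  have "is_path (W - inner d) (thread d) (fst d) (fin d)" by (rule is_path_thread[OF d]) auto
  then obtain c' where "equitable (W - inner d \<union> set (thread d)) m c'"
    using extend_path[OF _ eq _ l[folded length_thread]] by blast
  moreover have "W - inner d \<union> set (thread d) = W" using inner_subset[OF d] unfolding set_thread by blast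
  ultimately show False using counterexample by metis
qed

lemma inner_nonempty: "1 \<le> len d \<Longrightarrow> inner d \<noteq> {}"
  unfolding inner_def by auto

text \<open>An end hub loses one neighbour with the thread, or two if the thread is a loop. Only a
  cubic hub with a loop is left with fewer than two.\<close>

lemma not_extendable_unless_cubic_loop:
  assumes d: "d \<in> hub_darts" and l: "extendable_length m (len d)"
  shows "fin d = fst d \<and> deg (fst d) = 3"
proof (rule ccontr)
  assume no: "\<not> ?thesis"
  have "1 \<le> len d" using l unfolding extendable_length_def by auto
  then have ne: "inner d \<noteq> {}" by (rule inner_nonempty)
  have "\<exists>c. equitable (W - inner d) m c"
  proof (rule reducible)
    show "W - inner d \<subset> W" using ne inner_subset[OF d] by blast
    fix w assume w: "w \<in> W - inner d"
    show "2 \<le> card (nbrs w \<inter> (W - inner d))"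
    proof (rule card_nbrs_remove[OF nbrs_inter_inner[OF d]])
      show "card ((if w = fst d then {wk d 1} else {}) \<union> (if w = fin d then {wk d (len d)} else {})) + 2 \<le> deg w"
        using no hub_start[OF d] hub_fin[OF d] deg_ge_2[of w] w
        by (auto simp: card_insert_if split: if_splits)
    qed (use w in auto)
  qed
  then show False using finish_with_thread[OF d l] by blast
qed

lemma card_3_split:
  assumes "card S = 3" "x \<in> S" "y \<in> S" "x \<noteq> y"
  obtains z where "S = {x, y, z}" "z \<noteq> x" "z \<noteq> y"
proof -
  have "finite S" using assms(1) card.infinite by fastforce
  then have "card (S - {x, y}) = 1" using assms by (simp add: card_Diff_subset)
  then obtain z where "S - {x, y} = {z}" by (rule card_1_singletonE)
  then show thesis using that[of z] assms by blast
qed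

text \<open>
  A cubic hub carrying a loop hangs on a third thread, and is removed together with that thread and
  the loop. The colouring is first extended along the third thread, the hub, and five further
  vertices of the loop.
\<close>

lemma no_cubic_loop:
  assumes d: "d \<in> hub_darts" and loop: "fin d = fst d" and cubic: "deg (fst d) = 3"
  shows False
proof -
  define u where "u = fst d"
  define n where "n = len d"
  have n: "13 \<le> n" unfolding n_def using loop_length[OF d loop] .
  have rd: "rv d = (u, wk d n)" unfolding rv_def loop u_def n_def ..
  have s1: "wk d 1 \<in> nbrs u" and sn: "wk d n \<in> nbrs u"
    using hub_dartD[OF d] hub_dartD[OF rv_hub_dart[OF d]] unfolding rd u_def by (auto simp: wk_1)
  have "wk d 1 \<noteq> wk d n" using inj_onD[OF wk_inj[OF d], of 1 n] n unfolding n_def by auto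
  then obtain z where z: "nbrs u = {wk d 1, wk d n, z}" "z \<noteq> wk d 1" "z \<noteq> wk d n"
    using card_3_split[of "nbrs u", OF _ s1 sn] cubic unfolding deg_def u_def by metis
  define e where "e = (u, z)"
  have du: "d = (u, wk d 1)" unfolding u_def by (simp add: wk_1)
  have e: "e \<in> hub_darts" using hub_dartD[OF d] z(1) unfolding hub_darts_def e_def u_def by auto
  have ed: "e \<noteq> d" "e \<noteq> rv d" using z(2,3) du rd unfolding e_def by auto
  define y where "y = fin e"
  \<comment> \<open>If the third thread came back to \<open>u\<close>, its reverse would leave
    \<open>u\<close> through one of the three neighbours and so be \<open>d\<close>,
    \<open>rv d\<close> or \<open>e\<close> itself.\<close>
  have yu: "y \<noteq> u"
  proof
    assume "y = u"
    then have "fst (rv e) = u" unfolding y_def using fst_rv[OF e] by simp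
    moreover have "snd (rv e) \<in> nbrs (fst (rv e))" using hub_dartD[OF rv_hub_dart[OF e]] by blast
    ultimately have "snd (rv e) = wk d 1 \<or> snd (rv e) = wk d n \<or> snd (rv e) = z" using z(1) by auto
    then have "rv e = d \<or> rv e = rv d \<or> rv e = e"
      using \<open>fst (rv e) = u\<close> du rd unfolding e_def by (metis prod.collapse)
    then show False using ed rv_neq[OF e] rv_rv[OF e] rv_rv[OF d] by metis
  qed
  have disj: "inner d \<inter> inner e = {}" using inner_disjoint[OF d e] ed by blast
  have ui: "u \<notin> inner d" "u \<notin> inner e" using start_fin_not_inner(1)[OF d] start_fin_not_inner(1)[OF e] unfolding u_def e_def by auto
  have uW: "u \<in> W" using dart(1)[OF d] unfolding u_def .
  let ?S = "insert u (inner d \<union> inner e)"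
  have nbu: "nbrs u \<subseteq> inner d \<union> inner e \<union> (if len e = 0 then {y} else {})"
  proof -
    have "wk d 1 \<in> inner d" "wk d n \<in> inner d" unfolding inner_def using n n_def by auto
    moreover have "z \<in> inner e" if "len e \<noteq> 0"
      unfolding inner_def using that wk_1[of e] unfolding e_def by (intro image_eqI[of _ _ 1]) auto
    moreover have "z = y" if "len e = 0" unfolding y_def fin_def that using wk_1[of e] unfolding e_def by simp
    ultimately show ?thesis unfolding z(1) by auto
  qed
  have sub: "?S \<subseteq> W" using inner_subset[OF d] inner_subset[OF e] uW by blast
  have "\<exists>c. equitable (W - ?S) m c"
  proof (rule reducible)
    show "W - ?S \<subset> W" using uW by blast
    fix w assume w: "w \<in> W - ?S"
    have "nbrs w \<inter> ?S \<subseteq> (if w = y then (if len e = 0 then {u} else {wk e (len e)}) else {})"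
    proof
      fix x assume x: "x \<in> nbrs w \<inter> ?S"
      then have wx: "w \<in> nbrs x" using nbrs_sym w by blast
      consider "x = u" | "x \<in> inner d" | "x \<in> inner e" using x by blast
      then show "x \<in> (if w = y then (if len e = 0 then {u} else {wk e (len e)}) else {})"
      proof cases
        case 1
        then show ?thesis using nbu wx w by (auto split: if_splits)
      next
        case 2
        then show ?thesis using inner_nbr_cases[OF d 2 wx] w loop unfolding u_def by auto
      next
        case 3
        then have "(w = fst e \<and> x = wk e 1) \<or> (w = fin e \<and> x = wk e (len e))" using inner_nbr_cases[OF e 3 wx] w by blast
        moreover have "fst e = u" unfolding e_def by simp
        moreover have "len e \<noteq> 0" using 3 unfolding inner_def by auto
        ultimately show ?thesis using w unfolding y_def by auto
      qed
    qed
    then show "2 \<le> card (nbrs w \<inter> (W - ?S))"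
      by (rule card_nbrs_remove) (use w hub_fin[OF e] deg_ge_2[of w] in \<open>auto simp: y_def\<close>)
  qed
  then obtain c where c: "equitable (W - ?S) m c" by blast
  let ?X = "W - ?S"
  let ?r = "thread (rv e)"
  \<comment> \<open>The hub and five vertices of the loop bring the first path to six vertices even
    if the third thread has none. At least eight loop vertices remain for the second path.\<close>
  let ?l = "map (wk d) [1..<6]"
  have r: "is_path ?X ?r y u"
    using is_path_thread[OF rv_hub_dart[OF e], of ?X] fst_rv[OF e] fin_rv[OF e] inner_rv[OF e] unfolding y_def e_def by auto
  have setr: "set ?r = inner e" using set_thread inner_rv[OF e] by metis
  \<comment> \<open>Read from its far end, the third thread is continued by the hub, whose two
    neighbours on the loop are still uncoloured.\<close>
  have ru: "is_path ?X (?r @ [u]) y (wk d 1)"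
  proof (cases "len e = 0")
    case True
    then have "?r = []" using length_thread[of "rv e"] len_rv[OF e] by simp
    moreover have "is_path ?X [u] y (wk d 1)"
      unfolding is_path_def using nbu adj_irrefl unfolding nbrs_def by (auto split: if_splits)
    ultimately show ?thesis by simp
  next
    case False
    then have ne: "?r \<noteq> []" using length_thread[of "rv e"] len_rv[OF e] by auto
    have last: "last ?r = z"
    proof -
      have "last ?r = wk (rv e) (len e)" unfolding thread_def len_rv[OF e] using False by (simp add: last_map)
      also have "\<dots> = wk e 1" using wk_rv[OF e, of "len e"] by simp
      finally show ?thesis using wk_1[of e] unfolding e_def by simp
    qed
    show ?thesis
    proof (rule is_path_append[OF r])
      show "u \<notin> ?X" by blast
      show "is_path (?X \<union> set ?r) [u] (last ?r) (wk d 1)"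
      proof -
        have "x = z" if x: "x \<in> ?X \<union> set ?r" "adj u x" for x
        proof -
          have "x \<in> nbrs u" using x sub inner_subset[OF e] setr unfolding nbrs_def by auto
          moreover have "wk d 1 \<in> inner d" "wk d n \<in> inner d" unfolding inner_def using n n_def by auto
          ultimately show ?thesis using x(1) z(1) disj setr by auto
        qed
        then show ?thesis unfolding is_path_def last using ui(2) setr adj_irrefl by auto
      qed
      show "wk d 1 \<notin> set ?r" using disj setr n unfolding inner_def n_def by fastforce
    qed (use ne in auto)
  qed
  have inner_range: "wk d k \<in> inner d" if "1 \<le> k" "k \<le> n" for k unfolding inner_def using that n_def by auto
  have wk_neq: "wk d i \<noteq> wk d j" if "1 \<le> i" "i \<le> n" "1 \<le> j" "j \<le> n" "i \<noteq> j" for i j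
    using inj_onD[OF wk_inj[OF d], of i j] that n_def by auto
  have walk_wk: "walk (fst d) (snd d) = wk d" unfolding wk_def ..
  have Y: "?X \<union> set (?r @ [u]) = W - inner d" using setr sub disj ui by auto
  have l: "is_path (?X \<union> set (?r @ [u])) ?l u (wk d 6)"
  proof -
    have "is_path (W - inner d) (map (walk (fst d) (snd d)) [1..<6]) (walk (fst d) (snd d) (1 - 1)) (walk (fst d) (snd d) 6)"
    proof (rule is_path_walk_segment[OF dart[OF d]])
      show "inj_on (walk (fst d) (snd d)) {1..<6}" unfolding walk_wk
        by (rule inj_on_subset[OF wk_inj[OF d]]) (use n n_def in auto)
      fix k :: nat assume k: "1 \<le> k" "k < 6"
      then have "wk d k \<noteq> fst d" "wk d k \<in> inner d" "wk d k \<noteq> wk d 6" "deg (wk d k) = 2"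
        using n inner_range[of k] ui(1) wk_neq[of k 6] deg_inner[OF d, of k] unfolding u_def n_def by auto
      then show "deg (walk (fst d) (snd d) k) = 2 \<and> walk (fst d) (snd d) k \<notin> W - inner d \<and>
          walk (fst d) (snd d) k \<noteq> walk (fst d) (snd d) (1 - 1) \<and> walk (fst d) (snd d) k \<noteq> walk (fst d) (snd d) 6"
        unfolding walk_wk by simp
    qed auto
    then have "is_path (W - inner d) ?l u (wk d 6)" unfolding walk_wk u_def by simp
    then show ?thesis by (simp only: Y)
  qed
  have p1: "is_path ?X ((?r @ [u]) @ ?l) y (wk d 6)"
  proof (rule is_path_append[OF ru])
    show "wk d 1 \<notin> ?X" using inner_range[of 1] n by auto
    show "is_path (?X \<union> set (?r @ [u])) ?l (last (?r @ [u])) (wk d 6)" using l by simp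
    show "wk d 6 \<notin> set (?r @ [u])" using inner_range[of 6] n disj ui(1) setr by auto
  qed auto
  have "extendable_length m (length ((?r @ [u]) @ ?l))" by (rule extendable_six(2)) simp
  then obtain c1 where c1: "equitable (?X \<union> set ((?r @ [u]) @ ?l)) m c1"
    by (rule extend_path[OF Diff_subset c p1])
  let ?X1 = "?X \<union> set ((?r @ [u]) @ ?l)"
  let ?q = "map (wk d) [6..<Suc n]"
  have X1: "?X1 = (W - inner d) \<union> wk d ` {1..<6}" using Y by auto
  have setq: "set ?q = wk d ` {6..n}" by auto
  have X1W: "?X1 \<subseteq> W" unfolding X1 using wk_in_W[OF d] by auto
  have "is_path ?X1 (map (walk (fst d) (snd d)) [6..<Suc n]) (walk (fst d) (snd d) (6 - 1)) (walk (fst d) (snd d) (Suc n))"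
  proof (rule is_path_walk_segment[OF dart[OF d]])
    show "?X1 \<subseteq> W" by (rule X1W)
    show "inj_on (walk (fst d) (snd d)) {6..<Suc n}" unfolding walk_wk
      by (rule inj_on_subset[OF wk_inj[OF d]]) (auto simp: n_def)
    fix k :: nat assume k: "6 \<le> k" "k < Suc n"
    then have "wk d k \<noteq> wk d (Suc n)" "wk d k \<in> inner d" "wk d k \<noteq> wk d 5" "deg (wk d k) = 2"
      using n inner_range[of k] ui(1) wk_neq[of k 5] deg_inner[OF d, of k] loop unfolding u_def n_def fin_def by auto
    moreover have "wk d k \<notin> wk d ` {1..<6}" using wk_neq[of k] k by fastforce
    ultimately show "deg (walk (fst d) (snd d) k) = 2 \<and> walk (fst d) (snd d) k \<notin> ?X1 \<and>
        walk (fst d) (snd d) k \<noteq> walk (fst d) (snd d) (6 - 1) \<and> walk (fst d) (snd d) k \<noteq> walk (fst d) (snd d) (Suc n)"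
      unfolding walk_wk X1 by simp
  qed simp
  then have p2: "is_path ?X1 ?q (wk d (6 - 1)) (wk d (Suc n))" unfolding walk_wk .
  have "extendable_length m (length ?q)" by (rule extendable_six(2)) (use n in simp)
  then obtain c2 where c2: "equitable (?X1 \<union> set ?q) m c2"
    by (rule extend_path[OF X1W c1 p2])
  have "{1..<6} \<union> {6..n} = {1..n}" using n by auto
  then have "wk d ` {1..<6} \<union> wk d ` {6..n} = inner d" unfolding inner_def n_def by (metis image_Un)
  then have "?X1 \<union> set ?q = W" unfolding X1 setq using inner_subset[OF d] by blast
  then show False using c2 counterexample by metis
qed

lemma not_extendable: "d \<in> hub_darts \<Longrightarrow> \<not> extendable_length m (len d)"
  using not_extendable_unless_cubic_loop no_cubic_loop by blast

lemma no_loop: "d \<in> hub_darts \<Longrightarrow> fin d \<noteq> fst d"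
  using loop_length not_extendable extendable_six(2)[of "len d"] by fastforce

lemma len_cases: "d \<in> hub_darts \<Longrightarrow> len d = 0 \<or> len d = 1 \<or> len d = 2 \<or> (m = 3 \<and> len d = 4)"
  using not_extendable[of d] m unfolding extendable_length_def by auto

lemma len_le_4: "d \<in> hub_darts \<Longrightarrow> len d \<le> 4"
  using len_cases by fastforce

text \<open>Two threads between the same hubs would close a cycle of at most ten vertices; if
  neither has inner vertices, they are the same edge.\<close>

lemma fin_inj:
  assumes d: "d \<in> hub_darts" and e: "e \<in> hub_darts" and eq: "fst d = fst e" "fin d = fin e"
  shows "d = e"
proof (rule ccontr)
  assume ne: "d \<noteq> e"
  let ?ds = "[d, rv e]"
  have r: "rv e \<in> hub_darts" "fst (rv e) = fin e" "fin (rv e) = fst e" "rv (rv e) = e" "len (rv e) = len e"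
    using rv_hub_dart[OF e] fst_rv[OF e] fin_rv[OF e] rv_rv[OF e] len_rv[OF e] by auto
  have rd: "rv e \<noteq> rv d" using ne rv_rv[OF d] r(4) by metis
  have "3 \<le> (\<Sum>d\<leftarrow>?ds. len d + 1)"
  proof (rule ccontr)
    assume "\<not> ?thesis"
    then have "len d = 0" "len e = 0" using r(5) by auto
    then have "fin d = snd d" "fin e = snd e" unfolding fin_def by (simp_all add: wk_1)
    then show False using ne eq prod_eqI by metis
  qed
  then have "14 \<le> (\<Sum>d\<leftarrow>?ds. len d + 1)"
  proof (intro cycle_of_threads)
    fix a b assume "a \<in> set ?ds" "b \<in> set ?ds"
    then show "b \<noteq> rv a" using rv_neq[OF d] rv_neq[OF r(1)] rd r(4) ne by auto
  qed (use d r eq no_loop[OF d] in auto)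
  then show False using len_le_4[OF d] len_le_4[OF e] r(5) by simp
qed

end

section \<open>Removing hubs with three colours\<close>

text \<open>
  \<open>lo t k j i\<close> and \<open>hi t k j i\<close> bound the number of vertices of colour \<open>i\<close> on a thread with \<open>t\<close> inner
  vertices, when its ends have the colours \<open>k\<close> and \<open>j\<close> and there are three colours. For
  \<open>t \<in> {0, 1, 2, 4}\<close>, every triple of numbers with sum \<open>t\<close> within these bounds is attained.
\<close>

definition lo :: "nat \<Rightarrow> nat \<Rightarrow> nat \<Rightarrow> nat \<Rightarrow> nat" where
  "lo t k j i = (if t = 0 then 0 else if t = 1 then (if j = k \<or> i = k \<or> i = j then 0 else 1)
    else if j = k \<and> i \<noteq> k then 1 else 0)"

definition hi :: "nat \<Rightarrow> nat \<Rightarrow> nat \<Rightarrow> nat \<Rightarrow> nat" where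
  "hi t k j i = (if t = 0 then 0 else if t = 1 then (if i = k then 0 else if j = k then 1 else if i = j then 0 else 1)
    else if i = k \<and> j = k then t div 2 - 1 else t div 2)"

text \<open>Each single bound can be attained by numbers with sum \<open>t\<close>: the upper bound
  of one is compatible with the lower bounds of the other two, and conversely. This makes the sets
  of admissible triples additive over threads.\<close>

definition tight :: "nat \<Rightarrow> (nat \<Rightarrow> nat) \<Rightarrow> (nat \<Rightarrow> nat) \<Rightarrow> bool" where
  "tight t l h \<longleftrightarrow> l 0 \<le> h 0 \<and> l 1 \<le> h 1 \<and> l 2 \<le> h 2 \<and>
    l 0 + l 1 + h 2 \<le> t \<and> l 0 + h 1 + l 2 \<le> t \<and> h 0 + l 1 + l 2 \<le> t \<and>
    t \<le> l 0 + h 1 + h 2 \<and> t \<le> h 0 + l 1 + h 2 \<and> t \<le> h 0 + h 1 + l 2"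

lemma less_3_cases: "(k::nat) < 3 \<Longrightarrow> k = 0 \<or> k = 1 \<or> k = 2"
  by auto

lemma tight_lo_hi:
  assumes "t \<in> {0, 1, 2, 4}" "k < 3" "j < 3"
  shows "tight t (lo t k j) (hi t k j)"
  using assms(1) less_3_cases[OF assms(2)] less_3_cases[OF assms(3)]
  unfolding tight_def lo_def hi_def by (elim insertE disjE) simp_all

lemma choose_in_intervals:
  fixes t :: nat
  assumes "a0 \<le> b0" "a1 \<le> b1" "a2 \<le> b2" "a0 + a1 + a2 \<le> t" "t \<le> b0 + b1 + b2"
  shows "\<exists>y0 y1 y2. y0 + y1 + y2 = t \<and> a0 \<le> y0 \<and> y0 \<le> b0 \<and> a1 \<le> y1 \<and> y1 \<le> b1 \<and> a2 \<le> y2 \<and> y2 \<le> b2"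
proof -
  define y0 where "y0 = min b0 (t - a1 - a2)"
  define y1 where "y1 = min b1 (t - y0 - a2)"
  have "y0 \<le> b0" "a0 \<le> y0" "y0 + a1 + a2 \<le> t" "t \<le> y0 + b1 + b2" using assms unfolding y0_def by auto
  moreover from this have "y1 \<le> b1" "a1 \<le> y1" "y0 + y1 + a2 \<le> t" "t \<le> y0 + y1 + b2" using assms unfolding y1_def by auto
  ultimately show ?thesis by (intro exI[of _ y0] exI[of _ y1] exI[of _ "t - y0 - y1"]) auto
qed

text \<open>The share \<open>y i\<close> is confined to the interval from \<open>a i\<close> to
  \<open>b i\<close>. For every choice of which of the two bounds is active at each colour,
  tightness of one of the two sides compares the sum of the end points with
  \<open>t\<close>.\<close>

lemma tight_split:
  assumes 1: "tight t l h" and 2: "tight t' l' h'"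
    and x: "\<And>i. i < 3 \<Longrightarrow> l i + l' i \<le> x i \<and> x i \<le> h i + h' i" and s: "x 0 + x 1 + x 2 = t + t'"
  shows "\<exists>y. y 0 + y 1 + y 2 = t \<and> (\<forall>i<3. l i \<le> y i \<and> y i \<le> h i \<and> y i \<le> x i \<and> l' i \<le> x i - y i \<and> x i - y i \<le> h' i)"
proof -
  define a where "a i = max (l i) (x i - h' i)" for i
  define b where "b i = min (h i) (x i - l' i)" for i
  have X: "l 0 + l' 0 \<le> x 0 \<and> x 0 \<le> h 0 + h' 0" "l 1 + l' 1 \<le> x 1 \<and> x 1 \<le> h 1 + h' 1"
    "l 2 + l' 2 \<le> x 2 \<and> x 2 \<le> h 2 + h' 2" by (rule x, simp)+
  have "a 0 \<le> b 0" "a 1 \<le> b 1" "a 2 \<le> b 2"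
    using X 1 2 unfolding a_def b_def tight_def by linarith+
  moreover have "a 0 + a 1 + a 2 \<le> t"
  proof -
    have a: "a i = l i \<or> a i + h' i = x i" for i unfolding a_def by linarith
    show ?thesis using a[of 0] a[of 1] a[of 2] X 1 2 s unfolding tight_def by linarith
  qed
  moreover have "t \<le> b 0 + b 1 + b 2"
  proof -
    have b: "b i = h i \<or> b i + l' i = x i" if "i < 3" for i using x[OF that] unfolding b_def by linarith
    have "b 0 = h 0 \<or> b 0 + l' 0 = x 0" "b 1 = h 1 \<or> b 1 + l' 1 = x 1" "b 2 = h 2 \<or> b 2 + l' 2 = x 2"
      by (rule b, simp)+
    then show ?thesis using X 1 2 s unfolding tight_def by linarith
  qed
  ultimately obtain y0 y1 y2 where y: "y0 + y1 + y2 = t" "a 0 \<le> y0" "y0 \<le> b 0" "a 1 \<le> y1" "y1 \<le> b 1" "a 2 \<le> y2" "y2 \<le> b 2"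
    using choose_in_intervals by blast
  define f where "f i = (if i = 0 then y0 else if i = 1 then y1 else y2)" for i :: nat
  have "a i \<le> f i \<and> f i \<le> b i" if "i < 3" for i using y less_3_cases[OF that] unfolding f_def by auto
  moreover have "l i \<le> f i \<and> f i \<le> h i \<and> f i \<le> x i \<and> l' i \<le> x i - f i \<and> x i - f i \<le> h' i"
    if "i < 3" "a i \<le> f i \<and> f i \<le> b i" for i using that x[OF that(1)] unfolding a_def b_def by auto
  ultimately show ?thesis using y(1) by (intro exI[of _ f]) (auto simp: f_def)
qed

lemma tight_sum:
  assumes "finite D" "\<And>d. d \<in> D \<Longrightarrow> tight (t d) (l d) (h d)"
  shows "tight (sum t D) (\<lambda>i. \<Sum>d\<in>D. l d i) (\<lambda>i. \<Sum>d\<in>D. h d i)"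
  using assms
proof (induction D rule: finite_induct)
  case empty
  then show ?case unfolding tight_def by simp
next
  case (insert d D)
  then have "tight (t d) (l d) (h d)" "tight (sum t D) (\<lambda>i. \<Sum>d\<in>D. l d i) (\<lambda>i. \<Sum>d\<in>D. h d i)" by auto
  then show ?case using insert.hyps unfolding tight_def by simp
qed

definition thread_filled :: "nat \<Rightarrow> nat \<Rightarrow> nat \<Rightarrow> nat \<Rightarrow> nat \<Rightarrow> nat list \<Rightarrow> bool" where
  "thread_filled k j y0 y1 y2 cs \<longleftrightarrow> distinct_adj cs \<and> (cs \<noteq> [] \<longrightarrow> hd cs \<noteq> k \<and> last cs \<noteq> j) \<and>
    count_list cs 0 = y0 \<and> count_list cs 1 = y1 \<and> count_list cs 2 = y2"

text \<open>No bound \<open>hi\<close> exceeds two for these lengths, so the claim is a finite table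
  and is settled by evaluation.\<close>

lemma thread_fill_check:
  "list_all (\<lambda>t. list_all (\<lambda>k. list_all (\<lambda>j. list_all (\<lambda>y0. list_all (\<lambda>y1. list_all (\<lambda>y2.
    y0 + y1 + y2 = t \<longrightarrow> lo t k j 0 \<le> y0 \<longrightarrow> y0 \<le> hi t k j 0 \<longrightarrow> lo t k j 1 \<le> y1 \<longrightarrow> y1 \<le> hi t k j 1 \<longrightarrow>
    lo t k j 2 \<le> y2 \<longrightarrow> y2 \<le> hi t k j 2 \<longrightarrow> list_ex (thread_filled k j y0 y1 y2) (List.n_lists t [0, 1, 2]))
    [0, 1, 2]) [0, 1, 2]) [0, 1, 2]) [0, 1, 2]) [0, 1, 2]) [0, 1, 2, 4]"
  by code_simp

lemma thread_fill:
  assumes t: "t \<in> {0, 1, 2, 4}" and kj: "k < 3" "j < 3"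
    and y: "y 0 + y 1 + y 2 = t" "\<And>i. i < 3 \<Longrightarrow> lo t k j i \<le> y i \<and> y i \<le> hi t k j i"
  shows "\<exists>cs. length cs = t \<and> set cs \<subseteq> {..<3} \<and> distinct_adj cs \<and> (cs \<noteq> [] \<longrightarrow> hd cs \<noteq> k \<and> last cs \<noteq> j) \<and>
    (\<forall>i<3. count (mset cs) i = y i)"
proof -
  have Y: "lo t k j 0 \<le> y 0" "y 0 \<le> hi t k j 0" "lo t k j 1 \<le> y 1" "y 1 \<le> hi t k j 1"
    "lo t k j 2 \<le> y 2" "y 2 \<le> hi t k j 2" using y(2)[of 0] y(2)[of 1] y(2)[of 2] by simp_all
  have le: "y i \<le> 2" if "i < 3" for i
  proof -
    have "hi t k j i \<le> 2" using t unfolding hi_def by auto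
    then show ?thesis using y(2)[OF that] by simp
  qed
  have mem: "t \<in> set [0, 1, 2, 4]" "k \<in> set [0, 1, 2]" "j \<in> set [0, 1, 2]"
    "y 0 \<in> set [0, 1, 2]" "y 1 \<in> set [0, 1, 2]" "y 2 \<in> set [0, 1, 2]"
    using t less_3_cases[OF kj(1)] less_3_cases[OF kj(2)] le[of 0] le[of 1] le[of 2] by auto
  have "list_ex (thread_filled k j (y 0) (y 1) (y 2)) (List.n_lists t [0, 1, 2])"
    using thread_fill_check mem Y y(1) unfolding list_all_iff by blast
  then obtain cs where cs: "cs \<in> set (List.n_lists t [0, 1, 2])" "thread_filled k j (y 0) (y 1) (y 2) cs"
    unfolding list_ex_iff by blast
  have "length cs = t" "set cs \<subseteq> {..<3}" using cs(1) by (auto simp: set_n_lists)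
  moreover have "count (mset cs) i = y i" if "i < 3" for i
    using less_3_cases[OF that] cs(2) unfolding thread_filled_def by (auto simp: count_mset)
  ultimately show ?thesis using cs(2) unfolding thread_filled_def by blast
qed

context min_counterexample
begin

lemma finite_hub_darts: "finite hub_darts"
proof (rule finite_subset)
  show "hub_darts \<subseteq> W \<times> W" unfolding hub_darts_def using nbrs_in_W by auto
qed (use finite_W in simp)

lemma finite_inner: "finite (inner d)"
  unfolding inner_def by simp

lemma card_inner: "d \<in> hub_darts \<Longrightarrow> card (inner d) = len d"
  unfolding inner_def using card_image[OF wk_inj] by simp

text \<open>Threads are filled one at a time: \<open>tight_sum\<close> makes the summed bounds of
  the remaining threads tight, so \<open>tight_split\<close> can divide the demanded class sizes
  between the next thread and the others.\<close>

lemma fill_threads: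
  assumes X: "X \<subseteq> W" and c: "proper X 3 c" and k: "k < 3"
    and fin_D: "finite D"
    and D: "\<And>d. d \<in> D \<Longrightarrow> d \<in> hub_darts \<and> fst d \<in> X \<and> fin d \<in> X \<and> c (fst d) = k \<and> inner d \<inter> X = {} \<and> len d \<in> {0, 1, 2, 4}"
    and rv: "\<And>d e. d \<in> D \<Longrightarrow> e \<in> D \<Longrightarrow> e \<noteq> rv d"
  shows "x 0 + x 1 + x 2 = (\<Sum>d\<in>D. len d) \<Longrightarrow>
    (\<And>i. i < 3 \<Longrightarrow> (\<Sum>d\<in>D. lo (len d) k (c (fin d)) i) \<le> x i \<and> x i \<le> (\<Sum>d\<in>D. hi (len d) k (c (fin d)) i)) \<Longrightarrow>
    \<exists>c'. proper (X \<union> (\<Union>d\<in>D. inner d)) 3 c' \<and> (\<forall>v\<in>X. c' v = c v) \<and> (\<forall>i<3. card {v \<in> (\<Union>d\<in>D. inner d). c' v = i} = x i)"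
  using fin_D D rv
proof (induction D arbitrary: x rule: finite_induct)
  case empty
  have "x i = 0" if "i < 3" for i using empty(1) less_3_cases[OF that] by auto
  then show ?case using c by (intro exI[of _ c]) auto
next
  case (insert d D)
  note Dd = insert.prems(3)
  have cX: "c v < 3" if "v \<in> X" for v using c that unfolding proper_def by blast
  let ?L = "\<lambda>d. lo (len d) k (c (fin d))" and ?H = "\<lambda>d. hi (len d) k (c (fin d))"
  have ti: "tight (len e) (?L e) (?H e)" if "e \<in> insert d D" for e
    using Dd[OF that] cX k by (intro tight_lo_hi) auto
  have "tight (sum len D) (\<lambda>i. \<Sum>d\<in>D. ?L d i) (\<lambda>i. \<Sum>d\<in>D. ?H d i)"
    by (rule tight_sum[OF insert.hyps(1)]) (use ti in blast)
  moreover have "x 0 + x 1 + x 2 = len d + sum len D" using insert.prems(1) insert.hyps by simp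
  moreover have "?L d i + (\<Sum>d\<in>D. ?L d i) \<le> x i \<and> x i \<le> ?H d i + (\<Sum>d\<in>D. ?H d i)" if "i < 3" for i
    using insert.prems(2)[OF that] insert.hyps by simp
  ultimately obtain y where y: "y 0 + y 1 + y 2 = len d"
    "\<And>i. i < 3 \<Longrightarrow> ?L d i \<le> y i \<and> y i \<le> ?H d i \<and> y i \<le> x i \<and> (\<Sum>d\<in>D. ?L d i) \<le> x i - y i \<and> x i - y i \<le> (\<Sum>d\<in>D. ?H d i)"
    using tight_split[OF ti[of d], of "sum len D" "\<lambda>i. \<Sum>d\<in>D. ?L d i" "\<lambda>i. \<Sum>d\<in>D. ?H d i" x] by blast
  let ?x = "\<lambda>i. x i - y i"
  have "?x 0 + ?x 1 + ?x 2 = sum len D"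
    using y(1) y(2)[of 0] y(2)[of 1] y(2)[of 2] insert.prems(1) insert.hyps by simp
  then obtain c1 where c1: "proper (X \<union> (\<Union>d\<in>D. inner d)) 3 c1" "\<forall>v\<in>X. c1 v = c v"
    "\<forall>i<3. card {v \<in> (\<Union>d\<in>D. inner d). c1 v = i} = ?x i"
    using insert.IH[of ?x] y(2) insert.prems(3,4) by blast
  let ?Y = "X \<union> (\<Union>d\<in>D. inner d)"
  have d: "d \<in> hub_darts" "fst d \<in> X" "fin d \<in> X" "c (fst d) = k" "inner d \<inter> X = {}" "len d \<in> {0, 1, 2, 4}"
    using Dd[of d] by auto
  have disj: "inner d \<inter> inner e = {}" if "e \<in> D" for e
    using inner_disjoint[OF d(1), of e] Dd[of e] insert.prems(4)[of d e] insert.hyps(2) that by blast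
  have YW: "?Y \<subseteq> W" using X inner_subset Dd by blast
  have p: "is_path ?Y (thread d) (fst d) (fin d)"
    by (rule is_path_thread[OF d(1) YW]) (use d(5) disj in blast)
  obtain cs where cs: "length cs = len d" "set cs \<subseteq> {..<3}" "distinct_adj cs"
    "cs \<noteq> [] \<longrightarrow> hd cs \<noteq> k \<and> last cs \<noteq> c (fin d)" "\<forall>i<3. count (mset cs) i = y i"
    using thread_fill[OF d(6) k cX[OF d(3)] y(1)] y(2) by blast
  obtain c2 where c2: "proper (?Y \<union> set (thread d)) 3 c2" "\<forall>v. v \<notin> set (thread d) \<longrightarrow> c2 v = c1 v" "map c2 (thread d) = cs"
    using extend_colouring_path[OF c1(1) p, of cs] cs c1(2) d(2-4) length_thread[of d] by auto
  have agree: "c2 v = c1 v" if "v \<in> ?Y" for v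
    using c2(2) that d(5) disj unfolding set_thread by blast
  have "card {v \<in> (\<Union>e\<in>insert d D. inner e). c2 v = i} = x i" if i: "i < 3" for i
  proof -
    have "{v \<in> (\<Union>e\<in>insert d D. inner e). c2 v = i} = {v \<in> set (thread d). c2 v = i} \<union> {v \<in> (\<Union>d\<in>D. inner d). c2 v = i}"
      unfolding set_thread by blast
    moreover have "{v \<in> (\<Union>d\<in>D. inner d). c2 v = i} = {v \<in> (\<Union>d\<in>D. inner d). c1 v = i}"
      using agree by (intro Collect_cong conj_cong refl) simp
    ultimately have "{v \<in> (\<Union>e\<in>insert d D. inner e). c2 v = i} = {v \<in> set (thread d). c2 v = i} \<union> {v \<in> (\<Union>d\<in>D. inner d). c1 v = i}"
      by simp
    moreover have "card {v \<in> set (thread d). c2 v = i} = y i"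
      using card_colour_class_list[OF distinct_thread[OF d(1)], of c2 i] c2(3) cs(5) i by simp
    moreover have "card {v \<in> (\<Union>d\<in>D. inner d). c1 v = i} = x i - y i" using c1(3) i by blast
    moreover have "{v \<in> set (thread d). c2 v = i} \<inter> {v \<in> (\<Union>d\<in>D. inner d). c1 v = i} = {}"
      using disj unfolding set_thread by blast
    ultimately show ?thesis using y(2)[OF i] finite_inner insert.hyps(1)
      by (simp add: card_Un_disjoint)
  qed
  moreover have "proper (X \<union> (\<Union>e\<in>insert d D. inner e)) 3 c2"
    using c2(1) unfolding set_thread by (simp add: Un_ac)
  moreover have "\<forall>v\<in>X. c2 v = c v" using agree c1(2) by simp
  ultimately show ?case by blast
qed

text \<open>\<open>hits\<close> counts all threads from \<open>H\<close> into an outside hub, also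
  those without inner vertices. Remaining vertices of degree two lose no neighbour. As
  \<open>D\<close> may list a thread in one direction only, \<open>cover\<close> asks for
  either.\<close>

lemma rest_colourable:
  assumes H: "H \<subseteq> W" "H \<noteq> {}"
    and D: "\<And>d. d \<in> D \<Longrightarrow> d \<in> hub_darts \<and> fst d \<in> H"
    and cover: "\<And>d. d \<in> hub_darts \<Longrightarrow> fst d \<in> H \<Longrightarrow> d \<in> D \<or> rv d \<in> D"
    and hubs: "\<And>u. u \<in> H \<Longrightarrow> 3 \<le> deg u"
    and hits: "\<And>w. w \<in> W - H \<Longrightarrow> 3 \<le> deg w \<Longrightarrow> card {d \<in> hub_darts. fst d \<in> H \<and> fin d = w} + 2 \<le> deg w"
  shows "\<exists>c. equitable (W - (H \<union> (\<Union>d\<in>D. inner d))) m c"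
proof (rule reducible)
  let ?S = "H \<union> (\<Union>d\<in>D. inner d)"
  show "W - ?S \<subset> W" using H by blast
  fix w assume w: "w \<in> W - ?S"
  let ?T = "{d \<in> hub_darts. fst d \<in> H \<and> fin d = w}"
  have inS: "inner d \<subseteq> ?S" if "d \<in> hub_darts" "fst d \<in> H" for d
    using cover[OF that] inner_rv[OF that(1)] by blast
  have "nbrs w \<inter> ?S \<subseteq> (\<lambda>d. wk d (len d)) ` ?T"
  proof
    fix x assume x: "x \<in> nbrs w \<inter> ?S"
    then have wx: "w \<in> nbrs x" using nbrs_sym w by blast
    show "x \<in> (\<lambda>d. wk d (len d)) ` ?T"
    proof (cases "x \<in> H")
      case True
      let ?d = "(x, w)"
      have d: "?d \<in> hub_darts" using True H hubs wx unfolding hub_darts_def by auto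
      have "len ?d = 0"
      proof (rule ccontr)
        assume "len ?d \<noteq> 0"
        then have "w \<in> inner ?d" unfolding inner_def using wk_1[of ?d] by (intro image_eqI[of _ _ 1]) auto
        then show False using inS[OF d] True w by auto
      qed
      then have "fin ?d = w" "wk ?d (len ?d) = x" unfolding fin_def by (simp_all add: wk_1)
      then show ?thesis using d True by (intro image_eqI[of _ _ ?d]) auto
    next
      case False
      then obtain d where d: "d \<in> D" "x \<in> inner d" using x by blast
      have "(w = fst d \<and> x = wk d 1) \<or> (w = fin d \<and> x = wk d (len d))"
        using inner_nbr_cases[of d x w] D[OF d(1)] d wx w by blast
      then show ?thesis using D[OF d(1)] w by blast
    qed
  qed
  moreover have finT: "finite ?T" using finite_hub_darts by simp
  moreover have "card ((\<lambda>d. wk d (len d)) ` ?T) + 2 \<le> deg w"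
  proof (cases "3 \<le> deg w")
    case True
    then show ?thesis using hits[of w] w card_image_le[OF finT, of "\<lambda>d. wk d (len d)"] by auto
  next
    case False
    then have "?T = {}" using hub_fin by auto
    then have "card ((\<lambda>d. wk d (len d)) ` ?T) = 0" by (metis card.empty image_empty)
    then show ?thesis using deg_ge_2[of w] w by simp
  qed
  ultimately show "2 \<le> card (nbrs w \<inter> (W - ?S))" using w by (intro card_nbrs_remove) auto
qed

end

lemma card_filter_sum: "finite A \<Longrightarrow> card {x \<in> A. P x} = (\<Sum>x\<in>A. if P x then 1 else 0)"
  by (simp add: sum.inter_filter[symmetric])

lemma balanced_three_bounds:
  assumes "balanced 3 M" "i < 3"
  shows "size M div 3 \<le> count M i" "count M i \<le> (size M + 2) div 3"
proof -
  have "size M = sum (count M) {..<3}" using assms(1) unfolding balanced_def by (intro size_eq_sum_count) auto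
  moreover have "{..<3} = {0, 1, 2 :: nat}" by auto
  ultimately have s: "size M = count M 0 + count M 1 + count M 2" by simp
  have le: "count M i \<le> count M j + 1" if "i < 3" "j < 3" for i j using assms(1) that unfolding balanced_def by blast
  have "count M i \<le> count M j + 1" "count M j \<le> count M i + 1" if "j < 3" for j using le assms(2) that by auto
  then have "count M 0 \<le> count M i + 1" "count M 1 \<le> count M i + 1" "count M 2 \<le> count M i + 1"
    "count M i \<le> count M 0 + 1" "count M i \<le> count M 1 + 1" "count M i \<le> count M 2 + 1" by auto
  then show "size M div 3 \<le> count M i" "count M i \<le> (size M + 2) div 3"
    using s less_3_cases[OF assms(2)] by auto
qed

lemma sum_by_value:
  fixes f :: "nat \<Rightarrow> nat"
  assumes "finite A" "\<And>x. x \<in> A \<Longrightarrow> g x \<in> {0, 1, 2, 4}"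
  shows "(\<Sum>x\<in>A. f (g x)) = f 0 * card {x \<in> A. g x = 0} + f 1 * card {x \<in> A. g x = 1} +
    f 2 * card {x \<in> A. g x = 2} + f 4 * card {x \<in> A. g x = 4}"
proof -
  have "g ` A \<subseteq> {0, 1, 2, 4}" by (rule image_subsetI) (rule assms(2))
  then have "(\<Sum>x\<in>A. f (g x)) = (\<Sum>t\<in>{0, 1, 2, 4}. \<Sum>x\<in>{x \<in> A. g x = t}. f (g x))"
    by (intro sum.group[OF assms(1), symmetric]) simp_all
  also have "\<dots> = (\<Sum>t\<in>{0, 1, 2, 4}. f t * card {x \<in> A. g x = t})"
    by (intro sum.cong refl) simp
  finally show ?thesis by simp
qed

context min_counterexample
begin

lemma dart_to_hub:
  assumes "u \<in> W" "3 \<le> deg u" "v \<in> nbrs u" "v \<notin> inner (u, v)"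
  shows "(u, v) \<in> hub_darts" "len (u, v) = 0" "fin (u, v) = v"
proof -
  show "(u, v) \<in> hub_darts" using assms unfolding hub_darts_def by simp
  show l: "len (u, v) = 0"
  proof (rule ccontr)
    assume "len (u, v) \<noteq> 0"
    then have "v \<in> inner (u, v)" unfolding inner_def using wk_1[of "(u, v)"] by (intro image_eqI[of _ _ 1]) auto
    then show False using assms(4) by blast
  qed
  then show "fin (u, v) = v" unfolding fin_def by (simp add: wk_1)
qed

text \<open>
  All hubs in \<open>H\<close> get the same colour, which is chosen such that at most \<open>\<alpha>\<close> of their threads with two
  or four inner vertices end outside \<open>H\<close> in that colour. The inner vertex of a thread between two hubs
  in \<open>H\<close>, counted by \<open>e\<close>, can then take either of the other two colours.
\<close>

lemma hub_config:
  assumes m3: "m = 3" and H: "H \<subseteq> W" "H \<noteq> {}"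
    and D: "\<And>d. d \<in> D \<Longrightarrow> d \<in> hub_darts \<and> fst d \<in> H"
    and rv: "\<And>d e. d \<in> D \<Longrightarrow> e \<in> D \<Longrightarrow> e \<noteq> rv d"
    and cover: "\<And>d. d \<in> hub_darts \<Longrightarrow> fst d \<in> H \<Longrightarrow> d \<in> D \<or> rv d \<in> D"
    and hubs: "\<And>u. u \<in> H \<Longrightarrow> 3 \<le> deg u"
    and hits: "\<And>w. w \<in> W - H \<Longrightarrow> 3 \<le> deg w \<Longrightarrow> card {d \<in> hub_darts. fst d \<in> H \<and> fin d = w} + 2 \<le> deg w"
    and mid: "\<And>d. d \<in> D \<Longrightarrow> fin d \<in> H \<Longrightarrow> len d = 1"
    and C: "C0 = card {d \<in> D. len d = 0}" "C1 = card {d \<in> D. len d = 1}"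
      "C2 = card {d \<in> D. len d = 2}" "C4 = card {d \<in> D. len d = 4}" "e = card {d \<in> D. fin d \<in> H}"
    and n: "n = card H + C1 + 2 * C2 + 4 * C4"
    and arith: "C2 + C4 < (3 - C0) * (\<alpha> + 1)" "\<alpha> + C1 \<le> n div 3 + e" "(n + 2) div 3 + \<alpha> \<le> card H + C2 + 2 * C4"
      "(n + 2) div 3 \<le> C2 + 2 * C4 + e" "card H \<le> n div 3"
  shows False
proof -
  let ?I = "\<Union>d\<in>D. inner d"
  let ?S = "H \<union> ?I"
  have finD: "finite D" using finite_hub_darts D by (meson finite_subset subsetI)
  have finH: "finite H" using H(1) finite_W finite_subset by blast
  have lens: "len d \<in> {0, 1, 2, 4}" if "d \<in> D" for d using len_cases[of d] D[OF that] by auto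
  have disj: "inner d \<inter> inner d' = {}" if "d \<in> D" "d' \<in> D" "d \<noteq> d'" for d d'
    using inner_disjoint[of d d'] D that rv[OF that(1,2)] by blast
  have hubI: "u \<notin> ?I" if "3 \<le> deg u" for u
    using deg_innerD D that by fastforce
  then have HI: "H \<inter> ?I = {}" using hubs by blast
  have IW: "?I \<subseteq> W" using inner_subset D by blast
  have finI: "finite ?I" using finD finite_inner by blast
  have fin_out: "fin d \<in> (W - ?S) \<union> H" if "d \<in> D" for d
    using fin_in_W hub_fin hubI D[OF that] by blast
  have sum_len: "(\<Sum>d\<in>D. len d) = C1 + 2 * C2 + 4 * C4"
    using sum_by_value[of D len "\<lambda>t. t", OF finD lens] unfolding C by simp
  have sum_half: "(\<Sum>d\<in>D. len d div 2) = C2 + 2 * C4"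
    using sum_by_value[of D len "\<lambda>t. t div 2", OF finD lens] unfolding C by simp
  have cardI: "card ?I = (\<Sum>d\<in>D. len d)"
    using card_UN_disjoint[of D inner] finD finite_inner disj card_inner D by simp
  then have cardS: "card ?S = n"
    using card_Un_disjoint[OF finH finI HI] sum_len n by simp
  obtain c where c: "equitable (W - ?S) m c"
    using rest_colourable[OF H D cover hubs hits] by blast
  have pc: "proper (W - ?S) 3 c" using c m3 unfolding equitable_def by simp
  define A where "A k = card {d \<in> D. 2 \<le> len d \<and> c (fin d) = k}" for k
  \<comment> \<open>The at most \<open>C0\<close> colours at the far ends of threads of length zero
    are excluded. If more than \<alpha> long threads ended in each remaining colour, there would be
    more than \<open>C2 + C4\<close> of them.\<close>
  obtain k where k: "k < 3" "\<And>d. d \<in> D \<Longrightarrow> len d = 0 \<Longrightarrow> c (fin d) \<noteq> k" "A k \<le> \<alpha>"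
  proof -
    define F where "F = (\<lambda>d. c (fin d)) ` {d \<in> D. len d = 0}"
    have finF: "finite F" "card F \<le> C0" unfolding F_def C(1) using finD by (auto intro: card_image_le)
    have cK: "3 - C0 \<le> card ({..<3} - F)"
      using diff_card_le_card_Diff[OF finF(1), of "{..<3}"] finF(2) by simp
    have "\<exists>k\<in>{..<3} - F. A k \<le> \<alpha>"
    proof (rule ccontr)
      assume "\<not> ?thesis"
      then have big: "\<alpha> + 1 \<le> A k" if "k \<in> {..<3} - F" for k
      proof -
        have "\<not> A k \<le> \<alpha>" using \<open>\<not> (\<exists>k\<in>{..<3} - F. A k \<le> \<alpha>)\<close> that by blast
        then show ?thesis by linarith
      qed
      have "(3 - C0) * (\<alpha> + 1) \<le> card ({..<3} - F) * (\<alpha> + 1)" using cK by (rule mult_le_mono1)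
      also have "\<dots> \<le> (\<Sum>k\<in>{..<3} - F. A k)"
        using sum_bounded_below[of "{..<3} - F" "\<alpha> + 1" A] big by simp
      also have "\<dots> = card (\<Union>k\<in>{..<3} - F. {d \<in> D. 2 \<le> len d \<and> c (fin d) = k})"
        unfolding A_def using finD by (intro card_UN_disjoint[symmetric]) auto
      also have "\<dots> \<le> card ({d \<in> D. len d = 2} \<union> {d \<in> D. len d = 4})"
        using finD lens by (intro card_mono) fastforce+
      also have "\<dots> \<le> C2 + C4" unfolding C by (rule card_Un_le)
      finally show False using arith(1) by simp
    qed
    then obtain k where "k < 3" "k \<notin> F" "A k \<le> \<alpha>" by blast
    then show thesis using that unfolding F_def by blast
  qed
  define c1 where "c1 v = (if v \<in> H then k else c v)" for v
  let ?X = "(W - ?S) \<union> H"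
  have cross: "c v \<noteq> k" if u: "u \<in> H" and v: "v \<in> W - ?S" and uv: "adj u v" for u v
  proof -
    have "v \<in> nbrs u" using v uv unfolding nbrs_def by blast
    moreover have "v \<notin> inner (u, v)"
    proof
      assume a: "v \<in> inner (u, v)"
      have d: "(u, v) \<in> hub_darts" using u H hubs calculation unfolding hub_darts_def by blast
      then have "inner (u, v) \<subseteq> ?I" using cover[OF d] u inner_rv[OF d] by auto
      then show False using a v by blast
    qed
    ultimately have d: "(u, v) \<in> hub_darts" "len (u, v) = 0" "fin (u, v) = v"
      using dart_to_hub[of u v] u H hubs by blast+
    have "rv (u, v) \<notin> D" using D[of "rv (u, v)"] fst_rv[OF d(1)] d(3) v by auto
    then have "(u, v) \<in> D" using cover[OF d(1)] u by auto
    then show ?thesis using k(2) d by metis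
  qed
  have indep: "\<not> adj u v" if u: "u \<in> H" and v: "v \<in> H" for u v
  proof
    assume uv: "adj u v"
    have "v \<in> nbrs u" using v uv H unfolding nbrs_def by blast
    moreover have d0: "(u, v) \<in> hub_darts" using u H hubs calculation unfolding hub_darts_def by blast
    have "v \<notin> inner (u, v)" using deg_innerD[OF d0] hubs[OF v] by fastforce
    ultimately have d: "(u, v) \<in> hub_darts" "len (u, v) = 0" "fin (u, v) = v"
      using dart_to_hub[of u v] u H hubs by blast+
    show False
    proof (cases "(u, v) \<in> D")
      case True
      then show False using mid[OF True] d v by simp
    next
      case False
      then have "rv (u, v) \<in> D" using cover[OF d(1)] u by auto
      then show False using mid[of "rv (u, v)"] fin_rv[OF d(1)] len_rv[OF d(1)] d(2) u by simp
    qed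
  qed
  have p1: "proper ?X 3 c1"
    unfolding proper_def
  proof (intro conjI ballI impI)
    fix v assume "v \<in> ?X"
    then show "c1 v < 3" using pc k(1) unfolding c1_def proper_def by auto
  next
    fix u v assume u: "u \<in> ?X" and v: "v \<in> ?X" and uv: "adj u v"
    consider "u \<in> H" "v \<in> H" | "u \<in> H" "v \<notin> H" | "u \<notin> H" "v \<in> H" | "u \<notin> H" "v \<notin> H" by blast
    then show "c1 u \<noteq> c1 v"
    proof cases
      case 1 then show ?thesis using indep uv by blast
    next
      case 2 then show ?thesis using cross[of u v] v uv unfolding c1_def by auto
    next
      case 3 then show ?thesis using cross[of v u] u adj_sym[OF uv] unfolding c1_def by auto
    next
      case 4 then show ?thesis using pc u v uv unfolding c1_def proper_def by auto
    qed
  qed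
  have far: "fin d \<notin> H" if "d \<in> D" "2 \<le> len d" for d using mid[OF that(1)] that(2) by auto
  have A: "(\<Sum>d\<in>D. if 2 \<le> len d \<and> c1 (fin d) = k then 1 else 0) = A k"
    unfolding A_def card_filter_sum[OF finD] using far by (intro sum.cong refl) (auto simp: c1_def)
  have n1: "(\<Sum>d\<in>D. if len d = 1 \<and> fin d \<notin> H then 1 else 0) + e = C1"
  proof -
    have e: "e = (\<Sum>d\<in>D. if fin d \<in> H then 1 else 0)" unfolding C by (rule card_filter_sum[OF finD])
    show ?thesis unfolding e C(2) card_filter_sum[OF finD] sum.distrib[symmetric]
      using mid by (intro sum.cong refl) auto
  qed
  let ?lo = "\<lambda>i. \<Sum>d\<in>D. lo (len d) k (c1 (fin d)) i" and ?hi = "\<lambda>i. \<Sum>d\<in>D. hi (len d) k (c1 (fin d)) i"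
  \<comment> \<open>A long thread with both ends coloured \<open>k\<close> can hold one vertex of
    colour \<open>k\<close> fewer.\<close>
  have hik: "C2 + 2 * C4 \<le> ?hi k + A k"
  proof -
    have "len d div 2 \<le> hi (len d) k (c1 (fin d)) k + (if 2 \<le> len d \<and> c1 (fin d) = k then 1 else 0)" if "d \<in> D" for d
      using lens[OF that] unfolding hi_def by auto
    then show ?thesis unfolding sum_half[symmetric] A[symmetric] sum.distrib[symmetric] by (rule sum_mono)
  qed
  \<comment> \<open>A thread within \<open>H\<close> has both ends coloured \<open>k\<close>, so its
    inner vertex may take colour \<open>i\<close>, a gain of one over
    \<open>len d div 2\<close>.\<close>
  have hii: "C2 + 2 * C4 + e \<le> ?hi i" if "i \<noteq> k" for i
  proof -
    have e: "e = (\<Sum>d\<in>D. if fin d \<in> H then 1 else 0)" unfolding C by (rule card_filter_sum[OF finD])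
    have "len d div 2 + (if fin d \<in> H then 1 else 0) \<le> hi (len d) k (c1 (fin d)) i" if "d \<in> D" for d
      using lens[OF that] mid[OF that] \<open>i \<noteq> k\<close> unfolding hi_def c1_def by auto
    then show ?thesis unfolding sum_half[symmetric] e sum.distrib[symmetric] by (rule sum_mono)
  qed
  have "lo t k j k = 0" for t j unfolding lo_def by simp
  then have lok: "?lo k = 0" by simp
  have loi: "?lo i + e \<le> A k + C1" for i
  proof -
    have "lo (len d) k (c1 (fin d)) i \<le> (if 2 \<le> len d \<and> c1 (fin d) = k then 1 else 0) + (if len d = 1 \<and> fin d \<notin> H then 1 else 0)"
      if "d \<in> D" for d using lens[OF that] mid[OF that] unfolding lo_def c1_def by auto
    then have "?lo i \<le> A k + (\<Sum>d\<in>D. if len d = 1 \<and> fin d \<notin> H then 1 else 0)"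
      unfolding A[symmetric] sum.distrib[symmetric] by (rule sum_mono)
    then show ?thesis using n1 by simp
  qed
  have "\<exists>c'. (\<forall>v\<in>W - ?S. c' v = c v) \<and> proper ((W - ?S) \<union> ?S) m c' \<and> (\<forall>i<m. card {v \<in> ?S. c' v = i} = count M i)"
    if M: "balanced m M" "size M = card ?S" for M
  proof -
    have b: "n div 3 \<le> count M i" "count M i \<le> (n + 2) div 3" if "i < 3" for i
      using balanced_three_bounds[of M i] M cardS m3 that by auto
    \<comment> \<open>The class sizes demanded of the inner vertices alone; all of \<open>H\<close>
      already counts for colour \<open>k\<close>, and the subtraction is exact by
      \<open>arith(5)\<close>.\<close>
    define x where "x i = count M i - (if i = k then card H else 0)" for i
    have xk: "count M i = x i + (if i = k then card H else 0)" if "i < 3" for i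
      using b(1)[OF that] arith(5) unfolding x_def by auto
    have "size M = sum (count M) {..<3}" using M(1) m3 unfolding balanced_def by (intro size_eq_sum_count) auto
    moreover have "{..<3} = {0, 1, 2 :: nat}" by auto
    ultimately have "n = count M 0 + count M 1 + count M 2" using M(2) cardS by simp
    then have sx: "x 0 + x 1 + x 2 = (\<Sum>d\<in>D. len d)"
      using xk[of 0] xk[of 1] xk[of 2] less_3_cases[OF k(1)] sum_len n by auto
    \<comment> \<open>Balanced multiplicities lie between \<open>n div 3\<close> and
      \<open>(n + 2) div 3\<close>. For colour \<open>k\<close> the lower bound is 0 and
      \<open>arith(3)\<close> gives the upper one; \<open>arith(2)\<close> and
      \<open>arith(4)\<close> do this for the other two colours.\<close>
    have bx: "?lo i \<le> x i \<and> x i \<le> ?hi i" if "i < 3" for i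
    proof (cases "i = k")
      case True
      then show ?thesis using lok hik k(3) arith(3) b(2)[OF that] xk[OF that] by simp
    next
      case False
      then show ?thesis using loi[of i] hii[of i] k(3) arith(2,4) b[OF that] xk[OF that] by simp
    qed
    have "\<exists>c'. proper (?X \<union> ?I) 3 c' \<and> (\<forall>v\<in>?X. c' v = c1 v) \<and> (\<forall>i<3. card {v \<in> ?I. c' v = i} = x i)"
    proof (rule fill_threads[OF _ p1 k(1) finD _ _ sx bx])
      show "?X \<subseteq> W" using H by blast
      fix d assume d: "d \<in> D"
      have "inner d \<inter> ?X = {}" using d HI by blast
      then show "d \<in> hub_darts \<and> fst d \<in> ?X \<and> fin d \<in> ?X \<and> c1 (fst d) = k \<and> inner d \<inter> ?X = {} \<and> len d \<in> {0, 1, 2, 4}"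
        using D[OF d] fin_out[OF d] lens[OF d] unfolding c1_def by simp
    qed (use rv in auto)
    then obtain c' where c': "proper (?X \<union> ?I) 3 c'" "\<forall>v\<in>?X. c' v = c1 v" "\<forall>i<3. card {v \<in> ?I. c' v = i} = x i"
      by blast
    have "card {v \<in> ?S. c' v = i} = count M i" if i: "i < 3" for i
    proof -
      have "{v \<in> ?S. c' v = i} = {v \<in> H. c' v = i} \<union> {v \<in> ?I. c' v = i}" by blast
      moreover have "card ({v \<in> H. c' v = i} \<union> {v \<in> ?I. c' v = i}) = card {v \<in> H. c' v = i} + card {v \<in> ?I. c' v = i}"
      proof (rule card_Un_disjoint)
        show "finite {v \<in> H. c' v = i}" using finH by simp
        show "finite {v \<in> ?I. c' v = i}" by (rule finite_subset[OF _ finI]) blast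
        have "{v \<in> H. c' v = i} \<inter> {v \<in> ?I. c' v = i} \<subseteq> H \<inter> ?I" by blast
        then show "{v \<in> H. c' v = i} \<inter> {v \<in> ?I. c' v = i} = {}" unfolding HI by (rule subset_empty[THEN iffD1])
      qed
      moreover have "{v \<in> H. c' v = i} = (if i = k then H else {})" using c'(2) unfolding c1_def by auto
      then have "card {v \<in> H. c' v = i} = (if i = k then card H else 0)" by simp
      moreover have "card {v \<in> ?I. c' v = i} = x i" using c'(3) i by blast
      ultimately have "card {v \<in> ?S. c' v = i} = (if i = k then card H else 0) + x i" by simp
      then show ?thesis using xk[OF i] by simp
    qed
    moreover have "\<forall>v\<in>W - ?S. c' v = c v" using c'(2) unfolding c1_def by auto
    moreover have "?X \<union> ?I = (W - ?S) \<union> ?S" by blast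
    ultimately show ?thesis using c'(1) m3 by (intro exI[of _ c']) simp
  qed
  moreover have "0 < m" "finite (W - ?S)" "finite ?S" "(W - ?S) \<inter> ?S = {}" using m finite_W finH finI by auto
  ultimately obtain c' where "equitable ((W - ?S) \<union> ?S) m c'"
    using equitable_extend[of m "W - ?S" ?S c] c by blast
  moreover have "(W - ?S) \<union> ?S = W" using IW H by blast
  ultimately show False using counterexample by metis
qed

text \<open>
  \<open>N u t\<close> is the number of threads with \<open>t\<close> inner vertices at \<open>u\<close>. The hubs in \<open>Bad\<close> are the cubic ones
  that have too little charge and yet cannot be removed on their own.
\<close>

definition darts :: "'a \<Rightarrow> ('a \<times> 'a) set" where
  "darts u = {d \<in> hub_darts. fst d = u}"

definition N :: "'a \<Rightarrow> nat \<Rightarrow> nat" where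
  "N u t = card {d \<in> darts u. len d = t}"

definition Bad :: "'a set" where
  "Bad = {u \<in> W. deg u = 3 \<and> N u 4 = 1 \<and> N u 1 = 2}"

lemma finite_darts: "finite (darts u)"
  unfolding darts_def using finite_hub_darts by simp

lemma card_darts: "u \<in> W \<Longrightarrow> 3 \<le> deg u \<Longrightarrow> card (darts u) = deg u"
proof -
  assume u: "u \<in> W" "3 \<le> deg u"
  have "darts u = Pair u ` nbrs u" unfolding darts_def hub_darts_def using u by auto
  then show ?thesis unfolding deg_def by (simp add: card_image inj_on_def)
qed

lemma len_darts: "d \<in> darts u \<Longrightarrow> len d \<in> {0, 1, 2, 4}"
  using len_cases[of d] unfolding darts_def by auto

lemma N_sum: "u \<in> W \<Longrightarrow> 3 \<le> deg u \<Longrightarrow> N u 0 + N u 1 + N u 2 + N u 4 = deg u"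
  using sum_by_value[of "darts u" len "\<lambda>_. 1", OF finite_darts len_darts] card_darts[of u] unfolding N_def by simp

lemma sum_len_darts: "(\<Sum>d\<in>darts u. len d) = N u 1 + 2 * N u 2 + 4 * N u 4"
  using sum_by_value[of "darts u" len "\<lambda>t. t", OF finite_darts len_darts] unfolding N_def by simp

lemma Bad_counts: "u \<in> Bad \<Longrightarrow> N u 0 = 0 \<and> N u 2 = 0 \<and> N u 4 = 1 \<and> N u 1 = 2"
  using N_sum[of u] unfolding Bad_def by auto

section \<open>Short cycles through hubs, and stars of bad hubs\<close>

lemma thread_polygon:
  assumes "set ds \<subseteq> hub_darts" "3 \<le> length ds" "distinct (map fst ds)"
    "successively (\<lambda>d e. fin d = fst e) ds" "fin (last ds) = fst (hd ds)"
    and no2: "\<And>d e. d \<in> set ds \<Longrightarrow> e \<in> set ds \<Longrightarrow> fst e \<noteq> fin d \<or> fin e \<noteq> fst d"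
  shows "14 \<le> (\<Sum>d\<leftarrow>ds. len d + 1)"
proof (rule cycle_of_threads)
  show "ds \<noteq> []" using assms(2) by auto
  have "length ds \<le> (\<Sum>d\<leftarrow>ds. len d + 1)" by (induction ds) auto
  then show "3 \<le> (\<Sum>d\<leftarrow>ds. len d + 1)" using assms(2) by linarith
  fix d e assume de: "d \<in> set ds" "e \<in> set ds"
  then have "d \<in> hub_darts" using assms(1) by blast
  then show "e \<noteq> rv d" using no2[OF de] fst_rv fin_rv by metis
qed (use assms in auto)

text \<open>The bound is 14 minus the three hubs. As threads have length at most four, no triangle
  contains a thread of length two or less.\<close>

lemma thread_triangle:
  assumes "a \<in> hub_darts" "b \<in> hub_darts" "c \<in> hub_darts"
    "fin a = fst b" "fin b = fst c" "fin c = fst a" "fst a \<noteq> fst b" "fst b \<noteq> fst c" "fst a \<noteq> fst c"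
  shows "11 \<le> len a + len b + len c"
proof -
  have "14 \<le> (\<Sum>d\<leftarrow>[a, b, c]. len d + 1)"
    by (rule thread_polygon) (use assms in auto)
  then show ?thesis by simp
qed

text \<open>Here the girth does not exclude everything: lengths 1, 1, 4, 4 attain the bound. This is
  the exceptional case in \<open>star_config\<close>.\<close>

lemma thread_quadrilateral:
  assumes "a \<in> hub_darts" "b \<in> hub_darts" "c \<in> hub_darts" "d \<in> hub_darts"
    "fin a = fst b" "fin b = fst c" "fin c = fst d" "fin d = fst a" "distinct [fst a, fst b, fst c, fst d]"
  shows "10 \<le> len a + len b + len c + len d"
proof -
  have "14 \<le> (\<Sum>d\<leftarrow>[a, b, c, d]. len d + 1)"
    by (rule thread_polygon) (use assms in auto)
  then show ?thesis by simp
qed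

text \<open>The removed hubs are \<open>w\<close> and \<open>r\<close> bad hubs reached from it by
  threads of length one. Each bad hub adds one more thread of length one and one of length four,
  whence the shifts by \<open>r\<close>; the linking threads are those counted by \<open>e\<close>
  in \<open>hub_config\<close>. The hypothesis \<open>two\<close> serves the case that both bad hubs
  send their long threads to the same hub, which then has degree at least four.\<close>

lemma star_config:
  assumes m3: "m = 3" and w: "w \<in> W" "3 \<le> deg w"
    and M: "M \<subseteq> {\<mu> \<in> darts w. len \<mu> = 1 \<and> fin \<mu> \<in> Bad}" and r: "r = card M" "r \<le> 2"
    and two: "r = 2 \<Longrightarrow> \<forall>x\<in>W. deg x = 3 \<longrightarrow> N x 4 \<le> 1"
    and n: "n = 1 + r + (N w 1 + r) + 2 * N w 2 + 4 * (N w 4 + r)"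
    and arith: "N w 2 + (N w 4 + r) < (3 - N w 0) * (\<alpha> + 1)" "\<alpha> + (N w 1 + r) \<le> n div 3 + r"
      "(n + 2) div 3 + \<alpha> \<le> (1 + r) + N w 2 + 2 * (N w 4 + r)"
      "(n + 2) div 3 \<le> N w 2 + 2 * (N w 4 + r) + r" "1 + r \<le> n div 3"
  shows False
proof -
  define H where "H = insert w (fin ` M)"
  \<comment> \<open>The linking threads are listed in the direction away from \<open>w\<close>
    only.\<close>
  define D where "D = darts w \<union> (\<Union>\<mu>\<in>M. darts (fin \<mu>) - {rv \<mu>})"
  have finM: "finite M" by (rule finite_subset[OF M]) (simp add: finite_darts)
  have M_hub: "\<mu> \<in> hub_darts" "fst \<mu> = w" "len \<mu> = 1" "fin \<mu> \<in> Bad" if "\<mu> \<in> M" for \<mu>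
    using M that unfolding darts_def by auto
  have M_inj: "\<mu> = \<nu>" if "\<mu> \<in> M" "\<nu> \<in> M" "fin \<mu> = fin \<nu>" for \<mu> \<nu>
    using fin_inj M_hub that by metis
  have M_ne: "fin \<mu> \<noteq> w" if "\<mu> \<in> M" for \<mu> using no_loop M_hub[OF that] by metis
  have rvM: "rv \<mu> \<in> darts (fin \<mu>)" "len (rv \<mu>) = 1" "fin (rv \<mu>) = w" "fst (rv \<mu>) = fin \<mu>" if "\<mu> \<in> M" for \<mu>
    using rv_hub_dart[OF M_hub(1)[OF that]] fst_rv[OF M_hub(1)[OF that]] len_rv[OF M_hub(1)[OF that]]
      fin_rv[OF M_hub(1)[OF that]] M_hub[OF that] unfolding darts_def by auto
  have bad: "u \<in> W \<and> deg u = 3" if "u \<in> Bad" for u using that unfolding Bad_def by blast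
  have HW: "H \<subseteq> W" using w(1) M_hub(4) bad unfolding H_def by blast
  have Hhub: "3 \<le> deg u" if "u \<in> H" for u using that w(2) M_hub(4) bad unfolding H_def by fastforce
  have D_hub: "d \<in> hub_darts \<and> fst d \<in> H" if "d \<in> D" for d using that unfolding D_def H_def darts_def by auto
  have HD_D: "d \<in> D \<or> (\<exists>\<mu>\<in>M. d = rv \<mu>)" if "d \<in> hub_darts" "fst d \<in> H" for d
    using that unfolding D_def H_def darts_def by auto
  have rvM_D: "rv \<mu> \<notin> D" if "\<mu> \<in> M" for \<mu>
  proof
    assume "rv \<mu> \<in> D"
    then consider "rv \<mu> \<in> darts w" | \<nu> where "\<nu> \<in> M" "rv \<mu> \<in> darts (fin \<nu>)" "rv \<mu> \<noteq> rv \<nu>" unfolding D_def by blast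
    then show False
    proof cases
      case 1 then show False using M_ne[OF that] rvM(4)[OF that] unfolding darts_def by auto
    next
      case 2
      then have "fin \<nu> = fin \<mu>" using rvM(4)[OF that] unfolding darts_def by auto
      then show False using M_inj[OF 2(1) that] 2(3) by blast
    qed
  qed
  text \<open>Among the removed hubs, the only threads are those in \<open>M\<close>: anything else would close a short cycle.\<close>
  have within: "d \<in> M \<or> (\<exists>\<mu>\<in>M. d = rv \<mu>)" if d: "d \<in> hub_darts" "fst d \<in> H" "fin d \<in> H" for d
  proof -
    have ne: "fin d \<noteq> fst d" using no_loop d by blast
    consider "fst d = w" | "fin d = w" | "fst d \<noteq> w" "fin d \<noteq> w" by blast
    then show ?thesis
    proof cases
      case 1
      then obtain \<mu> where \<mu>: "\<mu> \<in> M" "fin d = fin \<mu>" using d(3) ne unfolding H_def by auto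
      then have "d = \<mu>" using fin_inj[OF d(1) M_hub(1)[OF \<mu>(1)]] 1 M_hub(2) by simp
      then show ?thesis using \<mu> by blast
    next
      case 2
      then obtain \<mu> where \<mu>: "\<mu> \<in> M" "fst d = fin \<mu>" using d(2) ne unfolding H_def by auto
      then have "d = rv \<mu>" using fin_inj[OF d(1) rv_hub_dart[OF M_hub(1)[OF \<mu>(1)]]] 2 rvM[OF \<mu>(1)] by simp
      then show ?thesis using \<mu> by blast
    next
      case 3
      then obtain \<mu> \<nu> where \<mu>: "\<mu> \<in> M" "fst d = fin \<mu>" and \<nu>: "\<nu> \<in> M" "fin d = fin \<nu>"
        using d unfolding H_def by auto
      have "fin \<mu> \<noteq> fin \<nu>" using \<mu>(2) \<nu>(2) ne by simp
      then have "11 \<le> len \<mu> + len d + len (rv \<nu>)"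
        using M_hub[OF \<mu>(1)] d(1) rv_hub_dart[OF M_hub(1)[OF \<nu>(1)]] rvM[OF \<nu>(1)] \<mu>(2) \<nu>(2) M_ne[OF \<mu>(1)] M_ne[OF \<nu>(1)]
        by (intro thread_triangle) simp_all
      then show ?thesis using len_le_4[OF d(1)] M_hub(3)[OF \<mu>(1)] rvM(2)[OF \<nu>(1)] by simp
    qed
  qed
  have finD: "finite D" unfolding D_def using finM finite_darts by blast
  have at_h: "card {d \<in> hub_darts. fst d = h \<and> fin d = x} \<le> 1" for h x
    using finite_hub_darts fin_inj by (subst One_nat_def, subst card_le_Suc0_iff_eq) auto
  have hits: "card {d \<in> hub_darts. fst d \<in> H \<and> fin d = x} + 2 \<le> deg x" if x: "x \<in> W - H" "3 \<le> deg x" for x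
  proof (cases "\<exists>d e. d \<in> hub_darts \<and> e \<in> hub_darts \<and> fst d \<in> H \<and> fst e \<in> H \<and> fin d = x \<and> fin e = x \<and> d \<noteq> e")
    case False
    then have "card {d \<in> hub_darts. fst d \<in> H \<and> fin d = x} \<le> 1"
      using finite_hub_darts by (subst One_nat_def, subst card_le_Suc0_iff_eq) auto
    then show ?thesis using x(2) by simp
  next
    case True
    \<comment> \<open>A thread from \<open>w\<close> and one from a bad hub with the same end would
      form a triangle with the linking thread.\<close>
    have not_w: False if d: "d \<in> hub_darts" "fst d = w" "fin d = x" and e: "e \<in> hub_darts" "fst e \<in> H" "fin e = x" "d \<noteq> e" for d e
    proof -
      have "fst e \<noteq> w" using fin_inj[OF d(1) e(1)] d e by auto
      then obtain \<mu> where \<mu>: "\<mu> \<in> M" "fst e = fin \<mu>" using e(2) unfolding H_def by auto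
      have xH: "x \<noteq> w" "x \<noteq> fin \<mu>" using x(1) \<mu>(1) unfolding H_def by auto
      have "11 \<le> len (rv d) + len \<mu> + len e"
        using d e M_hub[OF \<mu>(1)] rv_hub_dart[OF d(1)] fst_rv[OF d(1)] fin_rv[OF d(1)] \<mu>(2) M_ne[OF \<mu>(1)] xH
        by (intro thread_triangle) simp_all
      then show False using len_le_4[OF d(1)] len_le_4[OF e(1)] M_hub(3)[OF \<mu>(1)] len_rv[OF d(1)] by simp
    qed
    from True obtain d e where de: "d \<in> hub_darts" "e \<in> hub_darts" "fst d \<in> H" "fst e \<in> H" "fin d = x" "fin e = x" "d \<noteq> e" by blast
    have "fst d \<noteq> w" "fst e \<noteq> w" using not_w[of d e] not_w[of e d] de by auto
    then obtain \<mu> \<nu> where \<mu>: "\<mu> \<in> M" "fst d = fin \<mu>" and \<nu>: "\<nu> \<in> M" "fst e = fin \<nu>"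
      using de unfolding H_def by auto
    have ne: "fin \<mu> \<noteq> fin \<nu>" using fin_inj[OF de(1,2)] \<mu> \<nu> de by auto
    then have "\<mu> \<noteq> \<nu>" by blast
    then have "{\<mu>, \<nu>} \<subseteq> M" "card {\<mu>, \<nu>} = 2" using \<mu> \<nu> by auto
    then have M2: "M = {\<mu>, \<nu>}" "r = 2" using r card_mono[OF finM] card_seteq[OF finM] by (metis, metis le_antisym)
    have xH: "x \<noteq> w" "x \<noteq> fin \<mu>" "x \<noteq> fin \<nu>" using x(1) \<mu> \<nu> unfolding H_def by auto
    \<comment> \<open>The two linking threads have length one, so the bound is met with equality and
      both threads into \<open>x\<close> have length four.\<close>
    have "10 \<le> len (rv d) + len (rv \<mu>) + len \<nu> + len e"
      using de rv_hub_dart[OF de(1)] fst_rv[OF de(1)] fin_rv[OF de(1)] rv_hub_dart[OF M_hub(1)[OF \<mu>(1)]]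
        rvM[OF \<mu>(1)] M_hub[OF \<nu>(1)] \<mu> \<nu> ne M_ne[OF \<mu>(1)] M_ne[OF \<nu>(1)] xH
      by (intro thread_quadrilateral) simp_all
    then have l4: "len d = 4" "len e = 4"
      using len_le_4[OF de(1)] len_le_4[OF de(2)] M_hub(3)[OF \<nu>(1)] rvM(2)[OF \<mu>(1)] len_rv[OF de(1)] by auto
    have "rv d \<noteq> rv e" using rv_rv[OF de(1)] rv_rv[OF de(2)] de(7) by metis
    moreover have "{rv d, rv e} \<subseteq> {d \<in> darts x. len d = 4}"
      using de l4 rv_hub_dart fst_rv len_rv unfolding darts_def by auto
    then have "card {rv d, rv e} \<le> N x 4" unfolding N_def using finite_darts by (intro card_mono) auto
    ultimately have "2 \<le> N x 4" by simp
    then have "4 \<le> deg x" using two[OF M2(2)] x by fastforce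
    moreover have "{d \<in> hub_darts. fst d \<in> H \<and> fin d = x} \<subseteq>
        {d \<in> hub_darts. fst d = fin \<mu> \<and> fin d = x} \<union> {d \<in> hub_darts. fst d = fin \<nu> \<and> fin d = x}"
    proof
      fix f assume f: "f \<in> {d \<in> hub_darts. fst d \<in> H \<and> fin d = x}"
      have "fst f \<noteq> w"
        using not_w[of f d] not_w[of f e] f de by auto
      then show "f \<in> {d \<in> hub_darts. fst d = fin \<mu> \<and> fin d = x} \<union> {d \<in> hub_darts. fst d = fin \<nu> \<and> fin d = x}"
        using f unfolding H_def M2(1) by auto
    qed
    then have "card {d \<in> hub_darts. fst d \<in> H \<and> fin d = x} \<le>
        card ({d \<in> hub_darts. fst d = fin \<mu> \<and> fin d = x} \<union> {d \<in> hub_darts. fst d = fin \<nu> \<and> fin d = x})"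
      using finite_hub_darts by (intro card_mono) auto
    ultimately show ?thesis
      using card_Un_le[of "{d \<in> hub_darts. fst d = fin \<mu> \<and> fin d = x}" "{d \<in> hub_darts. fst d = fin \<nu> \<and> fin d = x}"]
        at_h[of "fin \<mu>" x] at_h[of "fin \<nu>" x] by linarith
  qed
  have e: "{d \<in> D. fin d \<in> H} = M"
  proof
    show "{d \<in> D. fin d \<in> H} \<subseteq> M"
    proof
      fix d assume "d \<in> {d \<in> D. fin d \<in> H}"
      then show "d \<in> M" using within[of d] D_hub[of d] rvM_D by auto
    qed
    show "M \<subseteq> {d \<in> D. fin d \<in> H}" using M unfolding D_def H_def by auto
  qed
  have cardH: "card H = 1 + r"
  proof -
    have "inj_on fin M" using M_inj by (intro inj_onI) blast
    then have "card (fin ` M) = r" using r card_image by blast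
    moreover have "w \<notin> fin ` M" using M_ne by auto
    ultimately show ?thesis unfolding H_def using finM by simp
  qed
  \<comment> \<open>At \<open>t = 1\<close> each bad hub contributes one thread less, because its
    linking thread is already counted at \<open>w\<close>.\<close>
  have count: "card {d \<in> D. len d = t} = N w t + (\<Sum>\<mu>\<in>M. N (fin \<mu>) t - (if t = 1 then 1 else 0))" for t
  proof -
    let ?B = "\<lambda>\<mu>. {d \<in> darts (fin \<mu>) - {rv \<mu>}. len d = t}"
    have "{d \<in> D. len d = t} = {d \<in> darts w. len d = t} \<union> (\<Union>\<mu>\<in>M. ?B \<mu>)" unfolding D_def by blast
    moreover have "{d \<in> darts w. len d = t} \<inter> (\<Union>\<mu>\<in>M. ?B \<mu>) = {}"
    proof (rule equals0I)
      fix d assume "d \<in> {d \<in> darts w. len d = t} \<inter> (\<Union>\<mu>\<in>M. ?B \<mu>)"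
      then obtain \<mu> where \<mu>: "\<mu> \<in> M" "d \<in> darts (fin \<mu>)" "d \<in> darts w" by blast
      have "fst d = fin \<mu>" "fst d = w" using \<mu>(2,3) unfolding darts_def by simp_all
      then show False using M_ne[OF \<mu>(1)] by simp
    qed
    moreover have "card (\<Union>\<mu>\<in>M. ?B \<mu>) = (\<Sum>\<mu>\<in>M. card (?B \<mu>))"
    proof (rule card_UN_disjoint[OF finM])
      show "\<forall>\<mu>\<in>M. finite (?B \<mu>)" using finite_darts by simp
      show "\<forall>\<mu>\<in>M. \<forall>\<nu>\<in>M. \<mu> \<noteq> \<nu> \<longrightarrow> ?B \<mu> \<inter> ?B \<nu> = {}"
      proof (intro ballI impI)
        fix \<mu> \<nu> assume "\<mu> \<in> M" "\<nu> \<in> M" "\<mu> \<noteq> \<nu>"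
        then have "fin \<mu> \<noteq> fin \<nu>" using M_inj by blast
        then show "?B \<mu> \<inter> ?B \<nu> = {}" unfolding darts_def by auto
      qed
    qed
    moreover have "card (?B \<mu>) = N (fin \<mu>) t - (if t = 1 then 1 else 0)" if "\<mu> \<in> M" for \<mu>
    proof -
      have "?B \<mu> = {d \<in> darts (fin \<mu>). len d = t} - (if t = 1 then {rv \<mu>} else {})" using rvM[OF that] by auto
      then show ?thesis unfolding N_def using rvM[OF that] finite_darts by (auto simp: card_Diff_singleton)
    qed
    ultimately show ?thesis
      using card_Un_disjoint[of "{d \<in> darts w. len d = t}" "\<Union>\<mu>\<in>M. ?B \<mu>"] finite_darts finM unfolding N_def by simp
  qed
  have sumB: "(\<Sum>\<mu>\<in>M. N (fin \<mu>) t - (if t = 1 then 1 else 0)) = r * (if t = 1 \<or> t = 4 then 1 else 0)" if "t \<in> {0, 1, 2, 4}" for t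
  proof -
    have "N (fin \<mu>) t - (if t = 1 then 1 else 0) = (if t = 1 \<or> t = 4 then 1 else 0)" if "\<mu> \<in> M" for \<mu>
      using Bad_counts[OF M_hub(4)[OF that]] \<open>t \<in> {0, 1, 2, 4}\<close> by auto
    then show ?thesis using r(1) by simp
  qed
  have C: "card {d \<in> D. len d = 0} = N w 0" "card {d \<in> D. len d = 1} = N w 1 + r"
    "card {d \<in> D. len d = 2} = N w 2" "card {d \<in> D. len d = 4} = N w 4 + r"
    by (subst count, subst sumB, simp, simp)+
  show False
  proof (rule hub_config[OF m3 HW _ D_hub _ _ Hhub hits _ refl refl refl refl refl, of D])
    show "H \<noteq> {}" unfolding H_def by blast
    show "d' \<noteq> rv d" if d: "d \<in> D" "d' \<in> D" for d d'
    proof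
      assume eq: "d' = rv d"
      then have "fin d \<in> H" using D_hub[OF d(2)] fst_rv[of d] D_hub[OF d(1)] by simp
      then have "d \<in> M" using e d(1) by blast
      then show False using rvM_D d(2) eq by blast
    qed
    show "d \<in> D \<or> rv d \<in> D" if d: "d \<in> hub_darts" "fst d \<in> H" for d
      using HD_D[OF d] rv_rv M_hub(1) M unfolding D_def by fastforce
    show "len d = 1" if "d \<in> D" "fin d \<in> H" for d using e that M_hub(3) by blast
    show "n = card H + card {d \<in> D. len d = 1} + 2 * card {d \<in> D. len d = 2} + 4 * card {d \<in> D. len d = 4}"
      unfolding cardH C n by simp
    show "card {d \<in> D. len d = 2} + card {d \<in> D. len d = 4} < (3 - card {d \<in> D. len d = 0}) * (\<alpha> + 1)"
      using arith(1) unfolding C .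
    show "\<alpha> + card {d \<in> D. len d = 1} \<le> n div 3 + card {d \<in> D. fin d \<in> H}"
      using arith(2) unfolding C e r(1)[symmetric] .
    show "(n + 2) div 3 + \<alpha> \<le> card H + card {d \<in> D. len d = 2} + 2 * card {d \<in> D. len d = 4}"
      using arith(3) unfolding C cardH .
    show "(n + 2) div 3 \<le> card {d \<in> D. len d = 2} + 2 * card {d \<in> D. len d = 4} + card {d \<in> D. fin d \<in> H}"
      using arith(4) unfolding C e r(1)[symmetric] .
    show "card H \<le> n div 3" using arith(5) unfolding cardH .
  qed
qed

lemma single_hub:
  assumes "m = 3" "w \<in> W" "3 \<le> deg w" "n = 1 + N w 1 + 2 * N w 2 + 4 * N w 4"
    "N w 2 + N w 4 < (3 - N w 0) * (\<alpha> + 1)" "\<alpha> + N w 1 \<le> n div 3"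
    "(n + 2) div 3 + \<alpha> \<le> 1 + N w 2 + 2 * N w 4" "(n + 2) div 3 \<le> N w 2 + 2 * N w 4" "1 \<le> n div 3"
  shows False
  by (rule star_config[OF assms(1-3), of "{}" 0 n \<alpha>]) (use assms in auto)

text \<open>Without threads of length zero all three colours are available, so \<alpha> can be the
  average number of long threads per colour, rounded down. With at most one thread of length one,
  the hub is then removable on its own.\<close>

lemma hub_with_short_leg:
  assumes "m = 3" "w \<in> W" "3 \<le> deg w"
  shows "1 \<le> N w 0 \<or> 2 \<le> N w 1"
proof (rule ccontr)
  assume "\<not> ?thesis"
  then have "N w 0 = 0" "N w 1 \<le> 1" by auto
  moreover have "N w 1 + N w 2 + N w 4 \<ge> 3" using N_sum[OF assms(2,3)] assms(3) \<open>N w 0 = 0\<close> by simp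
  ultimately show False
    using single_hub[OF assms refl, of "(N w 2 + N w 4) div 3"] by simp linarith
qed

text \<open>The critical counts for \<open>hub_charge\<close>: the first four exceed the budget of
  the hub, and the last leaves nothing to give to a bad hub.\<close>

lemma single_hub_counts:
  assumes "m = 3" "w \<in> W" "3 \<le> deg w"
  shows "\<not> (N w 4 = 3 \<and> N w 2 = 0 \<and> N w 1 = 0 \<and> N w 0 = 1)"
    and "\<not> (N w 4 = 2 \<and> N w 2 = 0 \<and> N w 1 = 0 \<and> N w 0 = 1)"
    and "\<not> (N w 4 = 1 \<and> N w 2 = 1 \<and> N w 1 = 0 \<and> N w 0 = 1)"
    and "\<not> (N w 4 = 1 \<and> N w 2 = 0 \<and> N w 1 = 1 \<and> N w 0 = 1)"
    and "\<not> (N w 4 = 2 \<and> N w 2 = 0 \<and> N w 1 = 2 \<and> N w 0 = 0)"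
  by (rule notI, rule single_hub[OF assms refl, of 1]; simp)+

lemma cubic_N4:
  assumes "m = 3" "w \<in> W" "deg w = 3"
  shows "N w 4 \<le> 1"
proof (rule ccontr)
  assume "\<not> N w 4 \<le> 1"
  moreover have "N w 0 + N w 1 + N w 2 + N w 4 = 3" using N_sum[of w] assms by simp
  moreover have "1 \<le> N w 0 \<or> 2 \<le> N w 1" using hub_with_short_leg[of w] assms by simp
  ultimately have "N w 4 = 2 \<and> N w 2 = 0 \<and> N w 1 = 0 \<and> N w 0 = 1" by linarith
  then show False using single_hub_counts(2)[of w] assms by simp
qed

lemma star_bad:
  assumes "m = 3" "w \<in> W" "deg w = 3"
    and r: "r \<le> card {\<mu> \<in> darts w. len \<mu> = 1 \<and> fin \<mu> \<in> Bad}" "r \<le> 2"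
    and n: "n = 1 + r + (N w 1 + r) + 2 * N w 2 + 4 * (N w 4 + r)"
    and arith: "N w 2 + (N w 4 + r) < (3 - N w 0) * (\<alpha> + 1)" "\<alpha> + (N w 1 + r) \<le> n div 3 + r"
      "(n + 2) div 3 + \<alpha> \<le> (1 + r) + N w 2 + 2 * (N w 4 + r)"
      "(n + 2) div 3 \<le> N w 2 + 2 * (N w 4 + r) + r" "1 + r \<le> n div 3"
  shows False
proof -
  obtain M where M: "M \<subseteq> {\<mu> \<in> darts w. len \<mu> = 1 \<and> fin \<mu> \<in> Bad}" "card M = r"
    by (rule obtain_subset_with_card_n[OF r(1)])
  have "\<forall>x\<in>W. deg x = 3 \<longrightarrow> N x 4 \<le> 1" using cubic_N4[OF assms(1)] by blast
  then show False
    by (intro star_config[OF assms(1,2) _ M(1) M(2)[symmetric] r(2) _ n arith]) (use assms(3) in simp_all)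
qed

section \<open>Charges of the hubs for three colours\<close>

definition bad_legs :: "'a \<Rightarrow> nat" where
  "bad_legs w = card {\<mu> \<in> darts w. len \<mu> = 1 \<and> fin \<mu> \<in> Bad}"

lemma bad_legs_le: "bad_legs w \<le> N w 1"
  unfolding bad_legs_def N_def using finite_darts by (intro card_mono) auto

text \<open>In the three cases the slack in \<open>hub_charge\<close> is 0, 0 and 1, for lengths 4,
  1, 1 after receiving the two units due to a bad hub. One bad leg beyond the slack makes a
  removable star with \<alpha> = 1.\<close>

lemma cubic_bad_legs:
  assumes "m = 3" "w \<in> W" "deg w = 3" "N w 0 = 0"
  shows "N w 4 = 1 \<Longrightarrow> N w 1 = 2 \<Longrightarrow> bad_legs w = 0"
    and "N w 2 = 1 \<Longrightarrow> N w 1 = 2 \<Longrightarrow> bad_legs w = 0"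
    and "N w 1 = 3 \<Longrightarrow> bad_legs w \<le> 1"
proof -
  have s: "N w 1 + N w 2 + N w 4 = 3" using N_sum[of w] assms by simp
  show "bad_legs w = 0" if "N w 4 = 1" "N w 1 = 2"
  proof (rule ccontr)
    assume "bad_legs w \<noteq> 0"
    then have "1 \<le> card {\<mu> \<in> darts w. len \<mu> = 1 \<and> fin \<mu> \<in> Bad}" unfolding bad_legs_def by simp
    moreover have "N w 2 = 0" using that s by auto
    ultimately show False
      by (intro star_bad[OF assms(1-3), of 1 _ 1, OF _ _ refl]) (use that assms(4) in simp_all)
  qed
  show "bad_legs w = 0" if "N w 2 = 1" "N w 1 = 2"
  proof (rule ccontr)
    assume "bad_legs w \<noteq> 0"
    then have "1 \<le> card {\<mu> \<in> darts w. len \<mu> = 1 \<and> fin \<mu> \<in> Bad}" unfolding bad_legs_def by simp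
    moreover have "N w 4 = 0" using that s by auto
    ultimately show False
      by (intro star_bad[OF assms(1-3), of 1 _ 1, OF _ _ refl]) (use that assms(4) in simp_all)
  qed
  show "bad_legs w \<le> 1" if "N w 1 = 3"
  proof (rule ccontr)
    assume "\<not> bad_legs w \<le> 1"
    then have "2 \<le> card {\<mu> \<in> darts w. len \<mu> = 1 \<and> fin \<mu> \<in> Bad}" unfolding bad_legs_def by simp
    moreover have "N w 2 = 0" "N w 4 = 0" using that s by auto
    ultimately show False
      by (intro star_bad[OF assms(1-3), of 2 _ 1, OF _ _ refl]) (use that assms(4) in simp_all)
  qed
qed

text \<open>
  Discharging: every vertex \<open>v\<close> starts with charge \<open>6 deg v - 14\<close>. A hub gives one unit to each inner
  vertex of its threads, once per thread end, and one unit along each thread of length one to a bad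
  hub; the bad hubs lack two units and receive two.
\<close>

lemma hub_charge:
  assumes m3: "m = 3" and w: "w \<in> W" "3 \<le> deg w"
  shows "N w 1 + 2 * N w 2 + 4 * N w 4 + bad_legs w + 14 \<le> 6 * deg w + (if w \<in> Bad then 2 else 0)"
proof -
  have s: "N w 0 + N w 1 + N w 2 + N w 4 = deg w" using N_sum[OF w] .
  note short = hub_with_short_leg[OF m3 w] and single = single_hub_counts[OF m3 w]
  show ?thesis
  proof (cases "deg w = 3")
    case False
    \<comment> \<open>This is half of the claim after bounding \<open>bad_legs w\<close> by
      \<open>N w 1\<close> and expanding \<open>deg w\<close> as the sum of the four counts.\<close>
    have "7 \<le> N w 4 + 2 * N w 2 + 2 * N w 1 + 3 * N w 0"
    proof -
      have d: "4 \<le> deg w" using w(2) False by simp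
      consider "2 \<le> N w 0" | "N w 0 = 1" "5 \<le> deg w \<or> 1 \<le> N w 2 + N w 1" | "N w 0 = 1" "deg w = 4" "N w 2 + N w 1 = 0"
        | "N w 0 = 0" "5 \<le> deg w \<or> 3 \<le> N w 1 + N w 2" | "N w 0 = 0" "deg w = 4" "N w 1 + N w 2 \<le> 2"
        using d by linarith
      then show ?thesis
      proof cases
        case 3
        then have "N w 4 = 3" "N w 2 = 0" "N w 1 = 0" using s by auto
        then show ?thesis using single(1) 3 by simp
      next
        case 5
        then have "N w 1 = 2" "N w 2 = 0" "N w 4 = 2" using s short by auto
        then show ?thesis using single(5) 5 by simp
      next
        case 4
        then have "2 \<le> N w 1" using short by simp
        then show ?thesis using 4 s d by linarith
      qed (use s d in linarith)+
    qed
    then show ?thesis using s bad_legs_le[of w] by auto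
  next
    case True
    note cubic = cubic_bad_legs[OF m3 w(1) True]
    have bad: "w \<in> Bad \<longleftrightarrow> N w 4 = 1 \<and> N w 1 = 2" unfolding Bad_def using w True by auto
    have b: "bad_legs w \<le> N w 1" by (rule bad_legs_le)
    consider "N w 0 = 0" "N w 1 = 3" | "N w 0 = 0" "N w 1 = 2" "N w 4 = 1" "N w 2 = 0" | "N w 0 = 0" "N w 1 = 2" "N w 2 = 1" "N w 4 = 0"
      | "2 \<le> N w 0" | "N w 0 = 1" "2 * N w 4 + N w 2 \<le> 1 + N w 2"
      | "N w 0 = 1" "N w 4 = 1" "N w 2 = 1" | "N w 0 = 1" "N w 4 = 1" "N w 1 = 1" | "N w 0 = 1" "N w 4 = 2"
    proof -
      consider "N w 0 = 0" | "N w 0 = 1" | "2 \<le> N w 0" by linarith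
      then show thesis
      proof cases
        case 1
        then have "N w 1 = 3 \<or> N w 1 = 2" "N w 1 = 2 \<longrightarrow> (N w 4 = 1 \<and> N w 2 = 0) \<or> (N w 2 = 1 \<and> N w 4 = 0)"
          using s True short by arith+
        then show thesis using that(1-3) 1 by blast
      next
        case 2
        then have "N w 4 = 0 \<or> N w 4 = 1 \<or> N w 4 = 2" "N w 4 = 1 \<longrightarrow> N w 2 = 1 \<or> N w 1 = 1"
          using s True by arith+
        moreover have "2 * N w 4 + N w 2 \<le> 1 + N w 2" if "N w 4 = 0" using that by simp
        ultimately show thesis using that(5-8) 2 by blast
      next
        case 3
        then show thesis by (rule that(4))
      qed
    qed
    then show ?thesis
    proof cases
      case 1
      then have "N w 2 = 0" "N w 4 = 0" using s True by auto
      then show ?thesis using cubic(3)[OF 1] 1 True by simp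
    next
      case 2
      then show ?thesis using cubic(1) bad True by simp
    next
      case 3
      then show ?thesis using cubic(2) True by simp
    next
      case 4
      then have "N w 1 + N w 2 + N w 4 \<le> 1" using s True by simp
      then show ?thesis using b True by simp
    next
      case 5
      then have "N w 4 = 0" "N w 1 + N w 2 = 2" using s True by auto
      then show ?thesis using b True by simp
    next
      case 6
      then have "N w 1 = 0" using s True by auto
      then show ?thesis using single(3) 6 by simp
    next
      case 7
      then have "N w 2 = 0" using s True by auto
      then show ?thesis using single(4) 7 by simp
    next
      case 8
      then have "N w 1 = 0" "N w 2 = 0" using s True by auto
      then show ?thesis using single(2) 8 by simp
    qed
  qed
qed

section \<open>Four or more colours\<close>

lemma proper_extend:
  assumes c: "proper U m c" and UT: "U \<union> T \<subseteq> W" and agree: "\<And>v. v \<in> U \<Longrightarrow> f v = c v"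
    and T: "\<And>p. p \<in> T \<Longrightarrow> f p < m \<and> (\<forall>q\<in>nbrs p. f p \<noteq> f q)"
  shows "proper (U \<union> T) m f"
  unfolding proper_def
proof (intro conjI ballI impI)
  fix v assume "v \<in> U \<union> T"
  then show "f v < m" using c agree T unfolding proper_def by auto
next
  fix u v assume u: "u \<in> U \<union> T" and v: "v \<in> U \<union> T" and uv: "adj u v"
  have n: "v \<in> nbrs u" "u \<in> nbrs v" using u v uv adj_sym UT unfolding nbrs_def by auto
  consider "u \<in> T" | "v \<in> T" | "u \<in> U" "v \<in> U" using u v by blast
  then show "f u \<noteq> f v"
  proof cases
    case 1 then show ?thesis using T n by blast
  next
    case 2 then show ?thesis using T n by metis
  next
    case 3 then show ?thesis using c uv agree unfolding proper_def by auto
  qed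
qed

text \<open>Distinct threads at \<open>u\<close> end in distinct hubs by \<open>fin_inj\<close>, so
  every other hub loses at most one neighbour.\<close>

lemma spider_rest:
  assumes u: "u \<in> W" "3 \<le> deg u"
  shows "\<exists>c. equitable (W - ({u} \<union> (\<Union>d\<in>darts u. inner d))) m c"
proof (rule rest_colourable)
  show "card {d \<in> hub_darts. fst d \<in> {u} \<and> fin d = w} + 2 \<le> deg w" if "w \<in> W - {u}" "3 \<le> deg w" for w
  proof -
    have "card {d \<in> hub_darts. fst d \<in> {u} \<and> fin d = w} \<le> 1"
      using finite_hub_darts fin_inj by (subst One_nat_def, subst card_le_Suc0_iff_eq) auto
    then show ?thesis using that(2) by linarith
  qed
qed (use u in \<open>auto simp: darts_def\<close>)

lemma inner_one: "len d = 1 \<Longrightarrow> inner d = {wk d 1}"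
  unfolding inner_def by simp

lemma inner_two: "len d = 2 \<Longrightarrow> inner d = {wk d 1, wk d 2}"
proof -
  have "{1..2} = {1, 2 :: nat}" by auto
  then show "len d = 2 \<Longrightarrow> inner d = {wk d 1, wk d 2}" unfolding inner_def by simp
qed

lemma wk_one_neq_two: "d \<in> hub_darts \<Longrightarrow> len d = 2 \<Longrightarrow> wk d 1 \<noteq> wk d 2"
  using inj_onD[OF wk_inj[of d], of 1 2] by auto

lemma nbrs_one: "d \<in> hub_darts \<Longrightarrow> len d = 1 \<Longrightarrow> nbrs (wk d 1) = {fst d, fin d}"
  using nbrs_inner[of d 1] unfolding fin_def by (simp add: numeral_2_eq_2)

lemma nbrs_two:
  assumes "d \<in> hub_darts" "len d = 2"
  shows "nbrs (wk d 1) = {fst d, wk d 2}" "nbrs (wk d 2) = {wk d 1, fin d}"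
  using nbrs_inner[OF assms(1), of 1] nbrs_inner[OF assms(1), of 2] assms(2) unfolding fin_def
  by (simp_all add: numeral_2_eq_2)

text \<open>The condition on \<open>cs\<close> speaks about every \<open>f\<close> that realises it,
  so that for explicit legs it becomes a finite list of disequalities between colours.\<close>

lemma spider_colouring:
  assumes u: "u \<in> W" "3 \<le> deg u" and vs: "distinct vs" "set vs = {u} \<union> (\<Union>d\<in>darts u. inner d)"
    and arr: "\<And>M c. balanced m M \<Longrightarrow> size M = length vs \<Longrightarrow> \<exists>cs. mset cs = M \<and>
      (\<forall>f. map f vs = cs \<longrightarrow> (\<forall>v. v \<notin> set vs \<longrightarrow> f v = c v) \<longrightarrow> (\<forall>p\<in>set vs. \<forall>q\<in>nbrs p. f p \<noteq> f q))"
  shows False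
proof -
  let ?U = "W - set vs"
  obtain c where c: "equitable ?U m c" using spider_rest[OF u] unfolding vs(2) by blast
  have vsW: "set vs \<subseteq> W" unfolding vs(2) using u inner_subset unfolding darts_def by blast
  have "\<exists>f. (\<forall>v\<in>?U. f v = c v) \<and> proper (?U \<union> set vs) m f \<and> (\<forall>i<m. card {v \<in> set vs. f v = i} = count M i)"
    if M: "balanced m M" "size M = card (set vs)" for M
  proof -
    have "size M = length vs" using M(2) vs(1) by (simp add: distinct_card)
    from arr[OF M(1) this, of c]
    obtain cs where cs: "mset cs = M" "\<forall>f. map f vs = cs \<longrightarrow> (\<forall>v. v \<notin> set vs \<longrightarrow> f v = c v) \<longrightarrow> (\<forall>p\<in>set vs. \<forall>q\<in>nbrs p. f p \<noteq> f q)"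
      by blast
    have "length cs = length vs" using cs(1) \<open>size M = length vs\<close> by (metis size_mset)
    then obtain f where f: "map f vs = cs" "\<forall>v. v \<notin> set vs \<longrightarrow> f v = c v" using list_colouring[OF vs(1)] by metis
    have colours: "f p < m" if "p \<in> set vs" for p
    proof -
      have "f p \<in> set cs" using f(1) that by auto
      then have "f p \<in># M" using cs(1) by auto
      then show ?thesis using M(1) unfolding balanced_def by auto
    qed
    have "proper (?U \<union> set vs) m f"
    proof (rule proper_extend)
      show "proper ?U m c" using c unfolding equitable_def by blast
    qed (use f vsW colours cs(2) in auto)
    then show ?thesis using f card_colour_class_list[OF vs(1), of f] cs(1) by (intro exI[of _ f]) auto
  qed
  moreover have "0 < m" "finite ?U" "finite (set vs)" "?U \<inter> set vs = {}" using m finite_W by auto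
  ultimately obtain c' where "equitable (?U \<union> set vs) m c'" using equitable_extend[of m ?U "set vs" c] c by blast
  moreover have "?U \<union> set vs = W" using vsW by blast
  ultimately show False using counterexample by metis
qed

lemma spider_darts:
  assumes u: "u \<in> W" "deg u = 3" and d: "darts u = {d1, d2, d3}" "d1 \<noteq> d2" "d1 \<noteq> d3" "d2 \<noteq> d3"
  shows "nbrs u = {snd d1, snd d2, snd d3}"
    and "x \<in> {d1, d2, d3} \<Longrightarrow> x \<in> hub_darts \<and> fst x = u \<and> u \<notin> inner x \<and> fin x \<notin> {u} \<union> (\<Union>d\<in>darts u. inner d)"
    and "inner d1 \<inter> inner d2 = {}" "inner d1 \<inter> inner d3 = {}" "inner d2 \<inter> inner d3 = {}"
proof -
  have hub: "x \<in> hub_darts \<and> fst x = u" if "x \<in> {d1, d2, d3}" for x using that d(1) unfolding darts_def by blast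
  have "darts u = Pair u ` nbrs u" unfolding darts_def hub_darts_def using u by auto
  then have "nbrs u = snd ` darts u" by (simp add: image_image)
  then show "nbrs u = {snd d1, snd d2, snd d3}" unfolding d(1) by simp
  show "x \<in> hub_darts \<and> fst x = u \<and> u \<notin> inner x \<and> fin x \<notin> {u} \<union> (\<Union>d\<in>darts u. inner d)" if x: "x \<in> {d1, d2, d3}"
  proof -
    have "fin x \<notin> inner d" if "d \<in> darts u" for d
    proof
      assume "fin x \<in> inner d"
      then have "deg (fin x) = 2" using deg_innerD[of d] that unfolding darts_def by blast
      then show False using hub_fin[of x] hub[OF x] by simp
    qed
    then show ?thesis using hub[OF x] no_loop[of x] start_fin_not_inner(1)[of x] by auto
  qed
  have disj: "inner x \<inter> inner y = {}" if "x \<in> {d1, d2, d3}" "y \<in> {d1, d2, d3}" "x \<noteq> y" for x y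
  proof -
    have "y \<noteq> rv x" using hub[OF that(1)] hub[OF that(2)] fst_rv[of x] no_loop[of x] by metis
    then show ?thesis using inner_disjoint[of x y] hub[OF that(1)] hub[OF that(2)] that(3) by blast
  qed
  show "inner d1 \<inter> inner d2 = {}" "inner d1 \<inter> inner d3 = {}" "inner d2 \<inter> inner d3 = {}"
    by (rule disj; use d in simp)+
qed

lemma no_spider:
  assumes m4: "4 \<le> m" and u: "u \<in> W" "deg u = 3"
    and d: "darts u = {d1, d2, d3}" "d1 \<noteq> d2" "d1 \<noteq> d3" "d2 \<noteq> d3"
    and l: "len d1 = 2" "len d2 = 2" "len d3 = 1 \<or> len d3 = 2"
  shows False
proof -
  note S = spider_darts[OF u d]
  have h: "d1 \<in> hub_darts" "d2 \<in> hub_darts" "d3 \<in> hub_darts" "fst d1 = u" "fst d2 = u" "fst d3 = u"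
    "u \<notin> inner d1" "u \<notin> inner d2" "u \<notin> inner d3"
    using S(2) by blast+
  define a1 b1 w1 where "a1 = wk d1 1" and "b1 = wk d1 2" and "w1 = fin d1"
  define a2 b2 w2 where "a2 = wk d2 1" and "b2 = wk d2 2" and "w2 = fin d2"
  have N1: "nbrs a1 = {u, b1}" "nbrs b1 = {a1, w1}" and N2: "nbrs a2 = {u, b2}" "nbrs b2 = {a2, w2}"
    using nbrs_two[OF h(1) l(1)] nbrs_two[OF h(2) l(2)] h unfolding a1_def b1_def w1_def a2_def b2_def w2_def by simp_all
  have i1: "inner d1 = {a1, b1}" and i2: "inner d2 = {a2, b2}"
    using inner_two l unfolding a1_def b1_def a2_def b2_def by blast+
  have ne: "a1 \<noteq> b1" "a2 \<noteq> b2" using wk_one_neq_two h l unfolding a1_def b1_def a2_def b2_def by blast+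
  have Nu: "nbrs u = {a1, a2, wk d3 1}" using S(1) unfolding a1_def a2_def by (simp add: wk_1)
  have all: "{u} \<union> (\<Union>d\<in>darts u. inner d) = {u, a1, b1, a2, b2} \<union> inner d3" unfolding d(1) using i1 i2 by auto
  have out: "w1 \<notin> {u, a1, b1, a2, b2} \<union> inner d3" "w2 \<notin> {u, a1, b1, a2, b2} \<union> inner d3" "fin d3 \<notin> {u, a1, b1, a2, b2} \<union> inner d3"
    using S(2)[of d1] S(2)[of d2] S(2)[of d3] unfolding all w1_def w2_def by blast+
  from l(3) show False
  proof
    assume l3: "len d3 = 1"
    define a3 w3 where "a3 = wk d3 1" and "w3 = fin d3"
    have i3: "inner d3 = {a3}" using inner_one[OF l3] unfolding a3_def by simp
    have N3: "nbrs a3 = {u, w3}" using nbrs_one[OF h(3) l3] h(6) unfolding a3_def w3_def by simp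
    \<comment> \<open>The order is that of the colours delivered by
      \<open>arrange_spider_six\<close>: the third leg, then the path through
      \<open>u\<close>.\<close>
    let ?vs = "[a3, b1, a1, u, a2, b2]"
    have dist: "distinct ?vs" using ne h(7-9) S(3-5) unfolding i1 i2 i3 by auto
    have set: "set ?vs = {u} \<union> (\<Union>d\<in>darts u. inner d)" unfolding all i3 by auto
    show False
    proof (rule spider_colouring[OF u(1) _ dist set])
      show "3 \<le> deg u" using u(2) by simp
      fix M and c :: "'a \<Rightarrow> nat" assume M: "balanced m M" "size M = length ?vs"
      obtain g y1 x1 v x2 y2 where g: "M = {#g, y1, x1, v, x2, y2#}" "y1 \<noteq> x1" "x1 \<noteq> v" "v \<noteq> x2" "x2 \<noteq> y2"
        "y1 \<noteq> c w1" "y2 \<noteq> c w2" "v \<noteq> g" "g \<noteq> c w3"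
        using arrange_spider_six[OF m4 M(1), of "c w1" "c w2" "c w3"] M(2) by auto
      have col: "f p \<noteq> f q" if f: "map f ?vs = [g, y1, x1, v, x2, y2]" "\<forall>v. v \<notin> set ?vs \<longrightarrow> f v = c v"
        and pq: "p \<in> set ?vs" "q \<in> nbrs p" for f p q
      proof -
        have fw: "f w1 = c w1" "f w2 = c w2" "f w3 = c w3" using f(2) out unfolding i3 w3_def by auto
        have fv: "f a3 = g" "f b1 = y1" "f a1 = x1" "f u = v" "f a2 = x2" "f b2 = y2" using f(1) by auto
        have "(p = a3 \<and> (q = u \<or> q = w3)) \<or> (p = b1 \<and> (q = a1 \<or> q = w1)) \<or> (p = a1 \<and> (q = u \<or> q = b1)) \<or>
          (p = u \<and> (q = a1 \<or> q = a2 \<or> q = a3)) \<or> (p = a2 \<and> (q = u \<or> q = b2)) \<or> (p = b2 \<and> (q = a2 \<or> q = w2))"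
          using pq N1 N2 N3 Nu unfolding a3_def by auto
        then show ?thesis by (elim disjE conjE) (simp_all add: fv fw g(2-) g(2-)[symmetric])
      qed
      show "\<exists>cs. mset cs = M \<and> (\<forall>f. map f ?vs = cs \<longrightarrow> (\<forall>v. v \<notin> set ?vs \<longrightarrow> f v = c v) \<longrightarrow> (\<forall>p\<in>set ?vs. \<forall>q\<in>nbrs p. f p \<noteq> f q))"
      proof (intro exI[of _ "[g, y1, x1, v, x2, y2]"] conjI allI impI ballI)
        show "mset [g, y1, x1, v, x2, y2] = M" by (simp add: g(1))
      qed (rule col)
    qed
  next
    assume l3: "len d3 = 2"
    define a3 b3 w3 where "a3 = wk d3 1" and "b3 = wk d3 2" and "w3 = fin d3"
    have i3: "inner d3 = {a3, b3}" using inner_two[OF l3] unfolding a3_def b3_def by simp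
    have N3: "nbrs a3 = {u, b3}" "nbrs b3 = {a3, w3}" using nbrs_two[OF h(3) l3] h(6) unfolding a3_def b3_def w3_def by simp_all
    have ne3: "a3 \<noteq> b3" using wk_one_neq_two h l3 unfolding a3_def b3_def by blast
    let ?vs = "[b3, a3, b1, a1, u, a2, b2]"
    have dist: "distinct ?vs" using ne ne3 h(7-9) S(3-5) unfolding i1 i2 i3 by auto
    have set: "set ?vs = {u} \<union> (\<Union>d\<in>darts u. inner d)" unfolding all i3 by auto
    show False
    proof (rule spider_colouring[OF u(1) _ dist set])
      show "3 \<le> deg u" using u(2) by simp
      fix M and c :: "'a \<Rightarrow> nat" assume M: "balanced m M" "size M = length ?vs"
      obtain y3 x3 y1 x1 v x2 y2 where g: "M = {#y3, x3, y1, x1, v, x2, y2#}" "y1 \<noteq> x1" "x1 \<noteq> v" "v \<noteq> x2" "x2 \<noteq> y2"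
        "y1 \<noteq> c w1" "y2 \<noteq> c w2" "v \<noteq> x3" "x3 \<noteq> y3" "y3 \<noteq> c w3"
        using arrange_spider_seven[OF m4 M(1), of "c w1" "c w2" "c w3"] M(2) by auto
      have col: "f p \<noteq> f q" if f: "map f ?vs = [y3, x3, y1, x1, v, x2, y2]" "\<forall>v. v \<notin> set ?vs \<longrightarrow> f v = c v"
        and pq: "p \<in> set ?vs" "q \<in> nbrs p" for f p q
      proof -
        have fw: "f w1 = c w1" "f w2 = c w2" "f w3 = c w3" using f(2) out unfolding i3 w3_def by auto
        have fv: "f b3 = y3" "f a3 = x3" "f b1 = y1" "f a1 = x1" "f u = v" "f a2 = x2" "f b2 = y2" using f(1) by auto
        have "(p = b3 \<and> (q = a3 \<or> q = w3)) \<or> (p = a3 \<and> (q = u \<or> q = b3)) \<or> (p = b1 \<and> (q = a1 \<or> q = w1)) \<or> (p = a1 \<and> (q = u \<or> q = b1)) \<or>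
          (p = u \<and> (q = a1 \<or> q = a2 \<or> q = a3)) \<or> (p = a2 \<and> (q = u \<or> q = b2)) \<or> (p = b2 \<and> (q = a2 \<or> q = w2))"
          using pq N1 N2 N3 Nu unfolding a3_def by auto
        then show ?thesis by (elim disjE conjE) (simp_all add: fv fw g(2-) g(2-)[symmetric])
      qed
      show "\<exists>cs. mset cs = M \<and> (\<forall>f. map f ?vs = cs \<longrightarrow> (\<forall>v. v \<notin> set ?vs \<longrightarrow> f v = c v) \<longrightarrow> (\<forall>p\<in>set ?vs. \<forall>q\<in>nbrs p. f p \<noteq> f q))"
      proof (intro exI[of _ "[y3, x3, y1, x1, v, x2, y2]"] conjI allI impI ballI)
        show "mset [y3, x3, y1, x1, v, x2, y2] = M" by (simp add: g(1))
      qed (rule col)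
    qed
  qed
qed

section \<open>Discharging\<close>

definition hub_set :: "'a set" where
  "hub_set = {v \<in> W. 3 \<le> deg v}"

lemma finite_hub_set: "finite hub_set"
  unfolding hub_set_def using finite_W by simp

lemma sum_hub_darts: "(\<Sum>d\<in>hub_darts. f d) = (\<Sum>u\<in>hub_set. \<Sum>d\<in>darts u. f d)"
proof -
  have "fst ` hub_darts \<subseteq> hub_set" unfolding hub_set_def hub_darts_def by auto
  then show ?thesis unfolding darts_def
    by (intro sum.group[OF finite_hub_darts finite_hub_set, symmetric])
qed

lemma W_nonempty: "W \<noteq> {}"
proof
  assume "W = {}"
  then have "equitable W m (\<lambda>_. 0)" unfolding equitable_def proper_def by simp
  then show False using counterexample by blast
qed

text \<open>By \<open>sparse\<close> the charges 6 deg - 14 have a negative sum, and each vertex of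
  degree two contributes -2; stated without subtraction.\<close>

lemma hub_charge_bound:
  "6 * (\<Sum>u\<in>hub_set. deg u) < 14 * card hub_set + 2 * card (W - hub_set)"
proof -
  have "3 * (\<Sum>v\<in>W. deg v) < 7 * card W"
    using sparse[OF W W_nonempty] finite_W
    unfolding deg_def nbrs_def by simp
  moreover have "(\<Sum>v\<in>W. deg v) = (\<Sum>v\<in>hub_set. deg v) + (\<Sum>v\<in>W - hub_set. deg v)"
    using finite_W unfolding hub_set_def by (subst sum.subset_diff[of "{v \<in> W. 3 \<le> deg v}"]) auto
  moreover have "(\<Sum>v\<in>W - hub_set. deg v) = (\<Sum>v\<in>W - hub_set. 2)"
  proof (rule sum.cong[OF refl])
    fix v assume v: "v \<in> W - hub_set"
    then show "deg v = 2" using deg_ge_2[of v] unfolding hub_set_def by auto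
  qed
  moreover have "card W = card hub_set + card (W - hub_set)"
    using finite_W unfolding hub_set_def by (metis (no_types, lifting) card_Diff_subset card_mono finite_subset le_add_diff_inverse mem_Collect_eq subsetI)
  ultimately show ?thesis by simp
qed

text \<open>A vertex \<open>x\<close> of degree two is passed once in each direction. For a
  neighbour \<open>y\<close>, walking from \<open>x\<close> through \<open>y\<close> to a hub and
  turning around gives the dart that arrives at \<open>x\<close> from \<open>y\<close>.\<close>

lemma inner_vertices_bound: "2 * card (W - hub_set) \<le> (\<Sum>d\<in>hub_darts. len d)"
proof -
  let ?A = "Sigma (W - hub_set) nbrs" and ?B = "Sigma hub_darts (\<lambda>d. {1..len d})"
  let ?f = "\<lambda>(d, j). (wk d j, wk d (j - 1))"
  have deg2: "deg x = 2" if "x \<in> W - hub_set" for x using that deg_ge_2[of x] unfolding hub_set_def by auto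
  have "?A \<subseteq> ?f ` ?B"
  proof
    fix z assume "z \<in> ?A"
    then obtain x y where z: "z = (x, y)" and x: "x \<in> W - hub_set" and y: "y \<in> nbrs x" by auto
    let ?d = "(x, y)"
    have xy: "fst ?d \<in> W" "snd ?d \<in> nbrs (fst ?d)" using x y by auto
    define n where "n = len ?d"
    have inn: "deg (wk ?d k) = 2" if "1 \<le> k" "k \<le> n" for k using len(2)[OF xy, of k] that unfolding n_def by simp
    define e where "e = (wk ?d (Suc n), wk ?d n)"
    have hubf: "3 \<le> deg (wk ?d (Suc n))" using len(1)[OF xy] unfolding fin_def n_def .
    have step: "wk ?d n \<in> W" "wk ?d (Suc n) \<in> W" "wk ?d (Suc n) \<in> nbrs (wk ?d n)"
      using walk_step[of x y] x y unfolding wk_def by auto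
    have e: "e \<in> hub_darts" unfolding hub_darts_def e_def using hubf step nbrs_sym by auto
    have back_walk: "wk e i = wk ?d (Suc n - i)" if "i \<le> Suc n" for i
      using walk_reverse[of x y n i] x y inn that unfolding wk_def e_def by auto
    have d2: "deg (wk e i) = 2" if "1 \<le> i" "i \<le> Suc n" for i
    proof (cases "i = Suc n")
      case True
      then show ?thesis using back_walk[of i] deg2[OF x] by simp
    next
      case False
      then show ?thesis using back_walk[of i] inn[of "Suc n - i"] that by simp
    qed
    have "Suc n \<le> len e"
    proof (rule ccontr)
      assume "\<not> Suc n \<le> len e"
      then have "deg (wk e (Suc (len e))) = 2" by (intro d2) auto
      then show False using hub_fin[OF e] unfolding fin_def by simp
    qed
    moreover have "wk e (Suc n) = x" "wk e n = y" using back_walk[of "Suc n"] back_walk[of n] by (simp_all add: wk_1)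
    ultimately show "z \<in> ?f ` ?B" unfolding z using e by (intro image_eqI[of _ _ "(e, Suc n)"]) auto
  qed
  moreover have "finite ?B" using finite_hub_darts by auto
  ultimately have "card ?A \<le> card ?B" by (rule surj_card_le[rotated])
  moreover have "card ?B = (\<Sum>d\<in>hub_darts. len d)" using finite_hub_darts by simp
  moreover have "card ?A = (\<Sum>x\<in>W - hub_set. 2)"
    using deg2 finite_W finite_nbrs by (simp add: deg_def)
  ultimately show ?thesis by simp
qed

lemma three_colours_impossible:
  assumes m3: "m = 3"
  shows False
proof -
  have "Bad \<subseteq> hub_set" unfolding Bad_def hub_set_def by auto
  have "(\<Sum>u\<in>hub_set. (\<Sum>d\<in>darts u. len d) + bad_legs u + 14) \<le> (\<Sum>u\<in>hub_set. 6 * deg u + (if u \<in> Bad then 2 else 0))"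
  proof (rule sum_mono)
    fix u assume "u \<in> hub_set"
    then show "(\<Sum>d\<in>darts u. len d) + bad_legs u + 14 \<le> 6 * deg u + (if u \<in> Bad then 2 else 0)"
      using hub_charge[OF m3, of u] unfolding sum_len_darts hub_set_def by simp
  qed
  then have "(\<Sum>d\<in>hub_darts. len d) + (\<Sum>u\<in>hub_set. bad_legs u) + 14 * card hub_set
      \<le> 6 * (\<Sum>u\<in>hub_set. deg u) + (\<Sum>u\<in>hub_set. if u \<in> Bad then 2 else 0)"
    unfolding sum_hub_darts by (simp add: sum.distrib sum_distrib_left mult.commute)
  moreover have "(\<Sum>u\<in>hub_set. if u \<in> Bad then 2 else 0) = 2 * card Bad"
  proof -
    have "{u \<in> hub_set. u \<in> Bad} = Bad" using \<open>Bad \<subseteq> hub_set\<close> by blast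
    then show ?thesis using sum.inter_filter[OF finite_hub_set, of "\<lambda>_. 2 :: nat" "\<lambda>u. u \<in> Bad"] by simp
  qed
  moreover have "(\<Sum>u\<in>hub_set. bad_legs u) = 2 * card Bad"
  proof -
    let ?P = "{d \<in> hub_darts. len d = 1 \<and> fin d \<in> Bad}" and ?Q = "{d \<in> hub_darts. len d = 1 \<and> fst d \<in> Bad}"
    have "(\<Sum>u\<in>hub_set. bad_legs u) = (\<Sum>d\<in>hub_darts. if len d = 1 \<and> fin d \<in> Bad then 1 else 0)"
      unfolding sum_hub_darts bad_legs_def card_filter_sum[OF finite_darts] ..
    also have "\<dots> = card ?P" using card_filter_sum[OF finite_hub_darts] by metis
    \<comment> \<open>Reversal matches the threads of length one that end in bad hubs with those
      that start there, two at each.\<close>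
    also have "\<dots> = card ?Q"
      by (rule bij_betw_same_card[of rv], rule bij_betw_byWitness[of _ rv])
        (auto simp: rv_rv rv_hub_dart len_rv fin_rv fst_rv)
    also have "\<dots> = (\<Sum>d\<in>hub_darts. if len d = 1 \<and> fst d \<in> Bad then 1 else 0)"
      by (rule card_filter_sum[OF finite_hub_darts])
    also have "\<dots> = (\<Sum>u\<in>hub_set. if u \<in> Bad then N u 1 else 0)"
      unfolding sum_hub_darts
    proof (rule sum.cong[OF refl])
      fix u
      have "(\<Sum>d\<in>darts u. if len d = 1 \<and> fst d \<in> Bad then 1 else 0) = (\<Sum>d\<in>darts u. if len d = 1 \<and> u \<in> Bad then 1 else (0::nat))"
        by (rule sum.cong[OF refl]) (auto simp: darts_def)
      then show "(\<Sum>d\<in>darts u. if len d = 1 \<and> fst d \<in> Bad then 1 else 0) = (if u \<in> Bad then N u 1 else 0)"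
        unfolding N_def card_filter_sum[OF finite_darts] by simp
    qed
    also have "\<dots> = (\<Sum>u\<in>hub_set. if u \<in> Bad then 2 else 0)" using Bad_counts by (intro sum.cong refl) auto
    also have "\<dots> = 2 * card Bad" by fact
    finally show ?thesis .
  qed
  ultimately show False using hub_charge_bound inner_vertices_bound by linarith
qed

text \<open>Threads have length at most two, so a hub of degree at least four pays at most 2 deg,
  which is below 6 deg - 14. A cubic hub has four units, and \<open>no_spider\<close> excludes total
  lengths five and six.\<close>

lemma many_colours_impossible:
  assumes m4: "4 \<le> m"
  shows False
proof -
  have "(\<Sum>u\<in>hub_set. (\<Sum>d\<in>darts u. len d) + 14) \<le> (\<Sum>u\<in>hub_set. 6 * deg u)"
  proof (rule sum_mono)
    fix u assume "u \<in> hub_set"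
    then have u: "u \<in> W" "3 \<le> deg u" unfolding hub_set_def by auto
    have le2: "len d \<le> 2" if "d \<in> darts u" for d using len_cases[of d] m4 that unfolding darts_def by auto
    show "(\<Sum>d\<in>darts u. len d) + 14 \<le> 6 * deg u"
    proof (cases "deg u = 3")
      case False
      have "(\<Sum>d\<in>darts u. len d) \<le> deg u * 2" using sum_bounded_above[of "darts u" len 2] le2 card_darts[OF u] by simp
      then show ?thesis using False u(2) by linarith
    next
      case True
      then have "card (darts u) = 3" using card_darts[OF u] by simp
      then obtain d1 d2 d3 where d: "darts u = {d1, d2, d3}" "d1 \<noteq> d2" "d2 \<noteq> d3" "d1 \<noteq> d3" by (auto simp: card_3_iff)
      have s: "(\<Sum>d\<in>darts u. len d) = len d1 + len d2 + len d3" unfolding d(1) using d by simp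
      have l: "len d1 \<le> 2" "len d2 \<le> 2" "len d3 \<le> 2" using le2 d(1) by auto
      have "len d1 + len d2 + len d3 \<le> 4"
      proof (rule ccontr)
        assume "\<not> ?thesis"
        then consider "len d1 = 2" "len d2 = 2" "len d3 = 1 \<or> len d3 = 2" | "len d1 = 2" "len d3 = 2" "len d2 = 1"
          | "len d2 = 2" "len d3 = 2" "len d1 = 1" using l by linarith
        then show False
        proof cases
          case 1
          then show False using no_spider[OF m4 u(1) True d(1)] d by blast
        next
          case 2
          have "darts u = {d1, d3, d2}" using d(1) by auto
          then show False using no_spider[OF m4 u(1) True, of d1 d3 d2] d 2 by auto
        next
          case 3
          have "darts u = {d2, d3, d1}" using d(1) by auto
          then show False using no_spider[OF m4 u(1) True, of d2 d3 d1] d 3 by auto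
        qed
      qed
      then show ?thesis using s True by simp
    qed
  qed
  then have "(\<Sum>d\<in>hub_darts. len d) + 14 * card hub_set \<le> 6 * (\<Sum>u\<in>hub_set. deg u)"
    unfolding sum_hub_darts by (simp add: sum.distrib sum_distrib_left mult.commute)
  then show False using hub_charge_bound inner_vertices_bound by linarith
qed

lemma impossible: False
  using three_colours_impossible many_colours_impossible m by linarith

end

lemma (in sparse_graph) equitable_colouring_exists:
  assumes m: "3 \<le> m" and "W \<subseteq> V" "\<forall>v\<in>W. 2 \<le> card {u \<in> W. adj v u}"
  shows "\<exists>c. equitable W m c"
  using assms(2,3)
proof (induction "card W" arbitrary: W rule: less_induct)
  case less
  show ?case
  proof (rule ccontr)
    assume no: "\<not> ?case"
    have fin: "finite W" using less.prems(1) finite_V finite_subset by blast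
    interpret min_counterexample V adj W m
    proof
      show "\<exists>c. equitable U m c" if "U \<subset> W" "\<forall>v\<in>U. 2 \<le> card {u \<in> U. adj v u}" for U
        using less.hyps[OF psubset_card_mono[OF fin that(1)]] that less.prems(1) by blast
    qed (use m less.prems no in auto)
    show False by (rule impossible)
  qed
qed

section \<open>Planar graphs of girth at least fourteen\<close>

text \<open>A longest path contains all neighbours of its first vertex, and a neighbour other than
  the second vertex closes a cycle.\<close>

lemma exists_cycle:
  fixes R :: "'a \<Rightarrow> 'a \<Rightarrow> bool"
  assumes U: "finite U" "U \<noteq> {}" and sym: "\<And>x y. R x y \<Longrightarrow> R y x" and irr: "\<And>x. \<not> R x x"
    and deg: "\<And>x. x \<in> U \<Longrightarrow> 2 \<le> card {y \<in> U. R x y}"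
  obtains xs where "set xs \<subseteq> U" "distinct xs" "3 \<le> length xs" "successively R xs" "R (last xs) (hd xs)"
proof -
  define P where "P xs \<longleftrightarrow> xs \<noteq> [] \<and> set xs \<subseteq> U \<and> distinct xs \<and> successively R xs" for xs
  obtain x where "x \<in> U" using U(2) by blast
  then have "P [x]" unfolding P_def by simp
  moreover have "length xs < Suc (card U)" if "P xs" for xs
    using that U(1) card_mono[of U "set xs"] distinct_card[of xs] unfolding P_def by simp
  ultimately obtain xs where xs: "P xs" "\<And>ys. P ys \<Longrightarrow> length ys \<le> length xs"
    using ex_has_greatest_nat[of P "[x]" length "Suc (card U)"] by auto
  define x0 where "x0 = hd xs"
  have P: "xs \<noteq> []" "set xs \<subseteq> U" "distinct xs" "successively R xs" using xs(1) unfolding P_def by auto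
  then have x0: "x0 \<in> U" "xs ! 0 = x0" unfolding x0_def by (auto simp: hd_conv_nth)
  have in_xs: "y \<in> set xs" if y: "y \<in> U" "R x0 y" for y
  proof (rule ccontr)
    assume "y \<notin> set xs"
    then have "P (y # xs)" using P y sym unfolding P_def x0_def by (cases xs) auto
    then show False using xs(2) by fastforce
  qed
  have "\<not> {y \<in> U. R x0 y} \<subseteq> {xs ! 1}"
  proof
    assume "{y \<in> U. R x0 y} \<subseteq> {xs ! 1}"
    then have "card {y \<in> U. R x0 y} \<le> 1" using card_mono[of "{xs ! 1}" "{y \<in> U. R x0 y}"] by simp
    then show False using deg[OF x0(1)] by simp
  qed
  then obtain y where y: "y \<in> U" "R x0 y" "y \<noteq> xs ! 1" by auto
  then have "y \<in> set xs" using in_xs by simp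
  then obtain i where i: "i < length xs" "y = xs ! i" unfolding in_set_conv_nth by auto
  have "i \<noteq> 0"
  proof
    assume "i = 0"
    then have "y = x0" using i(2) x0(2) by simp
    then show False using y(2) irr by simp
  qed
  moreover have "i \<noteq> 1" using i(2) y(3) by auto
  ultimately have i2: "2 \<le> i" by simp
  let ?c = "take (Suc i) xs"
  show thesis
  proof (rule that)
    show "set ?c \<subseteq> U" using P(2) set_take_subset[of "Suc i" xs] by simp
    show "distinct ?c" using P(3) by simp
    show "3 \<le> length ?c" using i i2 by simp
    have nth: "R (xs ! j) (xs ! Suc j)" if "Suc j < length xs" for j
      using P(4) that unfolding successively_conv_nth by blast
    show "successively R ?c" unfolding successively_conv_nth using nth i(1) by simp
    have "last ?c = xs ! i" using i(1) by (simp add: take_Suc_conv_app_nth)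
    moreover have "hd ?c = x0" unfolding x0_def by simp
    ultimately show "R (last ?c) (hd ?c)" using sym y(2) i(2) by simp
  qed
qed

lemma handshake:
  assumes "finite F" "finite U" "\<And>e. e \<in> F \<Longrightarrow> e \<subseteq> U \<and> card e = 2"
  shows "(\<Sum>v\<in>U. card {e \<in> F. v \<in> e}) = 2 * card F"
proof -
  have "(\<Sum>v\<in>U. card {e \<in> F. v \<in> e}) = (\<Sum>v\<in>U. \<Sum>e\<in>F. if v \<in> e then 1 else 0)"
    using assms(1) by (simp add: sum.inter_filter[symmetric])
  also have "\<dots> = (\<Sum>e\<in>F. \<Sum>v\<in>U. if v \<in> e then 1 else 0)" by (rule sum.swap)
  also have "\<dots> = (\<Sum>e\<in>F. 2)"
  proof (rule sum.cong[OF refl])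
    fix e assume "e \<in> F"
    then have "{v \<in> U. v \<in> e} = e" "card e = 2" using assms(3) by blast+
    then show "(\<Sum>v\<in>U. if v \<in> e then 1 else 0) = (2 :: nat)" using assms(2) by (simp add: sum.inter_filter[symmetric])
  qed
  finally show ?thesis by simp
qed

context graph
begin

definition neighbour :: "'a \<Rightarrow> 'a \<Rightarrow> bool" where
  "neighbour u v \<longleftrightarrow> (u, v) \<in> arcs_ends G"

lemma neighbour_in_verts: "neighbour u v \<Longrightarrow> u \<in> verts G \<and> v \<in> verts G"
  unfolding neighbour_def arcs_ends_conv by auto

lemma neighbour_sym: "neighbour u v \<Longrightarrow> neighbour v u"
  unfolding neighbour_def using arcs_ends_symmetric[OF sym_arcs] by blast

lemma neighbour_irrefl: "\<not> neighbour v v"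
  unfolding neighbour_def arcs_ends_conv using no_loops by fastforce

lemma uedges_eq: "uedges G = {{u, v} | u v. neighbour u v}"
  unfolding uedges_def neighbour_def ..

lemma walk_of_arcs:
  assumes "u \<in> verts G" "successively neighbour (u # vs)"
  shows "\<exists>es. set es \<subseteq> arcs G \<and> cas u es (last (u # vs)) \<and> awalk_verts u es = u # vs"
  using assms
proof (induction vs arbitrary: u)
  case Nil
  then show ?case by (intro exI[of _ "[]"]) simp
next
  case (Cons v vs)
  then have uv: "neighbour u v" "successively neighbour (v # vs)" by auto
  then have "v \<in> verts G" using neighbour_in_verts by blast
  then obtain es where es: "set es \<subseteq> arcs G" "cas v es (last (v # vs))" "awalk_verts v es = v # vs"
    using Cons.IH uv(2) by blast
  obtain a where "a \<in> arcs G" "tail G a = u" "head G a = v"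
    using uv(1) unfolding neighbour_def arcs_ends_conv by auto
  then show ?case using es by (intro exI[of _ "a # es"]) auto
qed

text \<open>The girth is defined through closed walks of arcs, so the list of vertices is turned
  into such a walk.\<close>

lemma cycle_length:
  assumes "14 \<le> girth G" "set xs \<subseteq> verts G" "distinct xs" "3 \<le> length xs"
    "successively neighbour xs" "neighbour (last xs) (hd xs)"
  shows "14 \<le> length xs"
proof -
  obtain u vs where xs: "xs = u # vs" using assms(4) by (cases xs) auto
  have "successively neighbour (u # (vs @ [u]))"
    using assms(5,6) unfolding xs append_Cons[symmetric] successively_append_iff by simp
  then obtain es where es: "set es \<subseteq> arcs G" "cas u es u" "awalk_verts u es = u # (vs @ [u])"
    using walk_of_arcs[of u "vs @ [u]"] assms(2) xs by auto
  have l: "length es = length xs" using arg_cong[OF es(3), of length] length_awalk_verts[of u es] xs by simp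
  have "awalk u es u" unfolding awalk_def using es(1,2) assms(2) xs by simp
  moreover have "distinct (tl (awalk_verts u es))" "es \<noteq> []" using es(3) assms(3,4) xs l by auto
  ultimately have "pre_digraph.cycle G es" unfolding cycle_def by blast
  then have "girth G \<le> enat (length es)" unfolding Defs.girth_def using l assms(4) by (intro INF_lower) simp
  then have "14 \<le> enat (length es)" using assms(1) order_trans by blast
  then show ?thesis using l by (simp add: numeral_eq_enat)
qed

lemma card_edges_at:
  assumes "U \<subseteq> verts G"
  shows "card {e \<in> uedges G. v \<in> e \<and> e \<subseteq> U} = (if v \<in> U then card {u \<in> U. neighbour v u} else 0)"
proof (cases "v \<in> U")
  case True
  have "{e \<in> uedges G. v \<in> e \<and> e \<subseteq> U} = (\<lambda>u. {v, u}) ` {u \<in> U. neighbour v u}"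
    using True unfolding uedges_eq by (auto simp: insert_commute dest: neighbour_sym)
  moreover have "inj_on (\<lambda>u. {v, u}) {u \<in> U. neighbour v u}" by (auto simp: inj_on_def doubleton_eq_iff)
  ultimately show ?thesis using True by (simp add: card_image)
next
  case False
  then have none: "{e \<in> uedges G. v \<in> e \<and> e \<subseteq> U} = {}" by blast
  show ?thesis unfolding none using False by simp
qed

lemma uedge_card: "e \<in> uedges G \<Longrightarrow> card e = 2 \<and> e \<subseteq> verts G"
  unfolding uedges_eq using neighbour_irrefl neighbour_in_verts by (fastforce simp: card_2_iff)

text \<open>\<open>edge_bound\<close> with \<open>k = 14\<close> for the subgraph induced on
  \<open>U\<close> gives 12e < 14n; the degree sum is 2e.\<close>

lemma planar_sparse:
  assumes planar: "plane_drawing G p \<gamma>" and girth: "14 \<le> girth G" and U: "U \<subseteq> verts G" "U \<noteq> {}"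
  shows "3 * (\<Sum>v\<in>U. card {u \<in> U. neighbour v u}) < 7 * card U"
proof -
  define E where "E = {e \<in> uedges G. e \<subseteq> U}"
  have draw: "inj_on p (verts G)"
    "\<And>e. e \<in> uedges G \<Longrightarrow> Path_Connected.arc (\<gamma> e) \<and> {pathstart (\<gamma> e), pathfinish (\<gamma> e)} = p ` e \<and> path_image (\<gamma> e) \<inter> p ` verts G = p ` e"
    "\<And>e f. e \<in> uedges G \<Longrightarrow> f \<in> uedges G \<Longrightarrow> e \<noteq> f \<Longrightarrow> path_image (\<gamma> e) \<inter> path_image (\<gamma> f) \<subseteq> p ` (e \<inter> f)"
    using planar unfolding plane_drawing_def by simp_all
  have finU: "finite U" by (rule finite_subset[OF U(1) finite_verts])
  interpret plane_graph U E p \<gamma>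
  proof
    show "inj_on p U" by (rule inj_on_subset[OF draw(1) U(1)])
    fix e assume "e \<in> E"
    then have e: "e \<in> uedges G" "e \<subseteq> U" unfolding E_def by simp_all
    obtain a b where ab: "e = {a, b}" "neighbour a b" using e(1) unfolding uedges_eq by auto
    then have "a \<noteq> b" using neighbour_irrefl by auto
    then show "\<exists>u v. u \<in> U \<and> v \<in> U \<and> u \<noteq> v \<and> e = {u, v}" using ab(1) e(2) by (intro exI[of _ a] exI[of _ b]) simp
    show "Path_Connected.arc (\<gamma> e)" "{pathstart (\<gamma> e), pathfinish (\<gamma> e)} = p ` e" using draw(2)[OF e(1)] by simp_all
    have "path_image (\<gamma> e) \<inter> p ` U = (path_image (\<gamma> e) \<inter> p ` verts G) \<inter> p ` U"
      using image_mono[OF U(1), of p] by (simp only: Int_assoc Int_absorb1)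
    also have "\<dots> = p ` e" using draw(2)[OF e(1)] image_mono[OF e(2), of p] by (simp only: Int_absorb2)
    finally show "path_image (\<gamma> e) \<inter> p ` U = p ` e" .
    show "path_image (\<gamma> e) \<inter> path_image (\<gamma> f) \<subseteq> p ` (e \<inter> f)" if "f \<in> E" "e \<noteq> f" for f
      using draw(3)[OF e(1) _ that(2)] that(1) unfolding E_def by simp
  qed (rule finU)
  have "(14 - 2) * card E < 14 * card U"
  proof (rule edge_bound[OF U(2)])
    fix U' F assume U': "U' \<subseteq> U" "U' \<noteq> {}" and F: "F \<subseteq> E" and deg: "\<forall>v\<in>U'. 2 \<le> card {e \<in> F. v \<in> e \<and> e \<subseteq> U'}"
    have fin: "finite U'" "finite F" using finite_subset[OF U'(1) finU] finite_subset[OF F finite_E] by simp_all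
    let ?R = "\<lambda>x y. neighbour x y \<and> {x, y} \<in> F"
    have degR: "2 \<le> card {y \<in> U'. ?R x y}" if x: "x \<in> U'" for x
    proof -
      have "{e \<in> F. x \<in> e \<and> e \<subseteq> U'} \<subseteq> (\<lambda>y. {x, y}) ` {y \<in> U'. ?R x y}"
      proof
        fix e assume e: "e \<in> {e \<in> F. x \<in> e \<and> e \<subseteq> U'}"
        then have "e \<in> uedges G" using F unfolding E_def by auto
        then obtain a b where ab: "e = {a, b}" "neighbour a b" unfolding uedges_eq by auto
        then have "x = a \<or> x = b" using e by simp
        then show "e \<in> (\<lambda>y. {x, y}) ` {y \<in> U'. ?R x y}"
        proof
          assume "x = a" then show ?thesis using ab e by (intro image_eqI[of _ _ b]) auto
        next
          assume "x = b" then show ?thesis using ab e neighbour_sym by (intro image_eqI[of _ _ a]) (auto simp: insert_commute)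
        qed
      qed
      then have "card {e \<in> F. x \<in> e \<and> e \<subseteq> U'} \<le> card {y \<in> U'. ?R x y}"
        using fin(1) by (intro surj_card_le) auto
      then show ?thesis using bspec[OF deg x] by (rule order_trans[rotated])
    qed
    obtain xs where xs: "set xs \<subseteq> U'" "distinct xs" "3 \<le> length xs" "successively ?R xs" "?R (last xs) (hd xs)"
    proof (rule exists_cycle[OF fin(1) U'(2), of ?R])
      show "?R y x" if "?R x y" for x y using that neighbour_sym by (simp add: insert_commute)
      show "\<not> ?R x x" for x using neighbour_irrefl by simp
    qed (rule degR)
    have "successively neighbour xs" using xs(4) by (rule successively_mono) simp
    moreover have "set xs \<subseteq> verts G" using xs(1) U'(1) U(1) by (meson order_trans)
    ultimately have "14 \<le> length xs" using cycle_length[OF girth _ xs(2,3)] xs(5) by simp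
    also have "\<dots> \<le> card U'" using xs(1,2) fin(1) card_mono[of U' "set xs"] by (simp add: distinct_card)
    \<comment> \<open>Minimum degree two means at least as many edges as vertices.\<close>
    also have "\<dots> \<le> card F"
    proof -
      let ?F = "{e \<in> F. e \<subseteq> U'}"
      have "2 * card U' = (\<Sum>v\<in>U'. 2)" by simp
      also have "\<dots> \<le> (\<Sum>v\<in>U'. card {e \<in> ?F. v \<in> e})"
      proof (rule sum_mono)
        fix v assume v: "v \<in> U'"
        have "{e \<in> ?F. v \<in> e} = {e \<in> F. v \<in> e \<and> e \<subseteq> U'}" by blast
        then show "2 \<le> card {e \<in> ?F. v \<in> e}" using deg v by simp
      qed
      also have "\<dots> = 2 * card ?F"
        using fin F uedge_card unfolding E_def by (intro handshake) auto
      also have "\<dots> \<le> 2 * card F" using fin(2) by (simp add: card_mono)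
      finally show ?thesis by simp
    qed
    finally show "14 \<le> card F" .
  qed simp
  moreover have "(\<Sum>v\<in>U. card {u \<in> U. neighbour v u}) = 2 * card E"
  proof -
    have "(\<Sum>v\<in>U. card {u \<in> U. neighbour v u}) = (\<Sum>v\<in>U. card {e \<in> E. v \<in> e})"
    proof (rule sum.cong[OF refl])
      fix v assume "v \<in> U"
      moreover have "{e \<in> E. v \<in> e} = {e \<in> uedges G. v \<in> e \<and> e \<subseteq> U}" unfolding E_def by blast
      ultimately show "card {u \<in> U. neighbour v u} = card {e \<in> E. v \<in> e}" using card_edges_at[OF U(1), of v] by simp
    qed
    also have "\<dots> = 2 * card E"
      using finU finite_E uedge_card unfolding E_def by (intro handshake) auto
    finally show ?thesis .
  qed
  ultimately show ?thesis by simp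
qed

lemma out_degree_le: "out_degree G v \<le> card {u \<in> verts G. neighbour v u}"
  unfolding out_degree_def
proof (rule card_inj_on_le)
  show "inj_on (head G) (out_arcs G v)"
    using no_multi_arcs by (intro inj_onI) (auto simp: arc_to_ends_def)
  show "head G ` out_arcs G v \<subseteq> {u \<in> verts G. neighbour v u}"
    unfolding neighbour_def arcs_ends_conv by auto
qed simp

end

theorem theorem1p4:
  fixes G :: "('a, 'b) pre_digraph"
  assumes "graph G"
    and "planar G"
    and "min_degree G \<ge> 2"
    and "girth G \<ge> 14"
  shows "eq_chromatic_threshold G \<le> 3 \<and> (\<forall>n \<ge> 3. equitably_colorable G n)"
proof -
  interpret graph G by (rule assms(1))
  obtain p \<gamma> where draw: "plane_drawing G p \<gamma>" using assms(2) unfolding planar_def by blast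
  interpret S: sparse_graph "verts G" neighbour
  proof
    show "3 * (\<Sum>v\<in>W. card {u \<in> W. neighbour v u}) < 7 * card W" if "W \<subseteq> verts G" "W \<noteq> {}" for W
      by (rule planar_sparse[OF draw assms(4) that])
    show "14 \<le> length xs" if "set xs \<subseteq> verts G" "distinct xs" "3 \<le> length xs" "successively neighbour xs"
      "neighbour (last xs) (hd xs)" for xs
      by (rule cycle_length[OF assms(4) that])
  qed (use neighbour_sym neighbour_irrefl in auto)
  have deg: "2 \<le> card {u \<in> verts G. neighbour v u}" if "v \<in> verts G" for v
  proof -
    have "min_degree G \<le> out_degree G v" unfolding min_degree_def using that by (intro Min_le) auto
    then show ?thesis using assms(3) out_degree_le[of v] by linarith
  qed
  have all: "equitably_colorable G n" if n: "3 \<le> n" for n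
  proof -
    obtain c where "S.equitable (verts G) n c"
      using S.equitable_colouring_exists[OF n order_refl] deg by blast
    then have "equitable_coloring G n c"
      unfolding equitable_coloring_def proper_coloring_def color_class_def S.equitable_def S.proper_def
      using neighbour_in_verts unfolding neighbour_def by auto
    then show ?thesis unfolding equitably_colorable_def by blast
  qed
  then have "eq_chromatic_threshold G \<le> 3" unfolding eq_chromatic_threshold_def by (intro Least_le) blast
  then show ?thesis using all by blast
qed

end
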